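(* Let $0<\alpha<n$, $1<r\le r_0<\infty$, $1<p\le p_0<\infty$ with $\frac1{r_0}=\frac1{p_0}-\frac\alpha n$ and $\frac r{r_0}=\frac p{p_0}$, and let $a\in{\rm BMO}_{\rm dyadic}$. Write $u'=u/(u-1)$ for conjugate exponents. (i) The operator $I_{\alpha,{\rm dyadic}}$, originally defined on $L^{r_0'}$, is bounded from $\mathcal H^{r_0'}_{r'}$ to $\mathcal H^{p_0'}_{p'}$: there is $C>0$ with $\|I_{\alpha,{\rm dyadic}}f\|_{\mathcal H^{p_0'}_{p'}}\le C\|f\|_{\mathcal H^{r_0'}_{r'}}$ for all $f\in\mathcal H^{r_0'}_{r'}\cap L^{r_0'}$ (hence it extends to a bounded operator $\mathcal H^{r_0'}_{r'}\to\mathcal H^{p_0'}_{p'}$). (ii) The commutator $[a,I_{\alpha,{\rm dyadic}}]$, originally defined on $L^{r_0'}$, is likewise bounded from $\mathcal H^{r_0'}_{r'}$ to $\mathcal H^{p_0'}_{p'}$.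
   Context: Dyadic cubes: $Q_{jm}=\prod_{\nu=1}^n[m_\nu2^{-j},(m_\nu+1)2^{-j})$, $\mathcal D_j=\{Q_{jm}:m\in\mathbb Z^n\}$, $\mathcal D=\bigcup_j\mathcal D_j$. Haar functions: $h^{\epsilon_i}(t)=\chi_{[0,1)}(2t)+(-1)^{\epsilon_i}\chi_{[1,2)}(2t)$ for $\epsilon_i\in\{0,1\}$; $E=\{0,1\}^n\setminus\{(0,\dots,0)\}$; $h^\varepsilon(x)=\prod_i h^{\varepsilon_i}(x_i)$; $h^\varepsilon_{Q_{jm}}(x)=2^{jn/2}h^\varepsilon(2^jx-m)$. $\langle f,g\rangle=\int fg$, $m_Q(f)=|Q|^{-1}\int_Qf$. Dyadic BMO: $M^{\sharp,{\rm dyadic}}a(x)=\sup_{Q\in\mathcal D,\,x\in Q}m_Q(|a-m_Q(a)|)$, $a\in{\rm BMO}_{\rm dyadic}$ iff $a\in L^1_{\rm loc}$ and $\|M^{\sharp,{\rm dyadic}}a\|_{L^\infty}<\infty$. Dyadic fractional integral: $I_{\alpha,{\rm dyadic}}f=\sum_{\varepsilon\in E}\sum_{j\in\mathbb Z}\sum_{Q\in\mathcal D_j}|Q|^{\alpha/n}\langle f,h^\varepsilon_Q\rangle h^\varepsilon_Q$ (limit of partial sums over $-M\le j\le M$); commutator $[a,I_{\alpha,{\rm dyadic}}]f=a\,I_{\alpha,{\rm dyadic}}f-I_{\alpha,{\rm dyadic}}[af]$, understood as $\lim_{M}\sum_{\varepsilon}\sum_{j=-M}^M\sum_{Q\in\mathcal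 D_j}\langle a I_{\alpha,{\rm dyadic}}f-I_{\alpha,{\rm dyadic}}[af],h^\varepsilon_Q\rangle h^\varepsilon_Q$. Block spaces (preduals of Morrey spaces): for $1<u\le v<\infty$, a function $A\in L^v$ is a $(u,v)$-block if there is $Q\in\mathcal D$ with ${\rm supp}\,A\subset Q$ and $\|A\|_{L^v}\le|Q|^{1/v-1/u}$; $\mathcal H^u_v$ is the set of $f=\sum_{j\ge1}\lambda_ja_j$ with $\sum_j|\lambda_j|<\infty$ and each $a_j$ a $(u,v)$-block, normed by $\|f\|_{\mathcal H^u_v}=\inf\sum_j|\lambda_j|$ over all such decompositions. *)

theory Defs
  imports "HOL-Analysis.Analysis"
begin

definition dcube :: "int \<Rightarrow> int^'n \<Rightarrow> (real^'n) set" where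
  "dcube j m = {x. \<forall>i. real_of_int (m$i) * 2 powr (- real_of_int j) \<le> x$i
                      \<and> x$i < (real_of_int (m$i) + 1) * 2 powr (- real_of_int j)}"

definition dyadic_cubes :: "(real^'n) set set" where
  "dyadic_cubes = {dcube j m | j m. True}"

text \<open>One-dimensional Haar function; the boolean e encodes epsilon_i (True = 1).\<close>
definition haar1 :: "bool \<Rightarrow> real \<Rightarrow> real" where
  "haar1 e t = indicator {0..<1} (2*t) + (if e then -1 else 1) * indicator {1..<2} (2*t)"

definition haar_E :: "('n \<Rightarrow> bool) set" where
  "haar_E = {e. e \<noteq> (\<lambda>_. False)}"

definition haar :: "('n::finite \<Rightarrow> bool) \<Rightarrow> real^'n \<Rightarrow> real" where
  "haar e x = (\<Prod>i\<in>UNIV. haar1 (e i) (x$i))"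

definition haarQ :: "int \<Rightarrow> int^'n::finite \<Rightarrow> ('n \<Rightarrow> bool) \<Rightarrow> real^'n \<Rightarrow> real" where
  "haarQ j m e x = 2 powr (real_of_int j * real CARD('n) / 2)
      * haar e ((2 powr real_of_int j) *\<^sub>R x - (\<chi> i. real_of_int (m$i)))"

definition pairing :: "(real^'n::finite \<Rightarrow> real) \<Rightarrow> (real^'n \<Rightarrow> real) \<Rightarrow> real" where
  "pairing f g = (\<integral>x. f x * g x \<partial>lebesgue)"

definition haar_partial ::
  "(int \<Rightarrow> int^'n::finite \<Rightarrow> ('n \<Rightarrow> bool) \<Rightarrow> real) \<Rightarrow> nat \<Rightarrow> real^'n \<Rightarrow> real" where
  "haar_partial c M x = (\<Sum>e\<in>haar_E. \<Sum>j\<in>{- int M..int M}.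
       (\<Sum>\<^sub>\<infinity>m. c j m e * haarQ j m e x))"

definition fracint_dyadic :: "real \<Rightarrow> (real^'n::finite \<Rightarrow> real) \<Rightarrow> real^'n \<Rightarrow> real" where
  "fracint_dyadic \<alpha> f x = lim (\<lambda>M. haar_partial
      (\<lambda>j m e. measure lebesgue (dcube j m) powr (\<alpha> / real CARD('n)) * pairing f (haarQ j m e)) M x)"

definition commutator_dyadic ::
  "(real^'n::finite \<Rightarrow> real) \<Rightarrow> real \<Rightarrow> (real^'n \<Rightarrow> real) \<Rightarrow> real^'n \<Rightarrow> real" where
  "commutator_dyadic a \<alpha> f x = lim (\<lambda>M. haar_partial
      (\<lambda>j m e. pairing (\<lambda>y. a y * fracint_dyadic \<alpha> f y - fracint_dyadic \<alpha> (\<lambda>y. a y * f y) y)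
                       (haarQ j m e)) M x)"

definition cube_avg :: "(real^'n) set \<Rightarrow> (real^'n \<Rightarrow> real) \<Rightarrow> real" where
  "cube_avg Q f = (LINT x:Q|lebesgue. f x) / measure lebesgue Q"

definition sharp_dyadic :: "(real^'n \<Rightarrow> real) \<Rightarrow> real^'n \<Rightarrow> ereal" where
  "sharp_dyadic a x = (SUP Q\<in>{Q\<in>dyadic_cubes. x \<in> Q}.
       ereal (cube_avg Q (\<lambda>y. \<bar>a y - cube_avg Q a\<bar>)))"

definition L1_loc :: "(real^'n::finite \<Rightarrow> real) \<Rightarrow> bool" where
  "L1_loc a \<longleftrightarrow> a \<in> borel_measurable lebesgue \<and> (\<forall>K. compact K \<longrightarrow> set_integrable lebesgue K a)"

definition dyadic_BMO :: "(real^'n::finite \<Rightarrow> real) \<Rightarrow> bool" where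
  "dyadic_BMO a \<longleftrightarrow> L1_loc a \<and> (\<exists>K::real. AE x in lebesgue. sharp_dyadic a x \<le> ereal K)"

definition Lp_mem :: "real \<Rightarrow> (real^'n::finite \<Rightarrow> real) \<Rightarrow> bool" where
  "Lp_mem p f \<longleftrightarrow> f \<in> borel_measurable lebesgue \<and> integrable lebesgue (\<lambda>x. \<bar>f x\<bar> powr p)"

definition Lp_norm :: "real \<Rightarrow> (real^'n::finite \<Rightarrow> real) \<Rightarrow> real" where
  "Lp_norm p f = (\<integral>x. \<bar>f x\<bar> powr p \<partial>lebesgue) powr (1/p)"

definition is_block :: "real \<Rightarrow> real \<Rightarrow> (real^'n::finite \<Rightarrow> real) \<Rightarrow> bool" where
  "is_block u v A \<longleftrightarrow> Lp_mem v A \<and> (\<exists>Q\<in>dyadic_cubes. {x. A x \<noteq> 0} \<subseteq> Q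
       \<and> Lp_norm v A \<le> measure lebesgue Q powr (1/v - 1/u))"

definition block_decomp ::
  "real \<Rightarrow> real \<Rightarrow> (real^'n::finite \<Rightarrow> real) \<Rightarrow> (nat \<Rightarrow> real) \<Rightarrow> (nat \<Rightarrow> real^'n \<Rightarrow> real) \<Rightarrow> bool" where
  "block_decomp u v f lam A \<longleftrightarrow> summable (\<lambda>j. \<bar>lam j\<bar>) \<and> (\<forall>j. is_block u v (A j))
      \<and> (AE x in lebesgue. (\<lambda>j. lam j * A j x) sums f x)"

definition in_block_space :: "real \<Rightarrow> real \<Rightarrow> (real^'n::finite \<Rightarrow> real) \<Rightarrow> bool" where
  "in_block_space u v f \<longleftrightarrow> (\<exists>lam A. block_decomp u v f lam A)"

definition block_norm :: "real \<Rightarrow> real \<Rightarrow> (real^'n::finite \<Rightarrow> real) \<Rightarrow> real" where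
  "block_norm u v f = Inf {(\<Sum>j. \<bar>lam j\<bar>) | lam A. block_decomp u v f lam A}"

definition conj_exp :: "real \<Rightarrow> real" where
  "conj_exp u = u / (u - 1)"

end

theory Submission
  imports Defs
begin

text \<open>
  Write \<open>E\<^sub>j\<close> for averaging over the dyadic cubes of level \<open>j\<close>. The Haar projection of level \<open>j\<close> is
  \<open>E\<^sub>j\<^sub>+\<^sub>1 - E\<^sub>j\<close>, so Abel summation turns the fractional integral into
  \<open>(2\<^sup>\<alpha> - 1) \<Sum>\<^sub>j 2\<^sup>-\<^sup>j\<^sup>\<alpha> E\<^sub>j f\<close>; the boundary terms vanish by dyadic Lebesgue differentiation and by the
  growth bounds for block spaces and BMO. Consequently the fractional integral and the commutator
  are dominated by \<open>\<Sum>\<^sub>j 2\<^sup>-\<^sup>j\<^sup>\<alpha> b\<^sub>j E\<^sub>j(b\<^sub>j |f|)\<close> with \<open>b\<^sub>j = 1 + |a - E\<^sub>j a|\<close>, whose moments are bounded by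
  the John--Nirenberg inequality. This majorant is sublinear and block spaces are solid, so it is
  enough to decompose the majorant of a single block \<open>A\<close> on a cube \<open>Q\<^sub>0\<close>.

  The cubes containing \<open>Q\<^sub>0\<close> contribute one block each, with geometrically decaying coefficients.
  On \<open>Q\<^sub>0\<close> itself a single block does not suffice, since \<open>1/r' - 1/p'\<close> may exceed \<open>\<alpha>/n\<close>. There
  \<open>Q\<^sub>0\<close> is cut along the level sets of the fractional maximal function
  \<open>sup\<^sub>Q |Q|\<^sup>-\<^sup>\<kappa> \<integral>\<^sub>Q |A|\<^sup>r\<^sup>'\<close> with \<open>\<kappa> = 1 - p/p\<^sub>0\<close>. On the \<open>k\<close>-th level set, Hedberg's trick and the
  maximal theorem bound the \<open>L\<^sup>p\<^sup>'\<close> norm of the majorant, while the maximal cubes of that set have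
  content \<open>\<Sum>|Q|\<^sup>\<kappa> \<le> 2\<^sup>-\<^sup>k |Q\<^sub>0|\<^sup>\<kappa>\<close>; one block per maximal cube then costs a multiple of
  \<open>2\<^sup>-\<^sup>k\<^sup>/\<^sup>r\<close> in total.
\<close>

section \<open>Dyadic cubes and averages\<close>

text \<open>Block spaces are preduals of Morrey spaces, and part (i) is the predual form of Adams's
  theorem on fractional integrals. The hypothesis r/r0 = p/p0 says that source and target share one
  number \<kappa>: both 1/r0' and 1/p0' arise from 1/r' and 1/p' by the map x -> \<kappa> + (1 -
  \<kappa>) x. Hence 1/r' - 1/p' equals \<alpha>/(n(1 - \<kappa>)), more than the Sobolev gap
  \<alpha>/n as soon as \<kappa> > 0, and no mapping property from L^r' to L^p' on a single cube can
  produce the block. What helps is that a function concentrated on cubes of small \<kappa>-content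
  is cheap in the target space. The budget per level set is as follows. Doubling the threshold
  halves the content, which gains 2^(-(1 - 1/p')), while Hedberg's trick with the weaker stopping
  bound loses 2^(1/r' - 1/p'). The product is 2^(-(1 - 1/r')) = 2^(-1/r), so the levels can be
  summed exactly because r' > 1. The weights coming from \<open>a\<close> are unbounded, so they are
  never estimated pointwise: Hoelder's inequality puts them into a high moment t, and the price is
  that A is averaged in L^s with s slightly above 1.\<close>

definition cidx :: "int \<Rightarrow> real^'n \<Rightarrow> int^'n" where
  "cidx j x = (\<chi> i. \<lfloor>2 powr real_of_int j * x$i\<rfloor>)"

text \<open>Cubes are addressed by one of their points, as fibres of \<open>cidx j\<close>.
  Nestedness, disjointness and measurability then become statements about integer vectors. A larger
  j means a finer level.\<close>

definition cube :: "int \<Rightarrow> real^'n \<Rightarrow> (real^'n) set" where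
  "cube j x = {y. cidx j y = cidx j x}"

abbreviation vol :: "'n::finite itself \<Rightarrow> int \<Rightarrow> real" where
  "vol n j \<equiv> 2 powr (- real_of_int j * real CARD('n))"

lemma mem_cube: "y \<in> cube j x \<longleftrightarrow> cidx j y = cidx j x"
  by (simp add: cube_def)

lemma cube_refl [simp]: "x \<in> cube j x"
  by (simp add: mem_cube)

lemma cube_eq: "y \<in> cube j x \<Longrightarrow> cube j y = cube j x"
  by (simp add: cube_def)

lemma mem_dcube: "y \<in> dcube j m \<longleftrightarrow> cidx j y = m"
proof -
  have *: "(real_of_int k * 2 powr (- real_of_int j) \<le> t \<and> t < (real_of_int k + 1) * 2 powr (- real_of_int j))
     \<longleftrightarrow> \<lfloor>2 powr real_of_int j * t\<rfloor> = k" for k t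
    by (simp add: floor_eq_iff powr_minus field_simps)
  show ?thesis
    unfolding dcube_def mem_Collect_eq * by (auto simp: cidx_def vec_eq_iff)
qed

lemma cube_eq_dcube: "cube j x = dcube j (cidx j x)"
  by (auto simp: mem_cube mem_dcube)

lemma dcube_eq_cube: "\<exists>x. dcube j m = cube j x"
proof
  have "cidx j (\<chi> i. real_of_int (m$i) * 2 powr (- real_of_int j)) = m"
    by (simp add: cidx_def vec_eq_iff mult.left_commute flip: powr_add)
  then show "dcube j m = cube j (\<chi> i. real_of_int (m$i) * 2 powr (- real_of_int j))"
    by (simp add: cube_eq_dcube)
qed

lemma dyadic_cubes_iff: "Q \<in> dyadic_cubes \<longleftrightarrow> (\<exists>j x. Q = cube j x)"
  unfolding dyadic_cubes_def using dcube_eq_cube cube_eq_dcube by blast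

text \<open>Halving commutes with the floor up to integer division, so a coarse index is a function
  of the next finer one; nestedness of the cubes is read off from this.\<close>

lemma cidx_Suc: "cidx j x $ i = cidx (j+1) x $ i div 2"
proof -
  have "2 powr real_of_int j * x$i = (2 powr real_of_int (j+1) * x$i) / real_of_int 2"
    by (simp add: powr_add)
  then show ?thesis
    unfolding cidx_def vec_lambda_beta by (simp only: floor_divide_real_eq_div)
qed

lemma cube_mono: "j \<le> k \<Longrightarrow> cube k x \<subseteq> cube j x"
proof (induction k rule: int_ge_induct)
  case (step i)
  have "cube (i+1) x \<subseteq> cube i x"
    by (simp add: subset_iff mem_cube vec_eq_iff cidx_Suc[of i])
  with step show ?case by blast
qed simp

lemma measurable_cidx [measurable]: "cidx j \<in> lebesgue \<rightarrow>\<^sub>M count_space UNIV"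
proof -
  have "cidx j -` {m} \<inter> space lebesgue \<in> sets lebesgue" for m :: "int^'n"
  proof -
    have [measurable]: "(\<lambda>x::real^'n. 2 powr real_of_int j * x$i) \<in> borel_measurable borel" for i
      by measurable
    have "{x::real^'n. \<forall>i. \<lfloor>2 powr real_of_int j * x$i\<rfloor> = m$i} \<in> sets borel"
      by measurable
    moreover have "cidx j -` {m} \<inter> space lebesgue = {x. \<forall>i. \<lfloor>2 powr real_of_int j * x$i\<rfloor> = m$i}"
      by (auto simp: cidx_def vec_eq_iff)
    ultimately show ?thesis by simp
  qed
  then show ?thesis
    by (intro measurable_count_space_eq2_countable[THEN iffD2]) auto
qed

lemma cube_sets [measurable]: "cube j x \<in> sets lebesgue"
proof -
  have "cube j x = cidx j -` {cidx j x} \<inter> space lebesgue" by (auto simp: cube_def)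
  then show ?thesis using measurable_sets[OF measurable_cidx, of "{cidx j x}"] by simp
qed

lemma emeasure_cube: "emeasure lebesgue (cube j (x::real^'n)) = ennreal (vol TYPE('n) j)"
proof -
  define l :: "real^'n" where "l = (\<chi> i. real_of_int (cidx j x$i) * 2 powr (- real_of_int j))"
  define r :: "real^'n" where "r = (\<chi> i. (real_of_int (cidx j x$i) + 1) * 2 powr (- real_of_int j))"
  have lr: "l$i \<le> r$i" for i by (simp add: l_def r_def field_simps)
  have c: "cube j x = {y. \<forall>i. l$i \<le> y$i \<and> y$i < r$i}"
    unfolding cube_eq_dcube dcube_def l_def r_def by simp
  \<comment> \<open>The half-open cube lies between the open and the closed box with the same
    corners, and these have equal measure.\<close>
  have 1: "box l r \<subseteq> cube j x" "cube j x \<subseteq> cbox l r"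
    unfolding c by (auto simp: mem_box_cart less_imp_le)
  have pr: "(\<Prod>b\<in>Basis. (r - l) \<bullet> b) = vol TYPE('n) j"
  proof -
    have "(\<Prod>b\<in>Basis. (r - l) \<bullet> b) = (\<Prod>i\<in>(UNIV::'n set). (r-l)$i)"
    proof -
      have B: "(Basis::(real^'n) set) = (\<lambda>i. axis i 1) ` UNIV" by (auto simp: Basis_vec_def)
      show ?thesis
        unfolding B by (subst prod.reindex) (auto simp: inj_on_def axis_eq_axis inner_axis)
    qed
    also have "\<dots> = (\<Prod>i\<in>(UNIV::'n set). 2 powr (- real_of_int j))"
      by (rule prod.cong) (auto simp: l_def r_def algebra_simps)
    also have "\<dots> = vol TYPE('n) j"
    proof -
      have "(2 powr (- real_of_int j)) ^ CARD('n) = (2 powr (- real_of_int j)) powr real CARD('n)"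
        by (rule powr_realpow[symmetric]) simp
      then show ?thesis by (simp add: powr_powr)
    qed
    finally show ?thesis .
  qed
  have lrB: "l \<bullet> b \<le> r \<bullet> b" if "b \<in> Basis" for b
    using that lr by (auto simp: Basis_vec_def inner_axis)
  have "emeasure lebesgue (cbox l r) = ennreal (vol TYPE('n) j)"
    using lrB by (simp add: emeasure_lborel_cbox pr)
  moreover have "emeasure lebesgue (box l r) = ennreal (vol TYPE('n) j)"
    using lrB by (simp add: emeasure_lborel_box pr)
  ultimately show ?thesis
    using emeasure_mono[OF 1(1), of lebesgue] emeasure_mono[OF 1(2), of lebesgue] by (simp add: antisym)
qed

lemma measure_cube: "measure lebesgue (cube j (x::real^'n)) = vol TYPE('n) j"
  using emeasure_cube[of j x] by (simp add: measure_def)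

section \<open>Functions constant on the cubes of a level, and averages as conditional
  expectations\<close>

definition cinv :: "int \<Rightarrow> (real^'n::finite \<Rightarrow> 'b) \<Rightarrow> bool" where
  "cinv j g \<longleftrightarrow> (\<forall>x y. y \<in> cube j x \<longrightarrow> g y = g x)"

lemma cinvD: "cinv j g \<Longrightarrow> y \<in> cube j x \<Longrightarrow> g y = g x"
  by (auto simp: cinv_def)

lemma cinv_mono: "cinv j g \<Longrightarrow> j \<le> k \<Longrightarrow> cinv k g"
  unfolding cinv_def using cube_mono by blast

text \<open>Such a function factors through \<open>cidx j\<close>, and every function on the
  discrete space of indices is measurable.\<close>

lemma cinv_measurable:
  fixes g :: "real^'n::finite \<Rightarrow> 'b"
  assumes "cinv j g" shows "g \<in> lebesgue \<rightarrow>\<^sub>M N \<longleftrightarrow> range g \<subseteq> space N"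
proof
  assume r: "range g \<subseteq> space N"
  define G where "G m = g (SOME x. cidx j x = m)" for m :: "int^'n"
  have "g = (\<lambda>x. G (cidx j x))"
  proof
    fix x :: "real^'n"
    have "cidx j (SOME y. cidx j y = cidx j x) = cidx j x" by (rule someI) simp
    then show "g x = G (cidx j x)"
      unfolding G_def using cinvD[OF assms] by (metis mem_cube)
  qed
  moreover have "(\<lambda>x. G (cidx j x)) \<in> lebesgue \<rightarrow>\<^sub>M N"
    by (rule measurable_compose[OF measurable_cidx]) (use r in \<open>auto simp: G_def\<close>)
  ultimately show "g \<in> lebesgue \<rightarrow>\<^sub>M N" by simp
qed (auto dest: measurable_space)

lemma cinv_borel: "cinv j g \<Longrightarrow> g \<in> borel_measurable lebesgue"
  by (simp add: cinv_measurable)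

text \<open>The conditional expectation with respect to the cubes of level j, with
  \<open>cinv j\<close> in the role of measurability. Values in ennreal keep monotonicity, countable
  additivity and Tonelli free of integrability conditions.\<close>

definition dav :: "int \<Rightarrow> (real^'n::finite \<Rightarrow> ennreal) \<Rightarrow> real^'n \<Rightarrow> ennreal" where
  "dav j f x = ennreal (2 powr (real_of_int j * real CARD('n))) * (\<integral>\<^sup>+y\<in>cube j x. f y \<partial>lebesgue)"

lemma cinv_dav: "cinv j (dav j f)"
  unfolding cinv_def dav_def by (auto dest: cube_eq)

lemma dav_measurable [measurable]: "dav j f \<in> borel_measurable lebesgue"
  by (rule cinv_borel[OF cinv_dav])

lemma dav_mono: "(\<And>y. y \<in> cube j x \<Longrightarrow> f y \<le> g y) \<Longrightarrow> dav j f x \<le> dav j g x"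
  unfolding dav_def by (intro mult_left_mono nn_integral_mono) (auto simp: indicator_def)

lemma dav_mono_AE: "AE y in lebesgue. f y \<le> g y \<Longrightarrow> dav j f x \<le> dav j g x"
  unfolding dav_def by (intro mult_left_mono nn_integral_mono_AE) (auto simp: indicator_def)

lemma dav_cong: "(\<And>y. y \<in> cube j x \<Longrightarrow> f y = g y) \<Longrightarrow> dav j f x = dav j g x"
  by (intro antisym dav_mono) auto

lemma dav_cmult:
  "f \<in> borel_measurable lebesgue \<Longrightarrow> dav j (\<lambda>y. c * f y) x = c * dav j f x"
  unfolding dav_def by (subst mult.assoc, subst nn_integral_cmult) (auto simp: mult.left_commute)

lemma dav_add:
  "f \<in> borel_measurable lebesgue \<Longrightarrow> g \<in> borel_measurable lebesgue \<Longrightarrow>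
    dav j (\<lambda>y. f y + g y) x = dav j f x + dav j g x"
  unfolding dav_def distrib_right by (subst nn_integral_add) (auto simp: distrib_left)

lemma dav_suminf:
  assumes [measurable]: "\<And>i. f i \<in> borel_measurable lebesgue"
  shows "dav j (\<lambda>y. \<Sum>i. f i y) x = (\<Sum>i. dav j (f i) x)"
  unfolding dav_def ennreal_suminf_multc[symmetric] by (subst nn_integral_suminf) auto

lemma dav_mult_cinv:
  assumes "f \<in> borel_measurable lebesgue" "cinv j g"
  shows "dav j (\<lambda>y. g y * f y) x = g x * dav j f x"
proof -
  have "dav j (\<lambda>y. g y * f y) x = dav j (\<lambda>y. g x * f y) x"
    by (rule dav_cong) (simp add: cinvD[OF assms(2)])
  then show ?thesis using assms(1) by (simp add: dav_cmult)
qed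

lemma dav_const [simp]: "dav j (\<lambda>y. c) x = c"
proof -
  have "dav j (\<lambda>y. c) x = c * (ennreal (2 powr (real_of_int j * real CARD('a))) * ennreal (2 powr (- real_of_int j * real CARD('a))))"
    unfolding dav_def by (simp add: nn_integral_cmult_indicator emeasure_cube mult_ac)
  also have "\<dots> = c"
    by (simp flip: ennreal_mult powr_add)
  finally show ?thesis .
qed

lemma dav_cinv: "cinv j g \<Longrightarrow> dav j g x = g x"
  using dav_mult_cinv[of "\<lambda>_. 1" j g x] by simp

lemma vol_dav: "(\<integral>\<^sup>+y\<in>cube j (x::real^'n). f y \<partial>lebesgue) = ennreal (vol TYPE('n) j) * dav j f x"
proof -
  have "ennreal (vol TYPE('n) j) * ennreal (2 powr (real_of_int j * real CARD('n))) = 1"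
    by (simp flip: ennreal_mult powr_add)
  then show ?thesis unfolding dav_def by (simp only: mult.assoc[symmetric] mult_1)
qed

lemma sigma_finite_lebesgue: "sigma_finite_measure (lebesgue :: 'a::euclidean_space measure)"
proof
  show "\<exists>A::'a set set. countable A \<and> A \<subseteq> sets lebesgue \<and> \<Union>A = space lebesgue \<and> (\<forall>a\<in>A. emeasure lebesgue a \<noteq> \<infinity>)"
  proof (intro exI conjI)
    let ?A = "range (\<lambda>n::nat. cball (0::'a) (real n))"
    show "countable ?A" "?A \<subseteq> sets lebesgue" by auto
    show "\<Union>?A = space lebesgue" using real_arch_simple by (auto simp: dist_norm)
    show "\<forall>a\<in>?A. emeasure lebesgue a \<noteq> \<infinity>"
      using emeasure_bounded_finite[OF bounded_cball, of "0::'a"] by (auto simp: less_top[symmetric])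
  qed
qed

text \<open>Tonelli: averaging is integration against the kernel that tests
  \<open>cidx j x = cidx j y\<close>, which is symmetric in x and y.\<close>

lemma dav_adjoint:
  fixes f g :: "real^'n::finite \<Rightarrow> ennreal"
  assumes [measurable]: "f \<in> borel_measurable lebesgue" "g \<in> borel_measurable lebesgue"
  shows "(\<integral>\<^sup>+x. dav j f x * g x \<partial>lebesgue) = (\<integral>\<^sup>+x. f x * dav j g x \<partial>lebesgue)"
proof -
  interpret P: pair_sigma_finite "lebesgue :: (real^'n) measure" "lebesgue :: (real^'n) measure"
    by (simp add: pair_sigma_finite_def sigma_finite_lebesgue)
  let ?c = "ennreal (2 powr (real_of_int j * real CARD('n)))"
  have [measurable]: "{z \<in> space (lebesgue \<Otimes>\<^sub>M lebesgue). cidx j (snd z) = cidx j (fst z :: real^'n)} \<in> sets (lebesgue \<Otimes>\<^sub>M lebesgue)"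
    by measurable
  have *: "(\<lambda>(x,y). f y * indicator (cube j x) y * g x) \<in> borel_measurable (lebesgue \<Otimes>\<^sub>M lebesgue)"
  proof -
    have "(\<lambda>(x,y). f y * indicator (cube j x) y * g x) =
      (\<lambda>z. f (snd z) * indicator {z \<in> space (lebesgue \<Otimes>\<^sub>M lebesgue). cidx j (snd z) = cidx j (fst z)} z * g (fst z))"
      by (auto simp: fun_eq_iff indicator_def mem_cube space_pair_measure)
    then show ?thesis by simp
  qed
  have "(\<integral>\<^sup>+x. dav j f x * g x \<partial>lebesgue) = (\<integral>\<^sup>+x. ?c * (\<integral>\<^sup>+y. f y * indicator (cube j x) y * g x \<partial>lebesgue) \<partial>lebesgue)"
    by (intro nn_integral_cong) (simp only: dav_def mult.assoc, subst mult.assoc[symmetric], subst nn_integral_multc, simp_all add: mult.assoc)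
  also have "\<dots> = ?c * (\<integral>\<^sup>+x. \<integral>\<^sup>+y. f y * indicator (cube j x) y * g x \<partial>lebesgue \<partial>lebesgue)"
    by (rule nn_integral_cmult) (use sigma_finite_measure.borel_measurable_nn_integral_fst[OF sigma_finite_lebesgue *] in simp)
  also have "\<dots> = ?c * (\<integral>\<^sup>+y. \<integral>\<^sup>+x. f y * indicator (cube j x) y * g x \<partial>lebesgue \<partial>lebesgue)"
    using P.Fubini'[OF *] by simp
  also have "\<dots> = ?c * (\<integral>\<^sup>+y. f y * (\<integral>\<^sup>+x. g x * indicator (cube j y) x \<partial>lebesgue) \<partial>lebesgue)"
    by (intro arg_cong2[of _ _ _ _ "(*)"] refl nn_integral_cong, subst nn_integral_cmult[symmetric])
       (auto intro!: nn_integral_cong simp: indicator_def mem_cube mult_ac)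
  also have "\<dots> = (\<integral>\<^sup>+x. f x * dav j g x \<partial>lebesgue)"
  proof -
    have [measurable]: "(\<lambda>y. \<integral>\<^sup>+x. g x * indicator (cube j y) x \<partial>lebesgue) \<in> borel_measurable lebesgue"
      by (rule cinv_borel[of j]) (auto simp: cinv_def dest: cube_eq)
    show ?thesis
      by (subst nn_integral_cmult[symmetric]) (auto simp: dav_def mult_ac)
  qed
  finally show ?thesis .
qed

text \<open>Self-adjointness moves the finer average onto the indicator of the coarser cube, which
  is constant on the finer cubes and therefore unchanged.\<close>

lemma dav_tower:
  fixes f :: "real^'n::finite \<Rightarrow> ennreal"
  assumes [measurable]: "f \<in> borel_measurable lebesgue" and "i \<le> j"
  shows "dav i (dav j f) x = dav i f x"
proof -
  have c: "cinv j (indicator (cube i x) :: _ \<Rightarrow> ennreal)"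
    unfolding cinv_def
  proof (intro allI impI)
    fix y z :: "real^'n" assume "z \<in> cube j y"
    then have "cube i z = cube i y" using cube_mono[OF \<open>i \<le> j\<close>] cube_eq by blast
    then have "z \<in> cube i x \<longleftrightarrow> y \<in> cube i x" by (metis cube_eq cube_refl)
    then show "(indicator (cube i x) z :: ennreal) = indicator (cube i x) y" by (simp add: indicator_def)
  qed
  have "(\<integral>\<^sup>+y. dav j f y * indicator (cube i x) y \<partial>lebesgue) = (\<integral>\<^sup>+y. f y * dav j (indicator (cube i x)) y \<partial>lebesgue)"
    by (rule dav_adjoint) auto
  then show ?thesis
    by (simp add: dav_def[of i] dav_cinv[OF c])
qed

lemma nn_integral_dav_cinv:
  assumes [measurable]: "f \<in> borel_measurable lebesgue" and "cinv j g"
  shows "(\<integral>\<^sup>+x. dav j f x * g x \<partial>lebesgue) = (\<integral>\<^sup>+x. f x * g x \<partial>lebesgue)"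
  using dav_adjoint[OF assms(1) cinv_borel[OF assms(2)], of j] by (simp add: dav_cinv[OF assms(2)])

lemma nn_integral_dav:
  assumes [measurable]: "f \<in> borel_measurable lebesgue"
  shows "(\<integral>\<^sup>+x. dav j f x \<partial>lebesgue) = (\<integral>\<^sup>+x. f x \<partial>lebesgue)"
  using nn_integral_dav_cinv[OF assms, of j "\<lambda>_. 1"] by (simp add: cinv_def)

text \<open>Young's inequality for f/X and g/Y, with the factors 1/p and 1/q bounded by 1. The free
  scales X and Y are what lets one inequality stand in for Hoelder's inequality, both for integrals
  and for sums, and set up an absorption.\<close>

lemma young_weighted:
  fixes f g X Y p q :: real
  assumes "p > 1" "1/p + 1/q = 1" "f \<ge> 0" "g \<ge> 0" "X > 0" "Y > 0"
  shows "f * g \<le> X * Y * ((f powr p) * X powr (-p) + (g powr q) * Y powr (-q))"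
proof -
  have q: "q > 1"
  proof -
    have "1/p < 1" "1/p > 0" using assms(1) by auto
    then have "1/q > 0" "1/q < 1" using assms(2) by linarith+
    then show ?thesis by (auto simp: zero_less_divide_iff divide_less_eq_1)
  qed
  have "(f/X) * (g/Y) \<le> (f/X) powr p / p + (g/Y) powr q / q"
    by (rule Youngs_inequality) (use assms q in auto)
  also have "\<dots> \<le> (f/X) powr p + (g/Y) powr q"
    using assms q by (intro add_mono) (simp_all add: divide_le_eq mult_le_cancel_left1)
  finally have "X * Y * ((f/X) * (g/Y)) \<le> X * Y * ((f/X) powr p + (g/Y) powr q)"
    using assms by (intro mult_left_mono) auto
  moreover have "X * Y * ((f/X) * (g/Y)) = f * g" using assms by simp
  moreover have "(f/X) powr p = f powr p * X powr (-p)" "(g/Y) powr q = g powr q * Y powr (-q)"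
    using assms by (simp_all add: powr_divide powr_minus_divide)
  ultimately show ?thesis by simp
qed

text \<open>The factor 2 saves the normalisation argument: it suffices to integrate Young's inequality.\<close>

lemma dav_holder:
  fixes f g :: "real^'n::finite \<Rightarrow> real"
  assumes [measurable]: "f \<in> borel_measurable lebesgue" "g \<in> borel_measurable lebesgue"
    and "\<And>x. f x \<ge> 0" "\<And>x. g x \<ge> 0" and p: "p > 1" "1/p + 1/q = 1"
    and X: "dav j (\<lambda>y. ennreal (f y powr p)) x \<le> ennreal (X powr p)" "X \<ge> 0"
    and Y: "dav j (\<lambda>y. ennreal (g y powr q)) x \<le> ennreal (Y powr q)" "Y \<ge> 0"
  shows "dav j (\<lambda>y. ennreal (f y * g y)) x \<le> ennreal (2 * X * Y)"
proof -
  have q: "q > 0"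
  proof -
    have "1/p < 1" using p by auto
    then have "1/q > 0" using p by linarith
    then show ?thesis by (simp add: zero_less_divide_iff)
  qed
  \<comment> \<open>X or Y may be zero, where the weighted Young inequality cannot be applied; both
    are enlarged by e, and e tends to 0 at the end.\<close>
  have *: "dav j (\<lambda>y. ennreal (f y * g y)) x \<le> ennreal (2 * (X+e) * (Y+e))" if e: "e > 0" for e
  proof -
    define X' where "X' = X + e" define Y' where "Y' = Y + e"
    have pos: "X' > 0" "Y' > 0" using e X Y by (auto simp: X'_def Y'_def)
    have X': "dav j (\<lambda>y. ennreal (f y powr p)) x \<le> ennreal (X' powr p)"
      using X(1) by (rule order_trans) (use X(2) e p in \<open>auto simp: X'_def intro!: ennreal_leI powr_mono2\<close>)
    have Y': "dav j (\<lambda>y. ennreal (g y powr q)) x \<le> ennreal (Y' powr q)"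
      using Y(1) by (rule order_trans) (use Y(2) e q in \<open>auto simp: Y'_def intro!: ennreal_leI powr_mono2\<close>)
    have "dav j (\<lambda>y. ennreal (f y * g y)) x \<le> dav j (\<lambda>y. ennreal (X' * Y' * X' powr (-p)) * ennreal (f y powr p)
            + ennreal (X' * Y' * Y' powr (-q)) * ennreal (g y powr q)) x"
    proof (rule dav_mono)
      fix y
      have "ennreal (f y * g y) \<le> ennreal (X' * Y' * X' powr (-p) * (f y powr p) + X' * Y' * Y' powr (-q) * (g y powr q))"
        using young_weighted[OF p, of "f y" "g y" X' Y'] pos assms(3,4)[of y]
        by (intro ennreal_leI) (simp add: algebra_simps)
      then show "ennreal (f y * g y) \<le> ennreal (X' * Y' * X' powr (-p)) * ennreal (f y powr p)
            + ennreal (X' * Y' * Y' powr (-q)) * ennreal (g y powr q)"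
        using pos by (simp add: ennreal_mult ennreal_plus)
    qed
    also have "\<dots> = ennreal (X' * Y' * X' powr (-p)) * dav j (\<lambda>y. ennreal (f y powr p)) x
       + ennreal (X' * Y' * Y' powr (-q)) * dav j (\<lambda>y. ennreal (g y powr q)) x"
      by (simp add: dav_add dav_cmult)
    also have "\<dots> \<le> ennreal (X' * Y' * X' powr (-p)) * ennreal (X' powr p) + ennreal (X' * Y' * Y' powr (-q)) * ennreal (Y' powr q)"
      by (intro add_mono mult_left_mono X' Y') auto
    also have "\<dots> = ennreal (X' * Y' * (X' powr (-p) * X' powr p) + X' * Y' * (Y' powr (-q) * Y' powr q))"
      using pos by (simp add: ennreal_mult ennreal_plus mult.assoc)
    also have "\<dots> = ennreal (2 * X' * Y')"
      using pos by (simp flip: powr_add)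
    finally show ?thesis by (simp add: X'_def Y'_def)
  qed
  have "((\<lambda>e. ennreal (2 * (X+e) * (Y+e))) \<longlongrightarrow> ennreal (2 * (X+0) * (Y+0))) (at_right 0)"
    by (intro tendsto_intros)
  then have "dav j (\<lambda>y. ennreal (f y * g y)) x \<le> ennreal (2 * (X+0) * (Y+0))"
    by (rule tendsto_lowerbound) (use eventually_mono[OF eventually_at_right_less[of 0] *] in auto)
  then show ?thesis by simp
qed

section \<open>The dyadic maximal function\<close>

lemma ennreal_mult_add:
  "a \<ge> 0 \<Longrightarrow> b \<ge> 0 \<Longrightarrow> c \<ge> 0 \<Longrightarrow> d \<ge> 0 \<Longrightarrow> ennreal (a * b + c * d) = ennreal a * ennreal b + ennreal c * ennreal d"
  by (simp only: ennreal_plus ennreal_mult mult_nonneg_nonneg)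

text \<open>Subtracting half of a is legitimate only for finite a, which is why each absorption
  argument is preceded by a crude finiteness bound.\<close>

lemma ennreal_absorb:
  fixes a b :: ennreal
  assumes "a \<le> ennreal (1/2) * a + b" "a < \<infinity>"
  shows "a \<le> 2 * b"
proof (cases "b = \<infinity>")
  case False
  then obtain y where y: "b = ennreal y" "y \<ge> 0" by (cases b) auto
  from assms(2) obtain x where x: "a = ennreal x" "x \<ge> 0" by (cases a) auto
  have "ennreal x \<le> ennreal (1/2 * x + y)"
  proof -
    have "ennreal (1/2 * x + y) = ennreal (1/2) * ennreal x + ennreal y"
      using x y by (subst ennreal_plus, simp, simp, subst ennreal_mult) auto
    then show ?thesis using assms(1) x y by simp
  qed
  then have "x \<le> 1/2 * x + y" by (rule ennreal_le_iff[THEN iffD1, rotated]) (use x y in simp)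
  then have "x \<le> 2 * y" by linarith
  then have "ennreal x \<le> ennreal (2 * y)" by (rule ennreal_leI)
  then show ?thesis using x y by (simp add: ennreal_mult)
qed (simp add: ennreal_mult_top)

text \<open>Hoelder's inequality against the constant 1; \<open>2 powr q\<close> is the q-th power
  of the factor 2 in \<open>dav_holder\<close>.\<close>

lemma dav_jensen:
  fixes f :: "real^'n::finite \<Rightarrow> real"
  assumes [measurable]: "f \<in> borel_measurable lebesgue" and f: "\<And>x. f x \<ge> 0" and q: "q > 1"
    and fin: "dav j (\<lambda>y. ennreal (f y powr q)) x < \<infinity>"
  shows "dav j (\<lambda>y. ennreal (f y)) x < \<infinity>"
    and "ennreal (enn2real (dav j (\<lambda>y. ennreal (f y)) x) powr q) \<le> ennreal (2 powr q) * dav j (\<lambda>y. ennreal (f y powr q)) x"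
proof -
  from fin obtain Z where Z: "dav j (\<lambda>y. ennreal (f y powr q)) x = ennreal Z" "Z \<ge> 0"
    by (cases "dav j (\<lambda>y. ennreal (f y powr q)) x") auto
  define X where "X = Z powr (1/q)"
  have X: "X powr q = Z" "X \<ge> 0" using Z q by (auto simp: X_def powr_powr)
  have "dav j (\<lambda>y. ennreal (f y * 1)) x \<le> ennreal (2 * X * 1)"
    by (rule dav_holder[of _ _ q "q/(q-1)"]) (use f q X Z in \<open>auto simp: field_simps\<close>)
  then have *: "dav j (\<lambda>y. ennreal (f y)) x \<le> ennreal (2 * X)" by simp
  then show "dav j (\<lambda>y. ennreal (f y)) x < \<infinity>" using le_less_trans by fastforce
  have "enn2real (dav j (\<lambda>y. ennreal (f y)) x) \<le> 2 * X"
    using enn2real_mono[OF *] X by simp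
  then have "enn2real (dav j (\<lambda>y. ennreal (f y)) x) powr q \<le> (2 * X) powr q"
    using q by (intro powr_mono2) auto
  also have "\<dots> = 2 powr q * Z" using X by (simp add: powr_mult)
  finally have "ennreal (enn2real (dav j (\<lambda>y. ennreal (f y)) x) powr q) \<le> ennreal (2 powr q * Z)"
    by (rule ennreal_leI)
  then show "ennreal (enn2real (dav j (\<lambda>y. ennreal (f y)) x) powr q) \<le> ennreal (2 powr q) * dav j (\<lambda>y. ennreal (f y powr q)) x"
    using Z by (simp add: ennreal_mult)
qed

lemma dav_finite:
  fixes f :: "real^'n::finite \<Rightarrow> ennreal"
  assumes "(\<integral>\<^sup>+x. f x \<partial>lebesgue) < \<infinity>"
  shows "dav j f x < \<infinity>"
proof -
  have "(\<integral>\<^sup>+y\<in>cube j x. f y \<partial>lebesgue) \<le> (\<integral>\<^sup>+x. f x \<partial>lebesgue)"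
    by (intro nn_integral_mono) (auto simp: indicator_def)
  then show ?thesis unfolding dav_def using assms
    by (auto simp: ennreal_mult_less_top)
qed

text \<open>The running maximum of the martingale of averages, over the levels from j to j + N. The
  recursion adds finer levels one at a time, so that \<open>dmax j f N\<close> is constant on the
  cubes of level j + N; this adaptedness drives the induction in \<open>dmax_doob\<close>.\<close>

primrec dmax :: "int \<Rightarrow> (real^'n::finite \<Rightarrow> real) \<Rightarrow> nat \<Rightarrow> real^'n \<Rightarrow> real" where
  "dmax j f 0 x = enn2real (dav j (\<lambda>y. ennreal (f y)) x)"
| "dmax j f (Suc N) x = max (dmax j f N x) (enn2real (dav (j + int (Suc N)) (\<lambda>y. ennreal (f y)) x))"

lemma dmax_ge: "i \<le> N \<Longrightarrow> enn2real (dav (j + int i) (\<lambda>y. ennreal (f y)) x) \<le> dmax j f N x"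
proof (induction N)
  case (Suc N)
  show ?case
  proof (cases "i = Suc N")
    case False
    then show ?thesis using Suc by (simp add: le_max_iff_disj)
  qed simp
qed simp

lemma dmax_nonneg: "dmax j f N x \<ge> 0"
  using dmax_ge[of 0 N j f x] enn2real_nonneg[of "dav (j + int 0) (\<lambda>y. ennreal (f y)) x"] by linarith

lemma cinv_compose: "cinv j f \<Longrightarrow> cinv j (\<lambda>x. h (f x))"
  unfolding cinv_def by metis

lemma cinv_compose2: "cinv j f \<Longrightarrow> cinv j g \<Longrightarrow> cinv j (\<lambda>x. h (f x) (g x))"
  unfolding cinv_def by metis

lemma cinv_enn2real_dav: "cinv j (\<lambda>x. enn2real (dav j f x))"
  by (rule cinv_compose[OF cinv_dav])

lemma cinv_dmax: "cinv (j + int N) (dmax j f N)"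
proof (induction N)
  case 0 then show ?case using cinv_enn2real_dav[of j "\<lambda>y. ennreal (f y)"] by (simp add: fun_eq_iff[symmetric] cinv_def)
next
  case (Suc N)
  have "cinv (j + int (Suc N)) (dmax j f N)" by (rule cinv_mono[OF Suc]) simp
  from cinv_compose2[OF this cinv_enn2real_dav, of max "\<lambda>y. ennreal (f y)"] show ?case
    by (simp add: cinv_def)
qed

lemma dmax_measurable [measurable]: "dmax j f N \<in> borel_measurable lebesgue"
  by (rule cinv_borel[OF cinv_dmax])

text \<open>Equivalent to Young's inequality for c and \<open>b powr (q-1)\<close>. When the running
  maximum rises from b to c, the value c is the newest average, and the factor c standing in front
  of the increment is the one to be replaced by that average.\<close>

lemma powr_increment_le:
  fixes b c q :: real
  assumes "0 \<le> b" "b \<le> c" "q > 1"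
  shows "c powr q \<le> b powr q + c * (q/(q-1) * (c powr (q-1) - b powr (q-1)))"
proof -
  have "c * b powr (q-1) \<le> c powr q / q + (b powr (q-1)) powr (q/(q-1)) / (q/(q-1))"
    by (rule Youngs_inequality) (use assms in \<open>auto simp: field_simps\<close>)
  also have "(b powr (q-1)) powr (q/(q-1)) = b powr q" using assms by (simp add: powr_powr)
  finally have "q/(q-1) * (c * b powr (q-1)) \<le> q/(q-1) * (c powr q / q + b powr q / (q/(q-1)))"
    using assms by (intro mult_left_mono) auto
  also have "\<dots> = c powr q / (q-1) + b powr q" using assms by (simp add: field_simps)
  finally have 1: "q/(q-1) * (c * b powr (q-1)) \<le> c powr q / (q-1) + b powr q" .
  have "c * c powr (q-1) = c powr q" using assms by (simp add: powr_mult_base)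
  then have "c * (q/(q-1) * c powr (q-1)) = q/(q-1) * c powr q" by (metis mult.left_commute)
  also have "\<dots> = c powr q + c powr q / (q-1)" using assms by (simp add: field_simps)
  finally show ?thesis using 1 by (simp add: algebra_simps)
qed

text \<open>Doob's inequality before Hoelder is applied. The increment of the (q-1)-st power of the
  maximum at a new level is constant on the cubes of that level, so under the integral the newest
  average may be replaced by f itself; the increments then telescope.\<close>

lemma dmax_doob:
  fixes f :: "real^'n::finite \<Rightarrow> real"
  assumes [measurable]: "f \<in> borel_measurable lebesgue" and f: "\<And>x. f x \<ge> 0" and q: "q > 1"
    and fin: "\<And>j x. dav j (\<lambda>y. ennreal (f y)) x < \<infinity>"
  shows "(\<integral>\<^sup>+x. ennreal (dmax j f N x powr q) \<partial>lebesgue)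
     \<le> (\<integral>\<^sup>+x. ennreal (f x) * ennreal (q/(q-1) * dmax j f N x powr (q-1)) \<partial>lebesgue)"
proof (induction N)
  case 0
  have "(\<integral>\<^sup>+x. ennreal (dmax j f 0 x powr q) \<partial>lebesgue)
     \<le> (\<integral>\<^sup>+x. dav j (\<lambda>y. ennreal (f y)) x * ennreal (q/(q-1) * dmax j f 0 x powr (q-1)) \<partial>lebesgue)"
  proof (rule nn_integral_mono)
    fix x
    let ?X = "dmax j f 0 x"
    have X: "dav j (\<lambda>y. ennreal (f y)) x = ennreal ?X" using fin[of j x] by simp
    have "?X powr q \<le> 0 powr q + ?X * (q/(q-1) * (?X powr (q-1) - 0 powr (q-1)))"
      by (rule powr_increment_le) (use q dmax_nonneg[of j f 0 x] in auto)
    then show "ennreal (?X powr q) \<le> dav j (\<lambda>y. ennreal (f y)) x * ennreal (q/(q-1) * ?X powr (q-1))"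
      unfolding X using q dmax_nonneg[of j f 0 x] by (simp flip: ennreal_mult)
  qed
  also have "\<dots> = (\<integral>\<^sup>+x. ennreal (f x) * ennreal (q/(q-1) * dmax j f 0 x powr (q-1)) \<partial>lebesgue)"
  proof (rule nn_integral_dav_cinv)
    show "cinv j (\<lambda>x. ennreal (q/(q-1) * dmax j f 0 x powr (q-1)))"
      by (rule cinv_compose[of j "dmax j f 0"]) (use cinv_dmax[of j 0 f] in simp)
  qed simp
  finally show ?case .
next
  case (Suc N)
  let ?j = "j + int (Suc N)"
  define d where "d x = ennreal (q/(q-1) * (dmax j f (Suc N) x powr (q-1) - dmax j f N x powr (q-1)))" for x
  have d_cinv: "cinv ?j d"
    unfolding d_def
    by (rule cinv_compose2[OF cinv_dmax[of j "Suc N" f] cinv_mono[OF cinv_dmax[of j N f]]]) simp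
  have [measurable]: "d \<in> borel_measurable lebesgue" by (rule cinv_borel[OF d_cinv])
  have "(\<integral>\<^sup>+x. ennreal (dmax j f (Suc N) x powr q) \<partial>lebesgue)
     \<le> (\<integral>\<^sup>+x. ennreal (dmax j f N x powr q) + dav ?j (\<lambda>y. ennreal (f y)) x * d x \<partial>lebesgue)"
  proof (rule nn_integral_mono)
    fix x
    let ?b = "dmax j f N x" and ?c = "dmax j f (Suc N) x" and ?X = "enn2real (dav ?j (\<lambda>y. ennreal (f y)) x)"
    have X: "dav ?j (\<lambda>y. ennreal (f y)) x = ennreal ?X" using fin[of ?j x] by simp
    have le: "?b \<le> ?c" by simp
    have pw: "?c powr (q-1) - ?b powr (q-1) \<ge> 0"
      using powr_mono2[OF _ dmax_nonneg le, of "q-1"] q by simp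
    have "?c powr q \<le> ?b powr q + ?c * (q/(q-1) * (?c powr (q-1) - ?b powr (q-1)))"
      by (rule powr_increment_le[OF dmax_nonneg le q])
    \<comment> \<open>Either the maximum did not rise and the bracket vanishes, or \<open>?c\<close>
      is the new average \<open>?X\<close>.\<close>
    also have "\<dots> = ?b powr q + ?X * (q/(q-1) * (?c powr (q-1) - ?b powr (q-1)))"
      by (auto simp: max_def)
    finally have "ennreal (?c powr q) \<le> ennreal (?b powr q + ?X * (q/(q-1) * (?c powr (q-1) - ?b powr (q-1))))"
      by (rule ennreal_leI)
    also have "\<dots> = ennreal (?b powr q) + ennreal ?X * d x"
      unfolding d_def using q pw
      by (subst ennreal_mult[symmetric]) (auto simp: enn2real_nonneg intro!: ennreal_plus mult_nonneg_nonneg divide_nonneg_nonneg)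
    finally show "ennreal (?c powr q) \<le> ennreal (?b powr q) + dav ?j (\<lambda>y. ennreal (f y)) x * d x"
      by (simp only: X[symmetric])
  qed
  also have "\<dots> = (\<integral>\<^sup>+x. ennreal (dmax j f N x powr q) \<partial>lebesgue) + (\<integral>\<^sup>+x. dav ?j (\<lambda>y. ennreal (f y)) x * d x \<partial>lebesgue)"
    by (rule nn_integral_add) auto
  also have "(\<integral>\<^sup>+x. dav ?j (\<lambda>y. ennreal (f y)) x * d x \<partial>lebesgue) = (\<integral>\<^sup>+x. ennreal (f x) * d x \<partial>lebesgue)"
    by (rule nn_integral_dav_cinv[OF _ d_cinv]) auto
  also have "(\<integral>\<^sup>+x. ennreal (dmax j f N x powr q) \<partial>lebesgue) + \<dots> \<le>
     (\<integral>\<^sup>+x. ennreal (f x) * ennreal (q/(q-1) * dmax j f N x powr (q-1)) \<partial>lebesgue) + (\<integral>\<^sup>+x. ennreal (f x) * d x \<partial>lebesgue)"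
    by (intro add_mono Suc order_refl)
  also have "\<dots> = (\<integral>\<^sup>+x. ennreal (f x) * ennreal (q/(q-1) * dmax j f N x powr (q-1)) + ennreal (f x) * d x \<partial>lebesgue)"
    by (rule nn_integral_add[symmetric]) auto
  also have "\<dots> = (\<integral>\<^sup>+x. ennreal (f x) * ennreal (q/(q-1) * dmax j f (Suc N) x powr (q-1)) \<partial>lebesgue)"
  proof (rule nn_integral_cong)
    fix x
    let ?b = "dmax j f N x" and ?c = "dmax j f (Suc N) x"
    have le: "?b \<le> ?c" by simp
    have pw: "?c powr (q-1) - ?b powr (q-1) \<ge> 0"
      using powr_mono2[OF _ dmax_nonneg le, of "q-1"] q by simp
    have "ennreal (q/(q-1) * ?b powr (q-1)) + d x = ennreal (q/(q-1) * ?b powr (q-1) + q/(q-1) * (?c powr (q-1) - ?b powr (q-1)))"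
      unfolding d_def using q pw by (intro ennreal_plus[symmetric] mult_nonneg_nonneg divide_nonneg_nonneg) auto
    also have "q/(q-1) * ?b powr (q-1) + q/(q-1) * (?c powr (q-1) - ?b powr (q-1)) = q/(q-1) * ?c powr (q-1)"
      by (simp only: distrib_left[symmetric]) simp
    finally show "ennreal (f x) * ennreal (q/(q-1) * ?b powr (q-1)) + ennreal (f x) * d x = ennreal (f x) * ennreal (q/(q-1) * ?c powr (q-1))"
      by (simp only: distrib_left[symmetric])
  qed
  finally show ?case .
qed

text \<open>Write Q = q/(q-1), let f be the function and g its maximal function. Where g >= 2 Q f,
  the integrand Q f g^(q-1) of \<open>dmax_doob\<close> is at most half of g^q; elsewhere it is at
  most Q (2 Q)^(q-1) f^q. Absorbing the half doubles the constant.\<close>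

definition dmax_const :: "real \<Rightarrow> real" where
  "dmax_const q = 2 * (q/(q-1) * (2 * (q/(q-1))) powr (q-1))"

lemma dmax_const_pos: "q > 1 \<Longrightarrow> dmax_const q > 0"
  unfolding dmax_const_def by (intro mult_pos_pos) auto

theorem dmax_Lq:
  fixes f :: "real^'n::finite \<Rightarrow> real"
  assumes [measurable]: "f \<in> borel_measurable lebesgue" and f: "\<And>x. f x \<ge> 0" and q: "q > 1"
    and fin: "(\<integral>\<^sup>+x. ennreal (f x powr q) \<partial>lebesgue) < \<infinity>"
  shows "(\<integral>\<^sup>+x. ennreal (dmax j f N x powr q) \<partial>lebesgue) \<le> ennreal (dmax_const q) * (\<integral>\<^sup>+x. ennreal (f x powr q) \<partial>lebesgue)"
proof -
  have finq: "dav j (\<lambda>y. ennreal (f y powr q)) x < \<infinity>" for j x by (rule dav_finite[OF fin])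
  have finf: "dav j (\<lambda>y. ennreal (f y)) x < \<infinity>" for j x
    by (rule dav_jensen(1)[OF assms(1) f q finq])
  let ?G = "\<integral>\<^sup>+x. ennreal (dmax j f N x powr q) \<partial>lebesgue"
  have Xfin: "(\<integral>\<^sup>+x. ennreal (enn2real (dav j (\<lambda>y. ennreal (f y)) x) powr q) \<partial>lebesgue) < \<infinity>" for j
  proof -
    have "(\<integral>\<^sup>+x. ennreal (enn2real (dav j (\<lambda>y. ennreal (f y)) x) powr q) \<partial>lebesgue)
       \<le> (\<integral>\<^sup>+x. ennreal (2 powr q) * dav j (\<lambda>y. ennreal (f y powr q)) x \<partial>lebesgue)"
      by (intro nn_integral_mono dav_jensen(2)[OF assms(1) f q finq])
    also have "\<dots> = ennreal (2 powr q) * (\<integral>\<^sup>+x. ennreal (f x powr q) \<partial>lebesgue)"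
      by (subst nn_integral_cmult) (auto simp: nn_integral_dav)
    also have "\<dots> < \<infinity>" using fin by (simp add: ennreal_mult_less_top)
    finally show ?thesis .
  qed
  \<comment> \<open>A crude bound by a sum of N + 1 averages. It grows with N, but its only purpose
    is to make the absorption legitimate; the final constant is uniform in N.\<close>
  have Gfin: "(\<integral>\<^sup>+x. ennreal (dmax j f N x powr q) \<partial>lebesgue) < \<infinity>" for N
  proof (induction N)
    case 0 then show ?case using Xfin[of j] by simp
  next
    case (Suc N)
    let ?X = "\<lambda>x. enn2real (dav (j + int (Suc N)) (\<lambda>y. ennreal (f y)) x)"
    have "(\<integral>\<^sup>+x. ennreal (dmax j f (Suc N) x powr q) \<partial>lebesgue) \<le>
      (\<integral>\<^sup>+x. ennreal (dmax j f N x powr q) + ennreal (?X x powr q) \<partial>lebesgue)"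
      by (intro nn_integral_mono) (auto simp: max_def simp flip: ennreal_plus intro!: ennreal_leI)
    also have "\<dots> = (\<integral>\<^sup>+x. ennreal (dmax j f N x powr q) \<partial>lebesgue) + (\<integral>\<^sup>+x. ennreal (?X x powr q) \<partial>lebesgue)"
      by (rule nn_integral_add) auto
    also have "\<dots> < \<infinity>" using Suc Xfin by simp
    finally show ?case .
  qed
  define Q where "Q = q/(q-1)"
  have Q: "Q > 0" using q by (simp add: Q_def)
  have "?G \<le> (\<integral>\<^sup>+x. ennreal (f x) * ennreal (Q * dmax j f N x powr (q-1)) \<partial>lebesgue)"
    unfolding Q_def by (rule dmax_doob) (use f q finf in auto)
  also have "\<dots> \<le> (\<integral>\<^sup>+x. ennreal (1/2) * ennreal (dmax j f N x powr q) + ennreal (Q * (2 * Q) powr (q-1)) * ennreal (f x powr q) \<partial>lebesgue)"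
  proof (rule nn_integral_mono)
    fix x
    let ?g = "dmax j f N x"
    have g: "?g \<ge> 0" by (rule dmax_nonneg)
    have "f x * (Q * ?g powr (q-1)) \<le> 1/2 * ?g powr q + Q * (2*Q) powr (q-1) * f x powr q"
    proof (cases "2 * Q * f x \<le> ?g")
      case True
      have "f x * (Q * ?g powr (q-1)) = (Q * f x) * ?g powr (q-1)" by simp
      also have "\<dots> \<le> (?g/2) * ?g powr (q-1)" using True by (intro mult_right_mono) auto
      also have "\<dots> = 1/2 * ?g powr q" using g q by (simp add: powr_mult_base)
      finally have "f x * (Q * ?g powr (q-1)) \<le> 1/2 * ?g powr q" .
      moreover have "Q * (2*Q) powr (q-1) * f x powr q \<ge> 0" using Q by simp
      ultimately show ?thesis by linarith
    next
      case False
      have "?g powr (q-1) \<le> (2 * Q * f x) powr (q-1)" using False g q by (intro powr_mono2) auto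
      also have "\<dots> = (2*Q) powr (q-1) * f x powr (q-1)" using Q f[of x] by (simp add: powr_mult)
      finally have "f x * (Q * ?g powr (q-1)) \<le> f x * (Q * ((2*Q) powr (q-1) * f x powr (q-1)))"
        using Q f[of x] by (intro mult_left_mono) auto
      also have "\<dots> = Q * (2*Q) powr (q-1) * (f x * f x powr (q-1))" by (simp only: mult_ac)
      also have "f x * f x powr (q-1) = f x powr q" using f[of x] q by (simp add: powr_mult_base)
      finally show ?thesis using powr_ge_zero[of ?g q] by linarith
    qed
    then have "ennreal (f x * (Q * ?g powr (q-1))) \<le> ennreal (1/2 * ?g powr q + Q * (2*Q) powr (q-1) * f x powr q)"
      by (rule ennreal_leI)
    also have "\<dots> = ennreal (1/2) * ennreal (?g powr q) + ennreal (Q * (2*Q) powr (q-1)) * ennreal (f x powr q)"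
      using Q by (intro ennreal_mult_add) auto
    finally show "ennreal (f x) * ennreal (Q * ?g powr (q-1)) \<le> \<dots>"
      using f[of x] Q by (simp flip: ennreal_mult)
  qed
  also have "\<dots> = ennreal (1/2) * ?G + ennreal (Q * (2 * Q) powr (q-1)) * (\<integral>\<^sup>+x. ennreal (f x powr q) \<partial>lebesgue)"
    by (subst nn_integral_add) (auto simp: nn_integral_cmult)
  finally have "?G \<le> 2 * (ennreal (Q * (2 * Q) powr (q-1)) * (\<integral>\<^sup>+x. ennreal (f x powr q) \<partial>lebesgue))"
    by (rule ennreal_absorb) (rule Gfin)
  also have "\<dots> = ennreal (dmax_const q) * (\<integral>\<^sup>+x. ennreal (f x powr q) \<partial>lebesgue)"
    using Q by (simp add: dmax_const_def Q_def[symmetric] ennreal_mult mult.assoc)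
  finally show ?thesis .
qed

section \<open>Dyadic Lebesgue differentiation\<close>

definition lint :: "(real^'n::finite \<Rightarrow> real) \<Rightarrow> bool" where
  "lint f \<longleftrightarrow> f \<in> borel_measurable lebesgue \<and> (\<forall>j x. dav j (\<lambda>y. ennreal \<bar>f y\<bar>) x < \<infinity>)"

lemma lint_measurable: "lint f \<Longrightarrow> f \<in> borel_measurable lebesgue"
  by (simp add: lint_def)

lemma lint_cube: "lint f \<Longrightarrow> set_integrable lebesgue (cube j x) f"
proof -
  assume f: "lint f"
  then have [measurable]: "f \<in> borel_measurable lebesgue" by (rule lint_measurable)
  have "(\<integral>\<^sup>+y\<in>cube j x. ennreal \<bar>f y\<bar> \<partial>lebesgue) < \<infinity>"
    using f unfolding vol_dav lint_def by (simp add: ennreal_mult_less_top)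
  also have "(\<integral>\<^sup>+y\<in>cube j x. ennreal \<bar>f y\<bar> \<partial>lebesgue) = (\<integral>\<^sup>+y. ennreal (norm (indicator (cube j x) y *\<^sub>R f y)) \<partial>lebesgue)"
    by (intro nn_integral_cong) (auto simp: indicator_def)
  finally show ?thesis unfolding set_integrable_def by (intro integrableI_bounded) auto
qed

lemma lint_bound:
  assumes "lint g" "f \<in> borel_measurable lebesgue" "\<And>x. \<bar>f x\<bar> \<le> \<bar>g x\<bar>"
  shows "lint f"
  unfolding lint_def
proof (intro conjI allI)
  fix j x
  have "dav j (\<lambda>y. ennreal \<bar>f y\<bar>) x \<le> dav j (\<lambda>y. ennreal \<bar>g y\<bar>) x"
    by (intro dav_mono ennreal_leI assms)
  also have "\<dots> < \<infinity>" using assms(1) by (simp add: lint_def)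
  finally show "dav j (\<lambda>y. ennreal \<bar>f y\<bar>) x < \<infinity>" .
qed (fact assms)

lemma lint_add:
  assumes "lint f" "lint g" shows "lint (\<lambda>x. f x + g x)"
  unfolding lint_def
proof (intro conjI allI)
  have [measurable]: "f \<in> borel_measurable lebesgue" "g \<in> borel_measurable lebesgue"
    using assms by (auto simp: lint_def)
  show "(\<lambda>x. f x + g x) \<in> borel_measurable lebesgue" by measurable
  fix j x
  have "dav j (\<lambda>y. ennreal \<bar>f y + g y\<bar>) x \<le> dav j (\<lambda>y. ennreal \<bar>f y\<bar> + ennreal \<bar>g y\<bar>) x"
    by (intro dav_mono) (auto simp flip: ennreal_plus intro!: ennreal_leI)
  also have "\<dots> = dav j (\<lambda>y. ennreal \<bar>f y\<bar>) x + dav j (\<lambda>y. ennreal \<bar>g y\<bar>) x"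
    by (rule dav_add) auto
  also have "\<dots> < \<infinity>" using assms by (simp add: lint_def)
  finally show "dav j (\<lambda>y. ennreal \<bar>f y + g y\<bar>) x < \<infinity>" .
qed

lemma lint_cmult:
  assumes "lint f" shows "lint (\<lambda>x. c * f x)"
  unfolding lint_def
proof (intro conjI allI)
  have [measurable]: "f \<in> borel_measurable lebesgue"
    using assms by (auto simp: lint_def)
  show "(\<lambda>x. c * f x) \<in> borel_measurable lebesgue" by measurable
  fix j x
  have "dav j (\<lambda>y. ennreal \<bar>c * f y\<bar>) x = ennreal \<bar>c\<bar> * dav j (\<lambda>y. ennreal \<bar>f y\<bar>) x"
    by (subst dav_cmult[symmetric]) (auto simp: abs_mult ennreal_mult)
  also have "\<dots> < \<infinity>" using assms by (simp add: lint_def ennreal_mult_less_top)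
  finally show "dav j (\<lambda>y. ennreal \<bar>c * f y\<bar>) x < \<infinity>" .
qed

lemma lint_const: "lint (\<lambda>x. c)"
  by (simp add: lint_def)

lemma lint_minus: "lint f \<Longrightarrow> lint g \<Longrightarrow> lint (\<lambda>x. f x - g x)"
  using lint_add[of f "\<lambda>x. -1 * g x"] lint_cmult[of g "-1"] by simp

definition rav :: "int \<Rightarrow> (real^'n::finite \<Rightarrow> real) \<Rightarrow> real^'n \<Rightarrow> real" where
  "rav j f x = cube_avg (cube j x) f"

lemma cinv_rav: "cinv j (rav j f)"
  unfolding cinv_def rav_def by (auto dest: cube_eq)

lemma rav_measurable [measurable]: "rav j f \<in> borel_measurable lebesgue"
  by (rule cinv_borel[OF cinv_rav])

lemma rav_diff: "lint f \<Longrightarrow> lint g \<Longrightarrow> rav j (\<lambda>x. f x - g x) x = rav j f x - rav j g x"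
  unfolding rav_def cube_avg_def by (simp add: set_integral_diff(2) lint_cube diff_divide_distrib)

lemma rav_cmult: "rav j (\<lambda>x. c * f x) x = c * rav j f x"
  unfolding rav_def cube_avg_def by simp

lemma rav_cong: "(\<And>y. y \<in> cube j x \<Longrightarrow> f y = g y) \<Longrightarrow> rav j f x = rav j g x"
  unfolding rav_def cube_avg_def set_lebesgue_integral_def
  by (intro arg_cong2[of _ _ _ _ "(/)"] Bochner_Integration.integral_cong) (auto simp: indicator_def)

lemma rav_mult_cinv: "cinv j g \<Longrightarrow> rav j (\<lambda>y. g y * f y) x = g x * rav j f x"
  by (subst rav_cmult[symmetric], rule rav_cong) (simp add: cinvD)

lemma rav_const [simp]: "rav j (\<lambda>_. c) x = c"
  unfolding rav_def cube_avg_def set_lebesgue_integral_def by (simp add: measure_cube)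

lemma rav_cinv: "cinv j g \<Longrightarrow> rav j g x = g x"
  using rav_mult_cinv[of j g "\<lambda>_. 1"] by simp

lemma rav_dav:
  fixes f :: "real^'n::finite \<Rightarrow> real"
  assumes "lint f" "\<And>x. f x \<ge> 0" shows "ennreal (rav j f x) = dav j (\<lambda>y. ennreal (f y)) x"
proof -
  have "(\<integral>\<^sup>+y\<in>cube j x. ennreal (f y) \<partial>lebesgue) = (\<integral>\<^sup>+y. ennreal (indicator (cube j x) y *\<^sub>R f y) \<partial>lebesgue)"
    by (intro nn_integral_cong) (auto simp: indicator_def)
  also have "\<dots> = ennreal (LINT y:cube j x|lebesgue. f y)"
    unfolding set_lebesgue_integral_def
    by (rule nn_integral_eq_integral) (use lint_cube[OF assms(1)] assms(2) in \<open>auto simp: set_integrable_def\<close>)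
  finally have "dav j (\<lambda>y. ennreal (f y)) x = ennreal (2 powr (real_of_int j * real CARD('n)) * (LINT y:cube j x|lebesgue. f y))"
    unfolding dav_def by (simp add: ennreal_mult')
  then show ?thesis
    unfolding rav_def cube_avg_def measure_cube by (simp add: powr_minus divide_inverse mult.commute)
qed

lemma rav_nonneg: "(\<And>x. f x \<ge> 0) \<Longrightarrow> rav j f x \<ge> 0"
  unfolding rav_def cube_avg_def set_lebesgue_integral_def
  by (intro divide_nonneg_nonneg integral_nonneg) auto

lemma rav_mono:
  assumes "lint f" "lint g" "\<And>y. f y \<le> g y" shows "rav j f x \<le> rav j g x"
  using rav_nonneg[of "\<lambda>y. g y - f y" j x] rav_diff[OF assms(2,1), of j x] assms(3) by simp

lemma lint_abs: "lint f \<Longrightarrow> lint (\<lambda>x. \<bar>f x\<bar>)"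
  using lint_measurable[of f] by (auto intro!: lint_bound[of f])

lemma rav_abs_le: assumes "lint f" shows "\<bar>rav j f x\<bar> \<le> rav j (\<lambda>y. \<bar>f y\<bar>) x"
  using rav_mono[OF assms lint_abs[OF assms], of j x] rav_mono[OF lint_cmult[OF assms, of "-1"] lint_abs[OF assms], of j x]
  unfolding rav_cmult by (force simp: abs_le_iff)

lemma rav_abs_dav: assumes "lint f" shows "ennreal \<bar>rav j f x\<bar> \<le> dav j (\<lambda>y. ennreal \<bar>f y\<bar>) x"
  using rav_dav[OF lint_abs[OF assms], of j x] ennreal_leI[OF rav_abs_le[OF assms, of j x]] by simp

text \<open>Since \<open>ennreal\<close> sends negative numbers to 0, the two sides are the averages
  of the positive and of the negative part of f.\<close>

lemma rav_neg_dav: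
  assumes f: "lint f" and "rav j f x < 0"
  shows "dav j (\<lambda>y. ennreal (f y)) x \<le> dav j (\<lambda>y. ennreal (- f y)) x"
proof -
  have p: "lint (\<lambda>x. max 0 (f x))" "lint (\<lambda>x. max 0 (- f x))"
    using lint_measurable[OF f] by (auto intro!: lint_bound[OF f])
  have "rav j (\<lambda>x. max 0 (f x)) x - rav j (\<lambda>x. max 0 (- f x)) x = rav j f x"
    unfolding rav_diff[OF p, symmetric] by (intro rav_cong) auto
  then have "ennreal (rav j (\<lambda>x. max 0 (f x)) x) \<le> ennreal (rav j (\<lambda>x. max 0 (- f x)) x)"
    using assms(2) by (intro ennreal_leI) auto
  moreover have m: "ennreal (max 0 t) = ennreal t" for t by (simp add: max_def ennreal_neg)
  ultimately show ?thesis by (simp add: rav_dav[OF p(1)] rav_dav[OF p(2)] m)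
qed

lemma open_contains_cube:
  assumes "open G" "(x::real^'n::finite) \<in> G"
  shows "eventually (\<lambda>M. cube (int M) x \<subseteq> G) sequentially"
proof -
  obtain e where e: "e > 0" "ball x e \<subseteq> G" using assms open_contains_ball by metis
  have "(\<lambda>M. real CARD('n) * (1/2) ^ M) \<longlonglongrightarrow> real CARD('n) * 0"
    by (intro tendsto_intros) auto
  then have "eventually (\<lambda>M. real CARD('n) * (1/2) ^ M < e) sequentially"
    using e(1) by (intro order_tendstoD(2)) simp_all
  then show ?thesis
  proof eventually_elim
    case (elim M)
    have "dist x y < e" if "y \<in> cube (int M) x" for y
    proof -
      have *: "\<bar>(x - y)$i\<bar> \<le> (1/2)^M" for i
      proof -
        have "\<lfloor>2^M * x$i\<rfloor> = \<lfloor>2^M * y$i\<rfloor>"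
          using that by (auto simp: mem_cube cidx_def vec_eq_iff powr_realpow)
        then have "\<bar>2^M * x$i - 2^M * y$i\<bar> \<le> 1" by linarith
        then have "2^M * \<bar>x$i - y$i\<bar> \<le> 1" by (simp add: abs_mult flip: right_diff_distrib)
        then show ?thesis by (simp add: field_simps)
      qed
      have "norm (x - y) \<le> (\<Sum>i\<in>UNIV. \<bar>(x-y)$i\<bar>)" by (rule norm_le_l1_cart)
      also have "\<dots> \<le> (\<Sum>i\<in>(UNIV::'n set). (1/2)^M)" by (intro sum_mono *)
      also have "\<dots> < e" using elim by simp
      finally show ?thesis by (simp add: dist_norm)
    qed
    then show ?case using e(2) by (auto simp: subset_iff)
  qed
qed

text \<open>The cubes on which \<open>f\<close> has negative mean that are maximal inside an open \<open>G \<supseteq> B\<close> cover \<open>B\<close>,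
  so the integral of \<open>f\<^sup>+\<close> over \<open>B\<close> is at most that of \<open>f\<^sup>-\<close> over \<open>G - B\<close>.\<close>

lemma lebesgue_diff_null:
  fixes f :: "real^'n::finite \<Rightarrow> real" and x0 :: "real^'n"
  assumes f: "lint f" and d: "d > 0"
  defines "B \<equiv> {x \<in> cube 0 x0. f x > d \<and> (\<exists>\<^sub>F M in sequentially. rav (int M) f x < 0)}"
  shows "B \<in> null_sets lebesgue"
proof -
  have [measurable]: "f \<in> borel_measurable lebesgue" using f by (rule lint_measurable)
  have Bm[measurable]: "B \<in> sets lebesgue"
  proof -
    have "B = {x \<in> space lebesgue. x \<in> cube 0 x0 \<and> f x > d \<and> (\<forall>N. \<exists>M. M \<ge> N \<and> rav (int M) f x < 0)}"
      by (auto simp: B_def frequently_sequentially)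
    also have "\<dots> \<in> sets lebesgue" by measurable
    finally show ?thesis .
  qed
  have key: "ennreal d * emeasure lebesgue B \<le> (\<integral>\<^sup>+x\<in>G - B. ennreal (- f x) * indicator (cube 0 x0) x \<partial>lebesgue)"
    if G: "open G" "B \<subseteq> G" for G
  proof -
    have [measurable]: "G \<in> sets lebesgue" using G by auto
    \<comment> \<open>Only levels from 0 on are searched, so the selected cubes stay inside
      \<open>cube 0 x0\<close>, on which f is integrable.\<close>
    define P where "P n x \<longleftrightarrow> x \<in> cube 0 x0 \<and> cube (int n) x \<subseteq> G \<and> rav (int n) f x < 0" for n x
    define U where "U n = {x. P n x \<and> (\<forall>m<n. \<not> P m x)}" for n
    have Pinv: "P m y = P m x" if "y \<in> cube (int n) x" "m \<le> n" for m n x y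
    proof -
      have "y \<in> cube (int m) x" using that cube_mono[of "int m" "int n" x] by auto
      moreover have "y \<in> cube 0 x" using that cube_mono[of 0 "int n" x] by auto
      then have "y \<in> cube 0 x0 \<longleftrightarrow> x \<in> cube 0 x0" by (simp add: mem_cube)
      ultimately show ?thesis unfolding P_def by (simp add: cube_eq cinvD[OF cinv_rav])
    qed
    have Uinv: "cinv (int n) (indicator (U n) :: _ \<Rightarrow> ennreal)" for n
      unfolding cinv_def U_def indicator_def using Pinv[of _ n] by auto
    have Um[measurable]: "U n \<in> sets lebesgue" for n
    proof -
      have "U n = (indicator (U n) :: _ \<Rightarrow> ennreal) -` {1} \<inter> space lebesgue" by (auto simp: indicator_def)
      also have "\<dots> \<in> sets lebesgue" by (rule measurable_sets[OF cinv_borel[OF Uinv]]) auto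
      finally show ?thesis .
    qed
    have disj: "disjoint_family U"
      unfolding disjoint_family_on_def U_def
      by (auto simp: linorder_neq_iff)
    have UG: "(\<Union>n. U n) \<subseteq> G \<inter> cube 0 x0" unfolding U_def P_def using cube_refl by blast
    have BU: "B \<subseteq> (\<Union>n. U n)"
    proof
      fix x assume x: "x \<in> B"
      then have fr: "\<exists>\<^sub>F M in sequentially. rav (int M) f x < 0" and "x \<in> cube 0 x0" by (auto simp: B_def)
      have "\<exists>\<^sub>F M in sequentially. cube (int M) x \<subseteq> G \<and> rav (int M) f x < 0"
        using x G(2) by (intro frequently_eventually_conj fr open_contains_cube[OF G(1)]) auto
      then have "\<exists>M. P M x" unfolding P_def using \<open>x \<in> cube 0 x0\<close> by (auto dest: frequently_ex)
      then obtain n where "P n x" "\<forall>m<n. \<not> P m x" using exists_least_iff[of "\<lambda>M. P M x"] by auto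
      then show "x \<in> (\<Union>n. U n)" by (auto simp: U_def)
    qed
    have Un: "(\<integral>\<^sup>+x\<in>U n. ennreal (f x) \<partial>lebesgue) \<le> (\<integral>\<^sup>+x\<in>U n. ennreal (- f x) \<partial>lebesgue)" for n
    proof -
      have "(\<integral>\<^sup>+x. ennreal (f x) * indicator (U n) x \<partial>lebesgue) = (\<integral>\<^sup>+x. dav (int n) (\<lambda>x. ennreal (f x)) x * indicator (U n) x \<partial>lebesgue)"
        by (rule nn_integral_dav_cinv[OF _ Uinv, symmetric]) auto
      also have "\<dots> \<le> (\<integral>\<^sup>+x. dav (int n) (\<lambda>x. ennreal (- f x)) x * indicator (U n) x \<partial>lebesgue)"
        using rav_neg_dav[OF f] by (intro nn_integral_mono) (auto simp: indicator_def U_def P_def)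
      also have "\<dots> = (\<integral>\<^sup>+x. ennreal (- f x) * indicator (U n) x \<partial>lebesgue)"
        by (rule nn_integral_dav_cinv[OF _ Uinv]) auto
      finally show ?thesis .
    qed
    have "ennreal d * emeasure lebesgue B = (\<integral>\<^sup>+x. ennreal d * indicator B x \<partial>lebesgue)"
      by (simp add: nn_integral_cmult_indicator)
    also have "\<dots> \<le> (\<integral>\<^sup>+x\<in>(\<Union>n. U n). ennreal (f x) \<partial>lebesgue)"
      using BU by (intro nn_integral_mono) (auto simp: indicator_def B_def intro!: ennreal_leI)
    also have "\<dots> = (\<Sum>n. \<integral>\<^sup>+x\<in>U n. ennreal (f x) \<partial>lebesgue)"
      by (rule nn_integral_disjoint_family[OF _ _ disj]) auto
    also have "\<dots> \<le> (\<Sum>n. \<integral>\<^sup>+x\<in>U n. ennreal (- f x) \<partial>lebesgue)"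
      by (intro suminf_le Un) auto
    also have "\<dots> = (\<integral>\<^sup>+x\<in>(\<Union>n. U n). ennreal (- f x) \<partial>lebesgue)"
      by (rule nn_integral_disjoint_family[OF _ _ disj, symmetric]) auto
    \<comment> \<open>On B the function exceeds d > 0, so its negative part vanishes there and B can
      be removed from the domain.\<close>
    also have "\<dots> \<le> (\<integral>\<^sup>+x\<in>G - B. ennreal (- f x) * indicator (cube 0 x0) x \<partial>lebesgue)"
      using UG d by (intro nn_integral_mono) (auto simp: indicator_def B_def ennreal_neg)
    finally show ?thesis .
  qed
  have "\<exists>T. open T \<and> B \<subseteq> T \<and> emeasure lebesgue (T - B) < ennreal ((1/2)^k)" for k :: nat
  proof -
    have "(0::real) < (1/2)^k" by simp
    obtain T where "open T" "B \<subseteq> T" "T - B \<in> lmeasurable" "emeasure lebesgue (T - B) < ennreal ((1/2)^k)"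
      by (rule sets_lebesgue_outer_open[OF Bm \<open>0 < (1/2)^k\<close>])
    then show ?thesis by (intro exI[of _ T] conjI)
  qed
  then have "\<exists>T. \<forall>k. open (T k) \<and> B \<subseteq> T k \<and> emeasure lebesgue (T k - B) < ennreal ((1/2)^k)"
    by (intro choice allI)
  then obtain T where T': "\<forall>k. open (T k) \<and> B \<subseteq> T k \<and> emeasure lebesgue (T k - B) < ennreal ((1/2)^k)" ..
  have T: "open (T k)" "B \<subseteq> T k" "emeasure lebesgue (T k - B) < ennreal ((1/2)^k)" for k
    using spec[OF T', of k] by auto
  \<comment> \<open>Intersecting makes the open neighbourhoods of B decrease. The measure \<nu>
    below is finite and absolutely continuous, so its mass on the differences with B tends to the
    mass of a null set.\<close>
  define W where "W k = (\<Inter>i\<le>k. T i)" for k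
  have W: "open (W k)" "B \<subseteq> W k" for k unfolding W_def using T by auto
  have [measurable]: "W k \<in> sets lebesgue" for k using W by auto
  define \<nu> where "\<nu> = density lebesgue (\<lambda>x. ennreal (- f x) * indicator (cube 0 x0) x)"
  have \<nu>: "emeasure \<nu> S = (\<integral>\<^sup>+x\<in>S. ennreal (- f x) * indicator (cube 0 x0) x \<partial>lebesgue)" if "S \<in> sets lebesgue" for S
    unfolding \<nu>_def by (rule emeasure_density) (use that in auto)
  have fin: "emeasure \<nu> S < \<infinity>" if "S \<in> sets lebesgue" for S
  proof -
    have "emeasure \<nu> S \<le> (\<integral>\<^sup>+x\<in>cube 0 x0. ennreal \<bar>f x\<bar> \<partial>lebesgue)"
      unfolding \<nu>[OF that] by (intro nn_integral_mono) (auto simp: indicator_def intro!: ennreal_leI)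
    also have "\<dots> < \<infinity>" using f unfolding vol_dav lint_def by (simp add: ennreal_mult_less_top)
    finally show ?thesis .
  qed
  have null: "(\<Inter>k. W k - B) \<in> null_sets lebesgue"
  proof -
    have "emeasure lebesgue (\<Inter>k. W k - B) \<le> ennreal ((1/2)^k)" for k
    proof -
      have "emeasure lebesgue (\<Inter>k. W k - B) \<le> emeasure lebesgue (T k - B)"
        using T(1) by (intro emeasure_mono) (auto simp: W_def)
      then show ?thesis using T(3)[of k] by simp
    qed
    moreover have "(\<lambda>k. ennreal ((1/2)^k)) \<longlonglongrightarrow> ennreal 0"
      by (intro tendsto_ennrealI LIMSEQ_realpow_zero) auto
    ultimately have "emeasure lebesgue (\<Inter>k. W k - B) \<le> ennreal 0"
      by (intro LIMSEQ_le_const) auto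
    then show ?thesis by (auto simp: null_sets_def)
  qed
  have "(\<lambda>k. emeasure \<nu> (W k - B)) \<longlonglongrightarrow> emeasure \<nu> (\<Inter>k. W k - B)"
  proof (rule Lim_emeasure_decseq)
    show "range (\<lambda>k. W k - B) \<subseteq> sets \<nu>" by (auto simp: \<nu>_def)
    show "decseq (\<lambda>k. W k - B)" unfolding W_def decseq_def by force
    show "emeasure \<nu> (W k - B) \<noteq> \<infinity>" for k using fin[of "W k - B"] by auto
  qed
  moreover have "emeasure \<nu> (\<Inter>k. W k - B) = 0"
  proof -
    have "(\<Inter>k. W k - B) \<in> sets lebesgue" using null by auto
    moreover have "AE x in lebesgue. x \<notin> (\<Inter>k. W k - B)" using null by (rule AE_not_in)
    then have "(\<integral>\<^sup>+x\<in>(\<Inter>k. W k - B). ennreal (- f x) * indicator (cube 0 x0) x \<partial>lebesgue) = (\<integral>\<^sup>+(x::real^'n). 0 \<partial>lebesgue)"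
      by (intro nn_integral_cong_AE) (auto elim!: eventually_mono simp: indicator_def)
    ultimately show ?thesis by (simp add: \<nu>)
  qed
  ultimately have "(\<lambda>k. emeasure \<nu> (W k - B)) \<longlonglongrightarrow> 0" by simp
  moreover have "ennreal d * emeasure lebesgue B \<le> emeasure \<nu> (W k - B)" for k
    using key[OF W, of k] by (simp add: \<nu>)
  ultimately have "ennreal d * emeasure lebesgue B \<le> 0"
    by (intro LIMSEQ_le_const) auto
  then have "emeasure lebesgue B = 0" using d by simp
  then show ?thesis by (simp add: null_sets_def)
qed

lemma AE_cube0:
  assumes "\<And>x0::real^'n::finite. AE x in lebesgue. x \<in> cube 0 x0 \<longrightarrow> P x"
  shows "AE x in lebesgue. P x"
proof -
  have "AE x in lebesgue. \<forall>m::int^'n. x \<in> dcube 0 m \<longrightarrow> P x"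
    unfolding AE_all_countable using assms dcube_eq_cube[of 0] by metis
  then show ?thesis
    by eventually_elim (metis mem_dcube)
qed

text \<open>Rationals q1 < q2 fit between c and f x, and the null set lemma for f - q1 with d = q2 -
  q1 excludes averages that fall below q1 infinitely often. There are countably many such pairs.
  Applied to f and to -f, this one-sided statement gives the limit.\<close>

lemma lebesgue_diff_below:
  fixes f :: "real^'n::finite \<Rightarrow> real"
  assumes f: "lint f"
  shows "AE x in lebesgue. \<forall>c<f x. eventually (\<lambda>M. c < rav (int M) f x) sequentially"
proof (rule AE_cube0)
  fix x0 :: "real^'n"
  have "AE x in lebesgue. \<not> (x \<in> cube 0 x0 \<and> f x > q2 \<and> (\<exists>\<^sub>F M in sequentially. rav (int M) f x < q1))"
    if "q1 < q2" for q1 q2 :: real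
  proof -
    have g: "lint (\<lambda>x. f x - q1)" by (intro lint_minus f lint_const)
    have "AE x in lebesgue. x \<notin> {x \<in> cube 0 x0. f x - q1 > q2 - q1 \<and> (\<exists>\<^sub>F M in sequentially. rav (int M) (\<lambda>x. f x - q1) x < 0)}"
      by (rule AE_not_in, rule lebesgue_diff_null[OF g]) (use that in simp)
    then show ?thesis by (simp add: rav_diff[OF f lint_const])
  qed
  then have "AE x in lebesgue. \<forall>(q1::rat) (q2::rat). real_of_rat q1 < real_of_rat q2 \<longrightarrow>
     \<not> (x \<in> cube 0 x0 \<and> f x > real_of_rat q2 \<and> (\<exists>\<^sub>F M in sequentially. rav (int M) f x < real_of_rat q1))"
    unfolding AE_all_countable by auto
  then show "AE x in lebesgue. x \<in> cube 0 x0 \<longrightarrow> (\<forall>c<f x. eventually (\<lambda>M. c < rav (int M) f x) sequentially)"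
  proof eventually_elim
    case (elim x)
    show ?case
    proof (intro impI allI)
      fix c assume "x \<in> cube 0 x0" "c < f x"
      obtain q2 where q2: "c < real_of_rat q2" "real_of_rat q2 < f x"
        using of_rat_dense[OF \<open>c < f x\<close>] by auto
      obtain q1 where q1: "c < real_of_rat q1" "real_of_rat q1 < real_of_rat q2"
        using of_rat_dense[OF q2(1)] by auto
      have "\<forall>\<^sub>F M in sequentially. \<not> rav (int M) f x < real_of_rat q1"
        using elim q1 q2 \<open>x \<in> cube 0 x0\<close> by (auto simp: frequently_def)
      then show "eventually (\<lambda>M. c < rav (int M) f x) sequentially"
        by eventually_elim (use q1 in auto)
    qed
  qed
qed

theorem dyadic_lebesgue_diff:
  fixes f :: "real^'n::finite \<Rightarrow> real"
  assumes f: "lint f"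
  shows "AE x in lebesgue. (\<lambda>M. rav (int M) f x) \<longlonglongrightarrow> f x"
proof -
  have g: "lint (\<lambda>x. -1 * f x)" by (intro lint_cmult f)
  show ?thesis
    using lebesgue_diff_below[OF f] lebesgue_diff_below[OF g]
  proof eventually_elim
    case (elim x)
    show ?case
    proof (rule order_tendstoI)
      fix c assume "c > f x"
      then have "-c < -1 * f x" by simp
      with elim(2) have "eventually (\<lambda>M. -c < rav (int M) (\<lambda>x. -1 * f x) x) sequentially" by blast
      then show "eventually (\<lambda>M. rav (int M) f x < c) sequentially"
        unfolding rav_cmult by simp
    qed (use elim in auto)
  qed
qed

section \<open>The dyadic John--Nirenberg inequality\<close>

lemma lint_rav: assumes "lint a" shows "lint (rav i a)"
  unfolding lint_def
proof (intro conjI allI)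
  have [measurable]: "a \<in> borel_measurable lebesgue" using assms by (rule lint_measurable)
  fix j x
  show "dav j (\<lambda>y. ennreal \<bar>rav i a y\<bar>) x < \<infinity>"
  proof (cases "j \<le> i")
    case True
    have "dav j (\<lambda>y. ennreal \<bar>rav i a y\<bar>) x \<le> dav j (dav i (\<lambda>y. ennreal \<bar>a y\<bar>)) x"
      by (intro dav_mono rav_abs_dav assms)
    also have "\<dots> = dav j (\<lambda>y. ennreal \<bar>a y\<bar>) x" using True by (intro dav_tower) auto
    also have "\<dots> < \<infinity>" using assms by (simp add: lint_def)
    finally show ?thesis .
  next
    case False
    have "cinv j (\<lambda>y. ennreal \<bar>rav i a y\<bar>)"
      by (rule cinv_compose[OF cinv_mono[OF cinv_rav]]) (use False in simp)
    then show ?thesis by (simp add: dav_cinv)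
  qed
qed simp

lemma dav_Suc_le:
  fixes f :: "real^'n::finite \<Rightarrow> ennreal"
  shows "dav (j + 1) f x \<le> ennreal (2 ^ CARD('n)) * dav j f x"
proof -
  have "(2::real) powr (real_of_int (j+1) * real CARD('n)) = 2 ^ CARD('n) * 2 powr (real_of_int j * real CARD('n))"
    by (simp add: distrib_right powr_add powr_realpow)
  moreover have "(\<integral>\<^sup>+y\<in>cube (j+1) x. f y \<partial>lebesgue) \<le> (\<integral>\<^sup>+y\<in>cube j x. f y \<partial>lebesgue)"
    using cube_mono[of j "j+1" x] by (intro nn_integral_mono) (auto simp: indicator_def)
  ultimately show ?thesis
    unfolding dav_def by (simp add: ennreal_mult mult.assoc mult_left_mono del: of_int_add)
qed

lemma ennreal_le_suminf: "f n \<le> (\<Sum>n. f n :: ennreal)"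
  using sum_le_suminf[of f "{n}"] by simp

lemma rav_cinv_diff:
  assumes "lint a" "i \<le> j" shows "rav j (\<lambda>z. a z - rav i a z) y = rav j a y - rav i a y"
  by (simp add: rav_diff[OF assms(1) lint_rav[OF assms(1)]] rav_cinv[OF cinv_mono[OF cinv_rav assms(2)]])

lemma summable_powr_geometric:
  fixes q L :: real assumes "L > 0"
  shows "summable (\<lambda>m::nat. (real (Suc m) * L) powr q * (1/2)^m)"
proof -
  have "(\<lambda>n. (1 + inverse (real (Suc n))) powr q) \<longlonglongrightarrow> (1 + 0) powr q"
    by (intro tendsto_intros LIMSEQ_inverse_real_of_nat) auto
  then have "eventually (\<lambda>n. (1 + inverse (real (Suc n))) powr q < 3/2) sequentially"
    by (intro order_tendstoD(2)) auto
  then obtain N where N: "\<And>n. n \<ge> N \<Longrightarrow> (1 + inverse (real (Suc n))) powr q < 3/2"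
    by (auto simp: eventually_sequentially)
  show ?thesis
  proof (rule summable_ratio_test[of "3/4" N])
    fix n assume n: "N \<le> n"
    have "real (Suc (Suc n)) * L = (1 + inverse (real (Suc n))) * (real (Suc n) * L)" by (simp add: field_simps)
    then have "(real (Suc (Suc n)) * L) powr q = (1 + inverse (real (Suc n))) powr q * (real (Suc n) * L) powr q"
      using assms by (simp only: powr_mult[symmetric])
    also have "\<dots> \<le> 3/2 * (real (Suc n) * L) powr q"
      by (intro mult_right_mono) (use N[OF n] in auto)
    finally show "norm ((real (Suc (Suc n)) * L) powr q * (1/2)^Suc n) \<le> 3/4 * norm ((real (Suc n) * L) powr q * (1/2)^n)"
      by (simp add: field_simps)
  qed simp
qed

locale bmo =
  fixes a :: "real^'n::finite \<Rightarrow> real" and K :: real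
  assumes a: "lint a" and K: "K > 0"
    and osc: "\<And>j x. dav j (\<lambda>y. ennreal \<bar>a y - rav j a y\<bar>) x \<le> ennreal K"
begin

lemma a_measurable [measurable]: "a \<in> borel_measurable lebesgue"
  using a by (rule lint_measurable)

text \<open>The stopping height \<open>2 * K\<close> plus the largest possible jump
  \<open>2 ^ CARD('n) * K\<close> between consecutive levels: when the average first leaves the
  height, it has moved by at most L.\<close>

definition L :: real where "L = 2 * K + 2 ^ CARD('n) * K"

lemma L_pos: "L > 0"
  unfolding L_def using K by (simp add: add_pos_pos)

lemma rav_jump: "\<bar>rav (j+1) a x - rav j a x\<bar> \<le> 2 ^ CARD('n) * K"
proof -
  have "ennreal \<bar>rav (j+1) a x - rav j a x\<bar> \<le> dav (j+1) (\<lambda>y. ennreal \<bar>a y - rav j a y\<bar>) x"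
    using rav_abs_dav[OF lint_minus[OF a lint_rav[OF a]], of "j+1" j x] rav_cinv_diff[OF a, of j "j+1" x]
    by simp
  also have "\<dots> \<le> ennreal (2 ^ CARD('n)) * dav j (\<lambda>y. ennreal \<bar>a y - rav j a y\<bar>) x"
    by (rule dav_Suc_le)
  also have "\<dots> \<le> ennreal (2 ^ CARD('n)) * ennreal K" by (intro mult_left_mono osc) simp
  also have "\<dots> = ennreal (2 ^ CARD('n) * K)" using K by (simp add: ennreal_mult)
  finally show ?thesis using K by (simp add: ennreal_le_iff)
qed

text \<open>A level set of the deviation from \<open>rav i a\<close>, with \<open>a\<close> replaced
  by its averages at finer levels. Membership is then decided by a stopping argument, and Lebesgue
  differentiation brings \<open>a\<close> itself back in \<open>john_nirenberg\<close>.\<close>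

definition dev :: "int \<Rightarrow> nat \<Rightarrow> (real^'n) set" where
  "dev i m = {x. \<exists>n::nat. \<bar>rav (i + int n) a x - rav i a x\<bar> > real m * L}"

lemma dev_sets [measurable]: "dev i m \<in> sets lebesgue"
proof -
  have "dev i m = {x \<in> space lebesgue. \<exists>n::nat. \<bar>rav (i + int n) a x - rav i a x\<bar> > real m * L}"
    by (simp add: dev_def)
  also have "\<dots> \<in> sets lebesgue" by measurable
  finally show ?thesis .
qed

text \<open>A stopping time: n is the first number of levels after which the average has moved by
  more than \<open>2 * K\<close>. The sets consist of Calderon-Zygmund cubes of \<open>a\<close>,
  sorted by level; the height is twice the mean oscillation, which is the origin of the factor
  1/2.\<close>

definition exc :: "int \<Rightarrow> nat \<Rightarrow> (real^'n) set" where
  "exc i n = {x. \<bar>rav (i + int n) a x - rav i a x\<bar> > 2 * K \<and> (\<forall>m<n. \<not> \<bar>rav (i + int m) a x - rav i a x\<bar> > 2 * K)}"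

lemma cinv_exc: "cinv (i + int n) (indicator (exc i n) :: _ \<Rightarrow> ennreal)"
  unfolding cinv_def
proof (intro allI impI)
  fix x y :: "real^'n" assume y: "y \<in> cube (i + int n) x"
  have "rav (i + int m) a y = rav (i + int m) a x" if "m \<le> n" for m
    using cinvD[OF cinv_mono[OF cinv_rav] y] that by simp
  moreover have "rav i a y = rav i a x" using cinvD[OF cinv_mono[OF cinv_rav] y] by simp
  ultimately show "indicator (exc i n) y = (indicator (exc i n) x :: ennreal)"
    unfolding exc_def indicator_def by auto
qed

lemma exc_sets [measurable]: "exc i n \<in> sets lebesgue"
proof -
  have "exc i n = (indicator (exc i n) :: _ \<Rightarrow> ennreal) -` {1} \<inter> space lebesgue" by (auto simp: indicator_def)
  also have "\<dots> \<in> sets lebesgue" by (rule measurable_sets[OF cinv_borel[OF cinv_exc]]) auto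
  finally show ?thesis .
qed

lemma disjoint_exc: "disjoint_family (exc i)"
  unfolding disjoint_family_on_def exc_def by (auto simp: linorder_neq_iff)

text \<open>Chebyshev's inequality: on each stopping cube the mean of the deviation exceeds
  \<open>2 * K\<close>, while the mean over the whole cube is at most K.\<close>

lemma sum_exc: "(\<Sum>n. dav i (indicator (exc i n)) x) \<le> ennreal (1/2)"
proof -
  let ?g = "\<lambda>y. ennreal \<bar>a y - rav i a y\<bar>"
  have 1: "ennreal (2*K) * dav i (indicator (exc i n)) x \<le> dav i (\<lambda>y. indicator (exc i n) y * ?g y) x" for n
  proof -
    let ?j = "i + int n"
    have "ennreal (2*K) * dav i (indicator (exc i n)) x = dav i (\<lambda>y. ennreal (2*K) * indicator (exc i n) y) x"
      by (rule dav_cmult[symmetric]) auto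
    also have "\<dots> \<le> dav i (\<lambda>y. indicator (exc i n) y * dav ?j ?g y) x"
    proof (rule dav_mono)
      fix y
      show "ennreal (2*K) * indicator (exc i n) y \<le> indicator (exc i n) y * dav ?j ?g y"
      proof (cases "y \<in> exc i n")
        case True
        then have "ennreal (2*K) \<le> ennreal \<bar>rav ?j a y - rav i a y\<bar>" by (intro ennreal_leI) (auto simp: exc_def)
        also have "\<dots> \<le> dav ?j ?g y"
          using rav_abs_dav[OF lint_minus[OF a lint_rav[OF a]], of ?j i y] rav_cinv_diff[OF a, of i ?j y] by simp
        finally show ?thesis using True by simp
      qed simp
    qed
    also have "\<dots> = dav i (dav ?j (\<lambda>y. indicator (exc i n) y * ?g y)) x"
      by (intro dav_cong dav_mult_cinv[symmetric] cinv_exc) measurable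
    also have "\<dots> = dav i (\<lambda>y. indicator (exc i n) y * ?g y) x"
      by (rule dav_tower) auto
    finally show ?thesis .
  qed
  have "ennreal (2*K) * (\<Sum>n. dav i (indicator (exc i n)) x) = (\<Sum>n. ennreal (2*K) * dav i (indicator (exc i n)) x)"
    by simp
  also have "\<dots> \<le> (\<Sum>n. dav i (\<lambda>y. indicator (exc i n) y * ?g y) x)"
    by (intro suminf_le 1) auto
  also have "\<dots> = dav i (\<lambda>y. \<Sum>n. indicator (exc i n) y * ?g y) x"
    by (rule dav_suminf[symmetric]) auto
  also have "\<dots> \<le> dav i ?g x"
  proof (rule dav_mono)
    fix y
    have "(\<Sum>n. indicator (exc i n) y * ?g y) = indicator (\<Union>n. exc i n) y * ?g y"
      using suminf_indicator[OF disjoint_exc, of i y] by simp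
    also have "\<dots> \<le> ?g y" by (auto simp: indicator_def)
    finally show "(\<Sum>n. indicator (exc i n) y * ?g y) \<le> ?g y" .
  qed
  also have "\<dots> \<le> ennreal K" by (rule osc)
  also have "\<dots> = ennreal (2*K) * ennreal (1/2)" using K by (subst ennreal_mult[symmetric]) auto
  finally show ?thesis
    using K by (subst (asm) ennreal_mult_le_mult_iff) auto
qed

text \<open>A point that deviates by more than (m + 1) L must first be stopped, having moved by at
  most L, and must then still deviate by more than m L from the average on its stopping cube. The
  stopping cubes fill at most half of the cube, so each further L costs a factor 1/2. The induction
  hypothesis is needed on the stopping cubes, hence for all levels and points.\<close>

lemma dev_measure: "dav i (indicator (dev i m)) x \<le> ennreal ((1/2)^m)"
proof (induction m arbitrary: i x)
  case 0
  have "dav i (indicator (dev i 0)) x \<le> dav i (\<lambda>_. 1) x" by (intro dav_mono) (auto simp: indicator_def)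
  then show ?case by simp
next
  case (Suc m)
  have "dav i (indicator (dev i (Suc m))) x \<le> dav i (\<lambda>y. \<Sum>n. indicator (exc i n) y * indicator (dev (i + int n) m) y) x"
  proof (rule dav_mono)
    fix y
    show "indicator (dev i (Suc m)) y \<le> (\<Sum>n. indicator (exc i n) y * indicator (dev (i + int n) m) y :: ennreal)"
    proof (cases "y \<in> dev i (Suc m)")
      case True
      define P where "P n \<longleftrightarrow> \<bar>rav (i + int n) a y - rav i a y\<bar> > 2 * K" for n
      obtain k where k: "\<bar>rav (i + int k) a y - rav i a y\<bar> > real (Suc m) * L"
        using True by (auto simp: dev_def)
      have LK: "L \<ge> 2 * K" unfolding L_def using K by simp
      have mL: "real (Suc m) * L = real m * L + L" by (simp add: algebra_simps)
      have mL0: "real m * L \<ge> 0" using L_pos by simp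
      have "P k" unfolding P_def using k LK mL mL0 by linarith
      then obtain n where n: "P n" "\<forall>l<n. \<not> P l" using exists_least_iff[of P] by auto
      have nk: "n \<le> k" using n \<open>P k\<close> by (meson not_le)
      \<comment> \<open>At n = 0 the deviation is zero, so the stopping level has a predecessor,
        where the deviation was still at most \<open>2 * K\<close>.\<close>
      have "n \<noteq> 0" using n(1) K unfolding P_def by (intro notI) simp
      then obtain n' where n': "n = Suc n'" by (cases n) auto
      have jump: "\<bar>rav (i + int n) a y - rav i a y\<bar> \<le> L"
      proof -
        have "\<not> P n'" using n n' by simp
        then have "\<bar>rav (i + int n') a y - rav i a y\<bar> \<le> 2 * K" by (simp add: P_def)
        moreover have "\<bar>rav (i + int n) a y - rav (i + int n') a y\<bar> \<le> 2 ^ CARD('n) * K"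
          using rav_jump[of "i + int n'" y] n' by (simp add: add_ac)
        ultimately show ?thesis unfolding L_def by linarith
      qed
      have "i + int n + int (k - n) = i + int k" using nk by simp
      then have "\<bar>rav (i + int n + int (k - n)) a y - rav (i + int n) a y\<bar> > real m * L"
        using k jump mL by simp
      then have "y \<in> dev (i + int n) m" unfolding dev_def by blast
      moreover have "y \<in> exc i n" using n by (auto simp: exc_def P_def)
      ultimately have "indicator (dev i (Suc m)) y \<le> (indicator (exc i n) y * indicator (dev (i + int n) m) y :: ennreal)"
        by (simp add: indicator_def)
      also have "\<dots> \<le> (\<Sum>n. indicator (exc i n) y * indicator (dev (i + int n) m) y)"
        by (rule ennreal_le_suminf)
      finally show ?thesis .
    qed simp
  qed
  also have "\<dots> = (\<Sum>n. dav i (\<lambda>y. indicator (exc i n) y * indicator (dev (i + int n) m) y) x)"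
    by (rule dav_suminf) auto
  also have "\<dots> \<le> (\<Sum>n. ennreal ((1/2)^m) * dav i (indicator (exc i n)) x)"
  proof (intro suminf_le)
    fix n
    let ?j = "i + int n"
    have "dav i (\<lambda>y. indicator (exc i n) y * indicator (dev ?j m) y) x = dav i (dav ?j (\<lambda>y. indicator (exc i n) y * indicator (dev ?j m) y)) x"
      by (rule dav_tower[symmetric]) auto
    also have "\<dots> = dav i (\<lambda>y. indicator (exc i n) y * dav ?j (indicator (dev ?j m)) y) x"
      by (intro dav_cong dav_mult_cinv cinv_exc) measurable
    also have "\<dots> \<le> dav i (\<lambda>y. indicator (exc i n) y * ennreal ((1/2)^m)) x"
      by (intro dav_mono mult_left_mono Suc) auto
    also have "\<dots> = ennreal ((1/2)^m) * dav i (indicator (exc i n)) x"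
      by (subst mult.commute, rule dav_cmult) auto
    finally show "dav i (\<lambda>y. indicator (exc i n) y * indicator (dev ?j m) y) x \<le> ennreal ((1/2)^m) * dav i (indicator (exc i n)) x" .
  qed auto
  also have "\<dots> = ennreal ((1/2)^m) * (\<Sum>n. dav i (indicator (exc i n)) x)" by simp
  also have "\<dots> \<le> ennreal ((1/2)^m) * ennreal (1/2)" by (intro mult_left_mono sum_exc) auto
  also have "\<dots> = ennreal ((1/2)^Suc m)" by (subst ennreal_mult[symmetric]) auto
  finally show ?case .
qed

text \<open>The deviation is cut into shells of width L. The shell between m L and (m + 1) L
  contributes at most ((m + 1) L)^q 2^(-m), which is summable for every q.\<close>

theorem john_nirenberg:
  assumes q: "q > 0"
  shows "\<exists>C>0. \<forall>i x. dav i (\<lambda>y. ennreal (\<bar>a y - rav i a y\<bar> powr q)) x \<le> ennreal C"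
proof (intro exI conjI allI)
  let ?c = "\<lambda>m::nat. (real (Suc m) * L) powr q"
  let ?C = "\<Sum>m. ?c m * (1/2)^m"
  have sm: "summable (\<lambda>m. ?c m * (1/2)^m)" by (rule summable_powr_geometric[OF L_pos])
  show "?C > 0" by (rule suminf_pos[OF sm]) (use L_pos in auto)
  fix i x
  have "dav i (\<lambda>y. ennreal (\<bar>a y - rav i a y\<bar> powr q)) x \<le> dav i (\<lambda>y. \<Sum>m. ennreal (?c m) * indicator (dev i m) y) x"
  proof (rule dav_mono_AE)
    show "AE y in lebesgue. ennreal (\<bar>a y - rav i a y\<bar> powr q) \<le> (\<Sum>m. ennreal (?c m) * indicator (dev i m) y)"
      using dyadic_lebesgue_diff[OF a]
    proof eventually_elim
      case (elim y)
      define t where "t = \<bar>a y - rav i a y\<bar>"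
      \<comment> \<open>Otherwise all finer averages stay within m L of \<open>rav i a y\<close>,
        and hence so does their limit \<open>a y\<close>.\<close>
      have dev: "y \<in> dev i m" if "t > real m * L" for m
      proof (rule ccontr)
        assume "y \<notin> dev i m"
        then have le: "\<bar>rav (i + int n) a y - rav i a y\<bar> \<le> real m * L" for n by (auto simp: dev_def not_less)
        have "(\<lambda>M. \<bar>rav (int M) a y - rav i a y\<bar>) \<longlonglongrightarrow> t"
          unfolding t_def by (intro tendsto_intros elim)
        moreover have "\<exists>N. \<forall>M\<ge>N. \<bar>rav (int M) a y - rav i a y\<bar> \<le> real m * L"
        proof (intro exI allI impI)
          fix M :: nat assume "nat i \<le> M"
          then have "i + int (nat (int M - i)) = int M" by simp
          then show "\<bar>rav (int M) a y - rav i a y\<bar> \<le> real m * L" using le[of "nat (int M - i)"] by simp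
        qed
        ultimately have "t \<le> real m * L" by (rule LIMSEQ_le_const2)
        with that show False by simp
      qed
      show ?case
      proof (cases "t = 0")
        case False
        then have t: "t > 0" by (simp add: t_def)
        \<comment> \<open>Ceiling minus one places t in the shell m L < t \<le> (m + 1) L; the
          strict lower inequality is the one that \<open>dev\<close> asks for.\<close>
        define m where "m = nat (\<lceil>t / L\<rceil> - 1)"
        have "t / L > 0" using t L_pos by simp
        then have "real m = of_int (\<lceil>t / L\<rceil> - 1)" unfolding m_def by simp
        then have "real m < t / L" "t / L \<le> real (Suc m)" by linarith+
        then have m: "real m * L < t" "t \<le> real (Suc m) * L" using L_pos by (auto simp: field_simps)
        have "ennreal (t powr q) \<le> ennreal (?c m) * indicator (dev i m) y"
          using dev[OF m(1)] m(2) q t by (auto intro!: ennreal_leI powr_mono2)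
        also have "\<dots> \<le> (\<Sum>m. ennreal (?c m) * indicator (dev i m) y)"
          by (rule ennreal_le_suminf)
        finally show ?thesis by (simp add: t_def)
      qed (simp add: t_def)
    qed
  qed
  also have "\<dots> = (\<Sum>m. ennreal (?c m) * dav i (indicator (dev i m)) x)"
    by (subst dav_suminf) (auto simp: dav_cmult)
  also have "\<dots> \<le> (\<Sum>m. ennreal (?c m) * ennreal ((1/2)^m))"
    by (intro suminf_le mult_left_mono dev_measure) auto
  also have "\<dots> = (\<Sum>m. ennreal (?c m * (1/2)^m))" by (simp add: ennreal_mult)
  also have "\<dots> = ennreal ?C" by (intro suminf_ennreal2 sm) auto
  finally show "dav i (\<lambda>y. ennreal (\<bar>a y - rav i a y\<bar> powr q)) x \<le> ennreal ?C" .
qed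

end

section \<open>From the definition of dyadic BMO to mean oscillation on every cube\<close>

lemma bounded_cube: "bounded (cube j (x::real^'n::finite))"
proof (rule bounded_subset[OF bounded_cbox])
  show "cube j x \<subseteq> cbox (\<chi> i. real_of_int (cidx j x$i) * 2 powr (- real_of_int j)) (\<chi> i. (real_of_int (cidx j x$i) + 1) * 2 powr (- real_of_int j))"
    unfolding cube_eq_dcube dcube_def by (auto simp: mem_box_cart less_imp_le)
qed

lemma L1_loc_lint: fixes a :: "real^'n::finite \<Rightarrow> real" assumes "L1_loc a" shows "lint a"
  unfolding lint_def
proof (intro conjI allI)
  show [measurable]: "a \<in> borel_measurable lebesgue" using assms by (simp add: L1_loc_def)
  fix j and x :: "real^'n"
  have "compact (closure (cube j x))" using bounded_cube by (simp add: compact_closure)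
  then have "set_integrable lebesgue (closure (cube j x)) a" using assms by (simp add: L1_loc_def)
  then have "set_integrable lebesgue (cube j x) a"
    by (rule set_integrable_subset) (auto simp: closure_subset)
  then have "(\<integral>\<^sup>+y. ennreal (norm (indicator (cube j x) y *\<^sub>R a y)) \<partial>lebesgue) < \<infinity>"
    unfolding set_integrable_def integrable_iff_bounded by simp
  also have "(\<integral>\<^sup>+y. ennreal (norm (indicator (cube j x) y *\<^sub>R a y)) \<partial>lebesgue) = (\<integral>\<^sup>+y\<in>cube j x. ennreal \<bar>a y\<bar> \<partial>lebesgue)"
    by (intro nn_integral_cong) (auto simp: indicator_def)
  finally show "dav j (\<lambda>y. ennreal \<bar>a y\<bar>) x < \<infinity>"
    unfolding dav_def by (simp add: ennreal_mult_less_top)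
qed

text \<open>Every cube has positive measure, so it contains a point at which the sharp function is
  at most K, and the supremum at that point includes this very cube. The maximum with 1 provides the
  positive constant of the locale.\<close>

lemma dyadic_BMO_bmo:
  fixes a :: "real^'n::finite \<Rightarrow> real"
  assumes "dyadic_BMO a" shows "\<exists>K. bmo a K"
proof -
  obtain K where K: "AE x in lebesgue. sharp_dyadic a x \<le> ereal K" and "L1_loc a"
    using assms by (auto simp: dyadic_BMO_def)
  then have a: "lint a" by (simp add: L1_loc_lint)
  have "dav j (\<lambda>y. ennreal \<bar>a y - rav j a y\<bar>) x \<le> ennreal (max K 1)" for j x
  proof -
    have "\<exists>z\<in>cube j x. sharp_dyadic a z \<le> ereal K"
    proof (rule ccontr)
      assume "\<not> ?thesis"
      then have "AE z in lebesgue. z \<notin> cube j x" using K by (auto elim: eventually_mono)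
      then have "emeasure lebesgue (cube j x) = 0" by (subst (asm) AE_iff_measurable[of "cube j x"]) auto
      then show False by (simp add: emeasure_cube)
    qed
    then obtain z where z: "z \<in> cube j x" "sharp_dyadic a z \<le> ereal K" by blast
    have "ereal (cube_avg (cube j x) (\<lambda>y. \<bar>a y - cube_avg (cube j x) a\<bar>)) \<le> sharp_dyadic a z"
      unfolding sharp_dyadic_def using z(1) by (intro SUP_upper) (auto simp: dyadic_cubes_iff)
    then have "rav j (\<lambda>y. \<bar>a y - rav j a x\<bar>) x \<le> K"
      using z(2) unfolding rav_def by (meson ereal_less_eq(3) order_trans)
    moreover have "dav j (\<lambda>y. ennreal \<bar>a y - rav j a y\<bar>) x = dav j (\<lambda>y. ennreal \<bar>a y - rav j a x\<bar>) x"
      by (intro dav_cong) (simp add: cinvD[OF cinv_rav])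
    moreover have "\<dots> = ennreal (rav j (\<lambda>y. \<bar>a y - rav j a x\<bar>) x)"
      by (intro rav_dav[symmetric] lint_abs lint_minus a lint_const) auto
    ultimately show ?thesis by (simp add: ennreal_leI)
  qed
  with a show ?thesis by (intro exI[of _ "max K 1"]) (simp add: bmo_def)
qed

section \<open>Block spaces\<close>

text \<open>A norm bound witnessed by one decomposition. The norm is an infimum that may not be
  attained; carrying witnesses avoids an epsilon in every triangle inequality, and the infimum
  enters again only in \<open>BS_bounded_operator\<close>.\<close>

definition BS :: "real \<Rightarrow> real \<Rightarrow> real \<Rightarrow> (real^'n::finite \<Rightarrow> real) \<Rightarrow> bool" where
  "BS u v S h \<longleftrightarrow> (\<exists>lam A. block_decomp u v h lam A \<and> (\<Sum>j. \<bar>lam j\<bar>) \<le> S)"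

lemma Bex_dyadic_cubes: "(\<exists>Q\<in>dyadic_cubes. P Q) \<longleftrightarrow> (\<exists>j x. P (cube j x))"
proof
  assume "\<exists>Q\<in>dyadic_cubes. P Q"
  then obtain Q where Q: "Q \<in> dyadic_cubes" "P Q" ..
  then obtain j x where "Q = cube j x" unfolding dyadic_cubes_iff by blast
  with Q(2) have "P (cube j x)" by simp
  then show "\<exists>j x. P (cube j x)" by (intro exI)
next
  assume "\<exists>j x. P (cube j x)"
  then obtain j x where "P (cube j x)" by (elim exE)
  moreover have "cube j x \<in> dyadic_cubes" unfolding dyadic_cubes_iff by blast
  ultimately show "\<exists>Q\<in>dyadic_cubes. P Q" by (rule bexI)
qed

text \<open>Raising the normalisation to the power v and integrating in ennreal merges membership in
  L^v and the norm bound into a single inequality.\<close>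

lemma is_block_iff:
  fixes A :: "real^'n::finite \<Rightarrow> real"
  assumes v: "v > 0"
  shows "is_block u v A \<longleftrightarrow> A \<in> borel_measurable lebesgue \<and> (\<exists>j x. {x. A x \<noteq> 0} \<subseteq> cube j x \<and>
     (\<integral>\<^sup>+x. ennreal (\<bar>A x\<bar> powr v) \<partial>lebesgue) \<le> ennreal (vol TYPE('n) j powr (1 - v/u)))"
proof (cases "A \<in> borel_measurable lebesgue")
  case True
  note [measurable] = True
  have eq: "(vol TYPE('n) j powr (1/v - 1/u)) powr v = vol TYPE('n) j powr (1 - v/u)" for j
  proof -
    have "(1/v - 1/u) * v = 1 - v/u" using v by (simp add: left_diff_distrib)
    then show ?thesis by (simp only: powr_powr mult.assoc)
  qed
  have 1: "Lp_mem v A \<and> Lp_norm v A \<le> vol TYPE('n) j powr (1/v - 1/u) \<longleftrightarrow>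
     (\<integral>\<^sup>+x. ennreal (\<bar>A x\<bar> powr v) \<partial>lebesgue) \<le> ennreal (vol TYPE('n) j powr (1 - v/u))" for j
  proof
    assume *: "Lp_mem v A \<and> Lp_norm v A \<le> vol TYPE('n) j powr (1/v - 1/u)"
    then have int: "integrable lebesgue (\<lambda>x. \<bar>A x\<bar> powr v)" by (simp add: Lp_mem_def)
    have "(\<integral>x. \<bar>A x\<bar> powr v \<partial>lebesgue) = Lp_norm v A powr v"
      using v by (simp add: Lp_norm_def powr_powr)
    also have "\<dots> \<le> (vol TYPE('n) j powr (1/v - 1/u)) powr v"
      using * v by (intro powr_mono2) (auto simp: Lp_norm_def)
    finally show "(\<integral>\<^sup>+x. ennreal (\<bar>A x\<bar> powr v) \<partial>lebesgue) \<le> ennreal (vol TYPE('n) j powr (1 - v/u))"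
      unfolding eq using int by (subst nn_integral_eq_integral) (auto intro: ennreal_leI)
  next
    assume *: "(\<integral>\<^sup>+x. ennreal (\<bar>A x\<bar> powr v) \<partial>lebesgue) \<le> ennreal (vol TYPE('n) j powr (1 - v/u))"
    have int: "integrable lebesgue (\<lambda>x. \<bar>A x\<bar> powr v)"
      by (rule integrableI_bounded) (use * in \<open>auto intro: le_less_trans\<close>)
    have "(\<integral>x. \<bar>A x\<bar> powr v \<partial>lebesgue) \<le> vol TYPE('n) j powr (1 - v/u)"
      using * int by (subst (asm) nn_integral_eq_integral) (auto simp: ennreal_le_iff)
    then have "Lp_norm v A \<le> (vol TYPE('n) j powr (1 - v/u)) powr (1/v)"
      unfolding Lp_norm_def using v by (intro powr_mono2) auto
    also have "\<dots> = vol TYPE('n) j powr (1/v - 1/u)"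
    proof -
      have "(1 - v/u) * (1/v) = 1/v - 1/u" using v by (simp add: field_simps)
      then show ?thesis by (simp only: powr_powr mult.assoc)
    qed
    finally show "Lp_mem v A \<and> Lp_norm v A \<le> vol TYPE('n) j powr (1/v - 1/u)"
      using int by (simp add: Lp_mem_def)
  qed
  have "is_block u v A \<longleftrightarrow> (\<exists>j x. {x. A x \<noteq> 0} \<subseteq> cube j x \<and> Lp_mem v A \<and> Lp_norm v A \<le> vol TYPE('n) j powr (1/v - 1/u))"
    unfolding is_block_def Bex_dyadic_cubes measure_cube by blast
  then show ?thesis unfolding 1 using True by simp
qed (auto simp: is_block_def Lp_mem_def)

lemma block_measurable: "is_block u v A \<Longrightarrow> A \<in> borel_measurable lebesgue"
  by (simp add: is_block_def Lp_mem_def)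

text \<open>Truncation at height c: below c the first term suffices, above c the surplus power of t
  is traded for a power of c.\<close>

lemma powr_young_level:
  fixes t c s v :: real
  assumes "t \<ge> 0" "c > 0" "0 < s" "s \<le> v"
  shows "t powr s \<le> c powr s + c powr (s - v) * t powr v"
proof (cases "t \<le> c")
  case True
  then have "t powr s \<le> c powr s" using assms by (intro powr_mono2) auto
  moreover have "c powr (s - v) * t powr v \<ge> 0" by simp
  ultimately show ?thesis by linarith
next
  case False
  then have t: "t > 0" using assms by simp
  have "t powr s = t powr (s - v) * t powr v" using t by (simp flip: powr_add)
  also have "\<dots> \<le> c powr (s - v) * t powr v"
    using False assms by (intro mult_right_mono powr_mono2') auto
  finally show ?thesis by (simp add: add_increasing)
qed

text \<open>Averages of a block scale like those of a unit function of L^u. Let W be the smaller of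
  the volumes of the averaging cube and of the cube of the block. Truncating at height
  \<open>W powr (-1/u)\<close> makes both terms of \<open>powr_young_level\<close> at most W^(1 -
  s/u), where v \<ge> u handles a large block cube, and s \<le> u allows W to be enlarged to the
  volume of the averaging cube.\<close>

lemma block_dav_bound:
  fixes A :: "real^'n::finite \<Rightarrow> real"
  assumes A: "is_block u v A" and uv: "0 < s" "s \<le> u" "u \<le> v"
  shows "dav j (\<lambda>y. ennreal (\<bar>A y\<bar> powr s)) x \<le> ennreal (2 * vol TYPE('n) j powr (-s/u))"
proof -
  have [measurable]: "A \<in> borel_measurable lebesgue" using A by (rule block_measurable)
  have u: "u > 0" and v: "v > 0" using uv by auto
  obtain k z where supp: "{x. A x \<noteq> 0} \<subseteq> cube k z" and
     nrm: "(\<integral>\<^sup>+x. ennreal (\<bar>A x\<bar> powr v) \<partial>lebesgue) \<le> ennreal (vol TYPE('n) k powr (1 - v/u))"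
    using A unfolding is_block_iff[OF v] by blast
  define Vj where "Vj = vol TYPE('n) j" define Vk where "Vk = vol TYPE('n) k"
  have V: "Vj > 0" "Vk > 0" by (auto simp: Vj_def Vk_def)
  define W where "W = min Vj Vk"
  define c where "c = W powr (-1/u)"
  have W: "W > 0" using V by (simp add: W_def)
  then have c: "c > 0" by (simp add: c_def)
  have "(\<integral>\<^sup>+y\<in>cube j x. ennreal (\<bar>A y\<bar> powr s) \<partial>lebesgue) \<le>
     (\<integral>\<^sup>+y. ennreal (c powr s) * indicator (cube j x \<inter> cube k z) y + ennreal (c powr (s-v)) * ennreal (\<bar>A y\<bar> powr v) \<partial>lebesgue)"
  proof (rule nn_integral_mono)
    fix y
    show "ennreal (\<bar>A y\<bar> powr s) * indicator (cube j x) y \<le> ennreal (c powr s) * indicator (cube j x \<inter> cube k z) y + ennreal (c powr (s-v)) * ennreal (\<bar>A y\<bar> powr v)"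
    proof (cases "A y = 0 \<or> y \<notin> cube j x")
      case False
      then have "y \<in> cube j x \<inter> cube k z" using supp by auto
      moreover have "ennreal (\<bar>A y\<bar> powr s) \<le> ennreal (c powr s * 1 + c powr (s-v) * (\<bar>A y\<bar> powr v))"
        using powr_young_level[of "\<bar>A y\<bar>" c s v] c uv by (intro ennreal_leI) auto
      moreover have "\<dots> = ennreal (c powr s) * ennreal 1 + ennreal (c powr (s-v)) * ennreal (\<bar>A y\<bar> powr v)"
        by (rule ennreal_mult_add) auto
      ultimately show ?thesis by simp
    qed auto
  qed
  also have "\<dots> = ennreal (c powr s) * emeasure lebesgue (cube j x \<inter> cube k z) + ennreal (c powr (s-v)) * (\<integral>\<^sup>+x. ennreal (\<bar>A x\<bar> powr v) \<partial>lebesgue)"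
    by (subst nn_integral_add) (auto simp: nn_integral_cmult nn_integral_cmult_indicator)
  also have "\<dots> \<le> ennreal (c powr s) * ennreal (min Vj Vk) + ennreal (c powr (s-v)) * ennreal (Vk powr (1 - v/u))"
  proof (intro add_mono mult_left_mono)
    show "emeasure lebesgue (cube j x \<inter> cube k z) \<le> ennreal (min Vj Vk)"
      using emeasure_mono[of "cube j x \<inter> cube k z" "cube j x" lebesgue] emeasure_mono[of "cube j x \<inter> cube k z" "cube k z" lebesgue]
      by (simp add: emeasure_cube Vj_def Vk_def min_def)
  qed (use nrm in \<open>auto simp: Vk_def\<close>)
  also have "\<dots> = ennreal (c powr s * min Vj Vk + c powr (s-v) * Vk powr (1 - v/u))"
    using V by (intro ennreal_mult_add[symmetric]) auto
  also have "\<dots> \<le> ennreal (2 * Vj powr (1 - s/u))"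
  proof (rule ennreal_leI)
    have cs: "c powr s = W powr (-s/u)" "c powr (s-v) = W powr ((v-s)/u)"
    proof -
      have "(-1/u) * s = -s/u" "(-1/u) * (s-v) = (v-s)/u" using u by (simp_all add: field_simps)
      then show "c powr s = W powr (-s/u)" "c powr (s-v) = W powr ((v-s)/u)" by (simp_all only: c_def powr_powr)
    qed
    have "W powr (-s/u) * W powr 1 = W powr (1 - s/u)" by (subst powr_add[symmetric]) simp
    then have "c powr s * min Vj Vk = W powr (1 - s/u)" using W by (simp add: cs W_def)
    moreover have "c powr (s-v) * Vk powr (1 - v/u) \<le> W powr ((v-s)/u) * W powr (1 - v/u)"
      unfolding cs using W uv u by (intro mult_left_mono powr_mono2') (auto simp: W_def)
    moreover have "W powr ((v-s)/u) * W powr (1 - v/u) = W powr (1 - s/u)"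
      by (subst powr_add[symmetric]) (simp add: diff_divide_distrib)
    moreover have "W powr (1 - s/u) \<le> Vj powr (1 - s/u)"
      using W uv u by (intro powr_mono2) (auto simp: W_def)
    ultimately show "c powr s * min Vj Vk + c powr (s-v) * Vk powr (1 - v/u) \<le> 2 * Vj powr (1 - s/u)" by linarith
  qed
  finally have le: "(\<integral>\<^sup>+y\<in>cube j x. ennreal (\<bar>A y\<bar> powr s) \<partial>lebesgue) \<le> ennreal (2 * Vj powr (1 - s/u))" .
  have "dav j (\<lambda>y. ennreal (\<bar>A y\<bar> powr s)) x \<le> ennreal (2 powr (real_of_int j * real CARD('n))) * ennreal (2 * Vj powr (1 - s/u))"
    unfolding dav_def by (intro mult_left_mono le) auto
  also have "\<dots> = ennreal (2 * (2 powr (real_of_int j * real CARD('n)) * Vj powr (1 - s/u)))"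
    using V by (subst ennreal_mult[symmetric]) (auto simp: mult_ac)
  also have "2 powr (real_of_int j * real CARD('n)) * Vj powr (1 - s/u) = Vj powr (-s/u)"
  proof -
    have "2 powr (real_of_int j * real CARD('n)) = Vj powr (-1)" by (simp only: Vj_def powr_powr) simp
    moreover have "Vj powr (-1) * Vj powr (1 - s/u) = Vj powr (-s/u)" by (subst powr_add[symmetric]) simp
    ultimately show ?thesis by simp
  qed
  finally show ?thesis by (simp add: Vj_def)
qed

lemma block_L1_bound:
  assumes "is_block u v (A :: real^'n::finite \<Rightarrow> real)" "1 \<le> u" "u \<le> v"
  shows "dav j (\<lambda>y. ennreal \<bar>A y\<bar>) x \<le> ennreal (2 * vol TYPE('n) j powr (-1/u))"
  using block_dav_bound[OF assms(1), of 1 j x] assms by simp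

lemma block_series_dav:
  fixes A :: "nat \<Rightarrow> real^'n::finite \<Rightarrow> real"
  assumes A: "\<And>i. is_block u v (A i)" and uv: "1 \<le> u" "u \<le> v" and lam: "summable (\<lambda>i. \<bar>lam i\<bar>)"
  shows "dav j (\<lambda>y. \<Sum>i. ennreal \<bar>lam i * A i y\<bar>) x \<le> ennreal (2 * (\<Sum>i. \<bar>lam i\<bar>) * vol TYPE('n) j powr (-1/u))"
proof -
  have [measurable]: "A i \<in> borel_measurable lebesgue" for i using A by (rule block_measurable)
  let ?c = "2 * vol TYPE('n) j powr (-1/u)"
  have "dav j (\<lambda>y. \<Sum>i. ennreal \<bar>lam i * A i y\<bar>) x = (\<Sum>i. ennreal \<bar>lam i\<bar> * dav j (\<lambda>y. ennreal \<bar>A i y\<bar>) x)"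
    by (subst dav_suminf) (auto simp: abs_mult ennreal_mult dav_cmult)
  also have "\<dots> \<le> (\<Sum>i. ennreal \<bar>lam i\<bar> * ennreal ?c)"
    by (intro suminf_le mult_left_mono block_L1_bound[OF A uv]) auto
  also have "\<dots> = ennreal (\<Sum>i. \<bar>lam i\<bar>) * ennreal ?c"
    by (subst ennreal_suminf_multc) (simp only: suminf_ennreal2[OF abs_ge_zero lam])
  also have "\<dots> = ennreal (2 * (\<Sum>i. \<bar>lam i\<bar>) * vol TYPE('n) j powr (-1/u))"
    using suminf_nonneg[OF lam] by (subst ennreal_mult[symmetric]) (auto simp: mult_ac)
  finally show ?thesis .
qed

lemma AE_finite_dav:
  fixes f :: "real^'n::finite \<Rightarrow> ennreal"
  assumes [measurable]: "f \<in> borel_measurable lebesgue" and fin: "\<And>x. dav 0 f x < \<infinity>"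
  shows "AE x in lebesgue. f x < \<infinity>"
proof (rule AE_cube0)
  fix x0 :: "real^'n"
  have "(\<integral>\<^sup>+y\<in>cube 0 x0. f y \<partial>lebesgue) \<noteq> \<infinity>"
    unfolding vol_dav using fin[of x0] by (simp add: ennreal_mult_eq_top_iff less_top)
  then have "AE x in lebesgue. f x * indicator (cube 0 x0) x \<noteq> \<infinity>"
    by (intro nn_integral_PInf_AE) auto
  then show "AE x in lebesgue. x \<in> cube 0 x0 \<longrightarrow> f x < \<infinity>"
    by eventually_elim (auto simp: less_top)
qed

text \<open>A decomposition only asks for convergence of the series almost everywhere. Summable
  coefficients make it absolute, which is what allows rearrangements in
  \<open>BS_suminf\<close>.\<close>

lemma block_series_AE:
  fixes A :: "nat \<Rightarrow> real^'n::finite \<Rightarrow> real"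
  assumes A: "\<And>i. is_block u v (A i)" and uv: "1 \<le> u" "u \<le> v" and lam: "summable (\<lambda>i. \<bar>lam i\<bar>)"
  shows "AE x in lebesgue. summable (\<lambda>i. \<bar>lam i * A i x\<bar>)"
proof -
  have [measurable]: "A i \<in> borel_measurable lebesgue" for i using A by (rule block_measurable)
  have "AE x in lebesgue. (\<Sum>i. ennreal \<bar>lam i * A i x\<bar>) < \<infinity>"
    by (rule AE_finite_dav) (auto intro: le_less_trans[OF block_series_dav[OF A uv lam]])
  then show ?thesis
    by eventually_elim (auto intro!: summable_suminf_not_top)
qed

lemma BS_nonneg: "BS u v S h \<Longrightarrow> S \<ge> 0"
  unfolding BS_def block_decomp_def using suminf_nonneg by fastforce

lemma BS_mono: "BS u v S h \<Longrightarrow> S \<le> T \<Longrightarrow> BS u v T h"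
  unfolding BS_def by (meson order_trans)

lemma BS_cong_AE: "BS u v S h \<Longrightarrow> AE x in lebesgue. h x = g x \<Longrightarrow> BS u v S g"
  unfolding BS_def block_decomp_def
proof (elim exE conjE, intro exI conjI)
  fix lam A
  assume "AE x in lebesgue. h x = g x" "AE x in lebesgue. (\<lambda>j. lam j * A j x) sums h x"
  then show "AE x in lebesgue. (\<lambda>j. lam j * A j x) sums g x" by eventually_elim simp
qed

lemma BS_measurable:
  fixes h :: "real^'n::finite \<Rightarrow> real"
  assumes "BS u v S h" shows "h \<in> borel_measurable lebesgue"
proof -
  obtain lam A where "block_decomp u v h lam A" using assms by (auto simp: BS_def)
  then have A: "\<And>j. is_block u v (A j)" and s: "AE x in lebesgue. (\<lambda>j. lam j * A j x) sums h x"
    by (auto simp: block_decomp_def)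
  have [measurable]: "A i \<in> borel_measurable lebesgue" for i using A by (rule block_measurable)
  show ?thesis
  proof (rule borel_measurable_AE)
    show "(\<lambda>x. \<Sum>j. lam j * A j x) \<in> borel_measurable lebesgue" by measurable
    show "AE x in lebesgue. (\<Sum>j. lam j * A j x) = h x" using s by eventually_elim (rule sums_unique[symmetric])
  qed
qed

lemma sums_abs_le_suminf:
  fixes f :: "nat \<Rightarrow> real" assumes "f sums s" shows "ennreal \<bar>s\<bar> \<le> (\<Sum>i. ennreal \<bar>f i\<bar>)"
proof (cases "(\<Sum>i. ennreal \<bar>f i\<bar>) = \<infinity>")
  case False
  then have sm: "summable (\<lambda>i. \<bar>f i\<bar>)" by (intro summable_suminf_not_top) auto
  have "\<bar>s\<bar> \<le> (\<Sum>i. \<bar>f i\<bar>)" using summable_rabs[OF sm] assms by (simp add: sums_iff)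
  then show ?thesis unfolding suminf_ennreal2[OF abs_ge_zero sm] by (rule ennreal_leI)
qed simp

text \<open>This embeds the block space into the locally integrable functions, and its decay over
  growing cubes later removes a boundary term of the Haar expansion.\<close>

lemma BS_dav:
  fixes h :: "real^'n::finite \<Rightarrow> real"
  assumes "BS u v S h" and uv: "1 \<le> u" "u \<le> v"
  shows "dav j (\<lambda>y. ennreal \<bar>h y\<bar>) x \<le> ennreal (2 * S * vol TYPE('n) j powr (-1/u))"
proof -
  obtain lam A where "block_decomp u v h lam A" and S: "(\<Sum>j. \<bar>lam j\<bar>) \<le> S" using assms by (auto simp: BS_def)
  then have A: "\<And>j. is_block u v (A j)" and s: "AE x in lebesgue. (\<lambda>j. lam j * A j x) sums h x"
    and lam: "summable (\<lambda>j. \<bar>lam j\<bar>)"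
    by (auto simp: block_decomp_def)
  have "dav j (\<lambda>y. ennreal \<bar>h y\<bar>) x \<le> dav j (\<lambda>y. \<Sum>i. ennreal \<bar>lam i * A i y\<bar>) x"
    by (intro dav_mono_AE) (use s in eventually_elim, rule sums_abs_le_suminf)
  also have "\<dots> \<le> ennreal (2 * (\<Sum>i. \<bar>lam i\<bar>) * vol TYPE('n) j powr (-1/u))"
    by (rule block_series_dav[OF A uv lam])
  also have "\<dots> \<le> ennreal (2 * S * vol TYPE('n) j powr (-1/u))"
    by (intro ennreal_leI mult_right_mono) (use S in auto)
  finally show ?thesis .
qed

lemma BS_lint:
  fixes h :: "real^'n::finite \<Rightarrow> real"
  assumes "BS u v S h" and uv: "1 \<le> u" "u \<le> v" shows "lint h"
  unfolding lint_def using BS_measurable[OF assms(1)] le_less_trans[OF BS_dav[OF assms]] by auto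

lemma BS_mult:
  fixes h :: "real^'n::finite \<Rightarrow> real"
  assumes "BS u v S h" and [measurable]: "\<phi> \<in> borel_measurable lebesgue" and \<phi>: "\<And>x. \<bar>\<phi> x\<bar> \<le> 1" and v: "v > 0"
  shows "BS u v S (\<lambda>x. \<phi> x * h x)"
proof -
  obtain lam A where bd: "block_decomp u v h lam A" "(\<Sum>j. \<bar>lam j\<bar>) \<le> S" using assms by (auto simp: BS_def)
  have "is_block u v (\<lambda>x. \<phi> x * A j x)" for j
  proof -
    have blk: "is_block u v (A j)" using bd by (simp add: block_decomp_def)
    then have [measurable]: "A j \<in> borel_measurable lebesgue" by (rule block_measurable)
    obtain k z where *: "{x. A j x \<noteq> 0} \<subseteq> cube k z"
      "(\<integral>\<^sup>+x. ennreal (\<bar>A j x\<bar> powr v) \<partial>lebesgue) \<le> ennreal (vol TYPE('n) k powr (1 - v/u))"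
      using blk unfolding is_block_iff[OF v] by blast
    have "(\<integral>\<^sup>+x. ennreal (\<bar>\<phi> x * A j x\<bar> powr v) \<partial>lebesgue) \<le> (\<integral>\<^sup>+x. ennreal (\<bar>A j x\<bar> powr v) \<partial>lebesgue)"
      using \<phi> v by (intro nn_integral_mono ennreal_leI powr_mono2) (auto simp: abs_mult mult_left_le_one_le)
    then show ?thesis unfolding is_block_iff[OF v] using *
      by (intro conjI exI[of _ k] exI[of _ z]) (auto intro: order_trans)
  qed
  moreover have "AE x in lebesgue. (\<lambda>j. lam j * (\<phi> x * A j x)) sums (\<phi> x * h x)"
    using bd unfolding block_decomp_def by (auto elim!: eventually_mono dest: sums_mult[where c="\<phi> _"] simp: mult.left_commute)
  ultimately show ?thesis
    using bd unfolding BS_def block_decomp_def by (intro exI[of _ lam] exI[of _ "\<lambda>j x. \<phi> x * A j x"]) auto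
qed

lemma BS_scale:
  fixes h :: "real^'n::finite \<Rightarrow> real"
  assumes "BS u v S h" shows "BS u v (\<bar>c\<bar> * S) (\<lambda>x. c * h x)"
proof -
  obtain lam A where bd: "block_decomp u v h lam A" "(\<Sum>j. \<bar>lam j\<bar>) \<le> S" using assms by (auto simp: BS_def)
  have "AE x in lebesgue. (\<lambda>j. (c * lam j) * A j x) sums (c * h x)"
    using bd unfolding block_decomp_def by (auto elim!: eventually_mono dest: sums_mult[where c=c] simp: mult.assoc)
  then show ?thesis
    using bd unfolding BS_def block_decomp_def
    by (intro exI[of _ "\<lambda>j. c * lam j"] exI[of _ A]) (auto simp: abs_mult suminf_mult intro!: mult_left_mono summable_mult)
qed

text \<open>Block spaces are solid: multiply the blocks of \<open>h\<close> by \<open>g / (c h)\<close>.\<close>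

lemma BS_dominated:
  fixes h :: "real^'n::finite \<Rightarrow> real"
  assumes h: "BS u v S h" and [measurable]: "g \<in> borel_measurable lebesgue" and v: "v > 0" and c: "c > 0"
    and le: "AE x in lebesgue. \<bar>g x\<bar> \<le> c * \<bar>h x\<bar>"
  shows "BS u v (c * S) g"
proof -
  have [measurable]: "h \<in> borel_measurable lebesgue" using h by (rule BS_measurable)
  define \<phi> where "\<phi> x = (if \<bar>g x\<bar> \<le> c * \<bar>h x\<bar> then g x / (c * h x) else 0)" for x
  have [measurable]: "\<phi> \<in> borel_measurable lebesgue" unfolding \<phi>_def by measurable
  have "\<bar>\<phi> x\<bar> \<le> 1" for x
    unfolding \<phi>_def using c by (auto simp: abs_mult divide_le_eq_1)
  then have "BS u v (\<bar>c\<bar> * S) (\<lambda>x. c * (\<phi> x * h x))"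
    by (intro BS_scale BS_mult h v) auto
  then have "BS u v (c * S) (\<lambda>x. c * (\<phi> x * h x))" using c by simp
  then show ?thesis
  proof (rule BS_cong_AE)
    show "AE x in lebesgue. c * (\<phi> x * h x) = g x"
      using le by eventually_elim (use c in \<open>auto simp: \<phi>_def\<close>)
  qed
qed

lemma BS_single:
  fixes g :: "real^'n::finite \<Rightarrow> real"
  assumes [measurable]: "g \<in> borel_measurable lebesgue" and supp: "{x. g x \<noteq> 0} \<subseteq> cube j x0"
    and w: "w > 0" and c: "c \<ge> 0"
    and nrm: "(\<integral>\<^sup>+x. ennreal (\<bar>g x\<bar> powr w) \<partial>lebesgue) \<le> ennreal ((c * vol TYPE('n) j powr (1/w - 1/u)) powr w)"
  shows "BS u w c g"
proof -
  have eq: "(vol TYPE('n) j powr (1/w - 1/u)) powr w = vol TYPE('n) j powr (1 - w/u)"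
  proof -
    have "(1/w - 1/u) * w = 1 - w/u" using w by (simp add: left_diff_distrib)
    then show ?thesis by (simp only: powr_powr mult.assoc)
  qed
  \<comment> \<open>For c = 0 this is the zero function, because division by zero yields 0. That is
    correct almost everywhere: the norm bound then forces g to vanish.\<close>
  define A where "A x = g x / c" for x
  have [measurable]: "A \<in> borel_measurable lebesgue" unfolding A_def by measurable
  have blk: "is_block u w A"
    unfolding is_block_iff[OF w]
  proof (intro conjI exI)
    show "{x. A x \<noteq> 0} \<subseteq> cube j x0" using supp by (auto simp: A_def)
    show "(\<integral>\<^sup>+x. ennreal (\<bar>A x\<bar> powr w) \<partial>lebesgue) \<le> ennreal (vol TYPE('n) j powr (1 - w/u))"
    proof (cases "c = 0")
      case True
      then show ?thesis by (simp add: A_def)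
    next
      case False
      have "(\<integral>\<^sup>+x. ennreal (\<bar>A x\<bar> powr w) \<partial>lebesgue) = (\<integral>\<^sup>+x. ennreal (c powr (-w)) * ennreal (\<bar>g x\<bar> powr w) \<partial>lebesgue)"
        unfolding A_def using c False
        by (intro nn_integral_cong) (simp add: powr_divide powr_minus_divide flip: ennreal_mult)
      also have "\<dots> = ennreal (c powr (-w)) * (\<integral>\<^sup>+x. ennreal (\<bar>g x\<bar> powr w) \<partial>lebesgue)"
        by (rule nn_integral_cmult) auto
      also have "\<dots> \<le> ennreal (c powr (-w)) * ennreal ((c * vol TYPE('n) j powr (1/w - 1/u)) powr w)"
        by (intro mult_left_mono nrm) auto
      also have "\<dots> = ennreal (vol TYPE('n) j powr (1 - w/u))"
      proof -
        have "c powr (-w) * (c * vol TYPE('n) j powr (1/w - 1/u)) powr w = (c powr (-w) * c powr w) * vol TYPE('n) j powr (1 - w/u)"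
          using c by (subst powr_mult) (simp_all only: eq powr_ge_zero mult.assoc)
        also have "c powr (-w) * c powr w = 1" using c False by (simp flip: powr_add)
        finally show ?thesis by (subst ennreal_mult[symmetric]) simp_all
      qed
      finally show ?thesis .
    qed
  qed (fact \<open>A \<in> borel_measurable lebesgue\<close>)
  have ae: "AE x in lebesgue. c * A x = g x"
  proof (cases "c = 0")
    case True
    then have "(\<integral>\<^sup>+x. ennreal (\<bar>g x\<bar> powr w) \<partial>lebesgue) = 0" using nrm by simp
    then have "AE x in lebesgue. ennreal (\<bar>g x\<bar> powr w) = 0" by (subst (asm) nn_integral_0_iff_AE) auto
    then show ?thesis by eventually_elim (use True in auto)
  qed (simp add: A_def)
  have sm: "(\<lambda>j. \<bar>if j = 0 then c else 0\<bar>) sums c"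
    using sums_single[of 0 "\<lambda>_. c"] c by (auto elim!: sums_cong[THEN iffD1, rotated])
  show ?thesis unfolding BS_def block_decomp_def
  proof (intro exI conjI allI)
    show "summable (\<lambda>j. \<bar>if j = 0 then c else 0\<bar>)" using sm by (simp add: sums_iff)
    show "(\<Sum>j. \<bar>if j = 0 then c else 0\<bar>) \<le> c" using sm by (simp add: sums_iff)
    show "AE x in lebesgue. (\<lambda>j. (if j = 0 then c else 0) * A x) sums g x"
      using ae
    proof eventually_elim
      case (elim x)
      show ?case using sums_single[of 0 "\<lambda>_. c * A x"] elim by (auto elim!: sums_cong[THEN iffD1, rotated])
    qed
  qed (rule blk)
qed

lemma BS_zero: "S \<ge> 0 \<Longrightarrow> w > 0 \<Longrightarrow> BS u w S (\<lambda>x::real^'n::finite. 0)"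
  by (rule BS_mono[of _ _ 0], rule BS_single[of _ 0 0]) auto

text \<open>The countable triangle inequality. All blocks of all decompositions are listed along
  \<open>prod_decode\<close>; the flattened series converges absolutely almost everywhere, so it may
  be summed by rows again.\<close>

lemma BS_suminf:
  fixes g :: "nat \<Rightarrow> real^'n::finite \<Rightarrow> real"
  assumes g: "\<And>i. BS u v (c i) (g i)" and uv: "1 \<le> u" "u \<le> v" and c: "summable c"
    and h: "AE x in lebesgue. (\<lambda>i. g i x) sums h x"
  shows "BS u v (\<Sum>i. c i) h"
proof -
  have "\<forall>i. \<exists>lam A. block_decomp u v (g i) lam A \<and> (\<Sum>j. \<bar>lam j\<bar>) \<le> c i" using g by (simp add: BS_def)
  then obtain lam A where bd: "\<And>i. block_decomp u v (g i) (lam i) (A i)" and le: "\<And>i. (\<Sum>j. \<bar>lam i j\<bar>) \<le> c i" by metis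
  define lam' where "lam' n = (case prod_decode n of (i,j) \<Rightarrow> lam i j)" for n
  define A' where "A' n = (case prod_decode n of (i,j) \<Rightarrow> A i j)" for n
  have blk: "is_block u v (A' n)" for n using bd by (auto simp: A'_def block_decomp_def split: prod.splits)
  have sml: "summable (\<lambda>j. \<bar>lam i j\<bar>)" for i using bd by (simp add: block_decomp_def)
  have s1: "((\<lambda>j. \<bar>lam i j\<bar>) has_sum (\<Sum>j. \<bar>lam i j\<bar>)) UNIV" for i
    by (rule sums_nonneg_imp_has_sum) (use sml in \<open>auto simp: summable_sums\<close>)
  have s2s: "summable (\<lambda>i. \<Sum>j. \<bar>lam i j\<bar>)"
    by (rule summable_comparison_test'[OF c, of 0]) (use le suminf_nonneg[OF sml] in auto)
  have s2: "((\<lambda>i. \<Sum>j. \<bar>lam i j\<bar>) has_sum (\<Sum>i. \<Sum>j. \<bar>lam i j\<bar>)) UNIV"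
    by (rule sums_nonneg_imp_has_sum) (use s2s suminf_nonneg[OF sml] in \<open>auto simp: summable_sums\<close>)
  have "(\<lambda>(i,j). \<bar>lam i j\<bar>) summable_on (UNIV \<times> UNIV)"
    by (rule summable_on_SigmaI[OF _ has_sum_imp_summable[OF s2]]) (use s1 in auto)
  then have "((\<lambda>(i,j). \<bar>lam i j\<bar>) has_sum (\<Sum>i. \<Sum>j. \<bar>lam i j\<bar>)) (UNIV \<times> UNIV)"
    by (intro has_sum_SigmaI[OF _ s2]) (use s1 in auto)
  then have "((\<lambda>n. (\<lambda>(i,j). \<bar>lam i j\<bar>) (prod_decode n)) has_sum (\<Sum>i. \<Sum>j. \<bar>lam i j\<bar>)) UNIV"
    by (subst has_sum_reindex_bij_betw[OF bij_prod_decode]) simp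
  moreover have "(\<lambda>n. (\<lambda>(i,j). \<bar>lam i j\<bar>) (prod_decode n)) = (\<lambda>n. \<bar>lam' n\<bar>)" by (auto simp: lam'_def split: prod.splits)
  ultimately have lam': "(\<lambda>n. \<bar>lam' n\<bar>) sums (\<Sum>i. \<Sum>j. \<bar>lam i j\<bar>)" by (auto intro: has_sum_imp_sums)
  then have sm: "summable (\<lambda>n. \<bar>lam' n\<bar>)" by (simp add: sums_iff)
  have tot: "(\<Sum>n. \<bar>lam' n\<bar>) \<le> (\<Sum>i. c i)"
    using lam' suminf_le[OF le s2s c] by (simp add: sums_iff)
  have "AE x in lebesgue. \<forall>i. (\<lambda>j. lam i j * A i j x) sums g i x"
    unfolding AE_all_countable using bd by (simp add: block_decomp_def)
  then have "AE x in lebesgue. (\<lambda>n. lam' n * A' n x) sums h x"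
    using h block_series_AE[of u v A' lam', OF blk uv sm]
  proof eventually_elim
    case (elim x)
    define F where "F = (\<lambda>(i,j). lam i j * A i j x)"
    have Fd: "F (prod_decode n) = lam' n * A' n x" for n
      by (auto simp: F_def lam'_def A'_def split: prod.splits)
    have "(\<lambda>n. F (prod_decode n)) summable_on UNIV"
      by (rule norm_summable_imp_summable_on) (use elim(3) in \<open>simp add: Fd\<close>)
    then have Fs: "F summable_on UNIV"
      using summable_on_reindex_bij_betw[OF bij_prod_decode, of F] by simp
    then have Fs': "F summable_on (UNIV \<times> UNIV)" by simp
    have row: "((\<lambda>j. F (i, j)) has_sum g i x) UNIV" for i
    proof -
      have "(\<lambda>j. F (i, j)) summable_on UNIV"
        using summable_on_subset_banach[OF Fs subset_UNIV, of "range (Pair i)"]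
          summable_on_reindex[of "Pair i" UNIV F] by (simp add: inj_on_def o_def)
      then obtain t where t: "((\<lambda>j. F (i, j)) has_sum t) UNIV" by (auto simp: summable_on_def)
      then have "(\<lambda>j. F (i, j)) sums t" by (rule has_sum_imp_sums)
      moreover have "(\<lambda>j. F (i, j)) sums g i x" using elim(1) by (simp add: F_def)
      ultimately show ?thesis using t sums_unique2 by blast
    qed
    obtain T where T: "(F has_sum T) (UNIV \<times> UNIV)" using Fs' by (auto simp: summable_on_def)
    then have "((\<lambda>i. g i x) has_sum T) UNIV" by (rule has_sum_SigmaD) (use row in auto)
    then have "(\<lambda>i. g i x) sums T" by (rule has_sum_imp_sums)
    with elim(2) have "T = h x" using sums_unique2 by blast
    with T have "(F has_sum h x) UNIV" by simp
    then have "((\<lambda>n. F (prod_decode n)) has_sum h x) UNIV"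
      by (subst has_sum_reindex_bij_betw[OF bij_prod_decode])
    then show ?case unfolding Fd by (rule has_sum_imp_sums)
  qed
  then show ?thesis unfolding BS_def block_decomp_def
    using sm tot blk by (intro exI[of _ lam'] exI[of _ A']) auto
qed

lemma BS_suminf_AE:
  fixes g :: "nat \<Rightarrow> real^'n::finite \<Rightarrow> real"
  assumes g: "\<And>i. BS u v (c i) (g i)" and uv: "1 \<le> u" "u \<le> v" and c: "summable c"
  shows "AE x in lebesgue. summable (\<lambda>i. \<bar>g i x\<bar>)"
proof -
  have [measurable]: "g i \<in> borel_measurable lebesgue" for i using g by (rule BS_measurable)
  have "dav 0 (\<lambda>y. \<Sum>i. ennreal \<bar>g i y\<bar>) x < \<infinity>" for x
  proof -
    have "dav 0 (\<lambda>y. \<Sum>i. ennreal \<bar>g i y\<bar>) x = (\<Sum>i. dav 0 (\<lambda>y. ennreal \<bar>g i y\<bar>) x)"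
      by (rule dav_suminf) auto
    also have "\<dots> \<le> (\<Sum>i. ennreal (2 * c i))"
    proof (intro suminf_le)
      fix i show "dav 0 (\<lambda>y. ennreal \<bar>g i y\<bar>) x \<le> ennreal (2 * c i)"
        using BS_dav[OF g[of i] uv, of 0 x] by simp
    qed auto
    also have "\<dots> < \<infinity>"
    proof -
      have "c i \<ge> 0" for i by (rule BS_nonneg[OF g])
      then have "(\<Sum>i. ennreal (2 * c i)) \<noteq> top"
        by (intro ennreal_suminf_neq_top summable_mult c mult_nonneg_nonneg) simp_all
      then show ?thesis by (simp only: less_top infinity_ennreal_def)
    qed
    finally show ?thesis .
  qed
  then have "AE x in lebesgue. (\<Sum>i. ennreal \<bar>g i x\<bar>) < \<infinity>"
    by (intro AE_finite_dav) auto
  then show ?thesis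
    by eventually_elim (auto intro!: summable_suminf_not_top)
qed

lemma BS_block_norm:
  assumes "BS u v S h" shows "in_block_space u v h" "block_norm u v h \<le> S"
proof -
  obtain lam A where bd: "block_decomp u v h lam A" "(\<Sum>j. \<bar>lam j\<bar>) \<le> S" using assms by (auto simp: BS_def)
  then show "in_block_space u v h" by (auto simp: in_block_space_def)
  have "block_norm u v h \<le> (\<Sum>j. \<bar>lam j\<bar>)"
    unfolding block_norm_def
  proof (rule cInf_lower)
    show "bdd_below {\<Sum>j. \<bar>lam j\<bar> |lam A. block_decomp u v h lam A}"
      by (rule bdd_belowI[of _ 0]) (auto simp: block_decomp_def intro!: suminf_nonneg)
  qed (use bd in blast)
  then show "block_norm u v h \<le> S" using bd by simp
qed

text \<open>The bound holds for every decomposition of f, and the infimum over these is taken at the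
  very end, after dividing by C.\<close>

lemma BS_bounded_operator:
  assumes C: "C > 0" and T: "\<And>S. BS u v S f \<Longrightarrow> BS z w (C * S) g" and f: "in_block_space u v f"
  shows "in_block_space z w g \<and> block_norm z w g \<le> C * block_norm u v f"
proof -
  have ne: "{\<Sum>j. \<bar>lam j\<bar> |lam A. block_decomp u v f lam A} \<noteq> {}" using f by (auto simp: in_block_space_def)
  have *: "BS z w (C * (\<Sum>j. \<bar>lam j\<bar>)) g" if "block_decomp u v f lam A" for lam A
    using that by (intro T) (auto simp: BS_def)
  have "block_norm z w g / C \<le> block_norm u v f"
    unfolding block_norm_def[of u v f]
  proof (rule cInf_greatest[OF ne])
    fix t assume "t \<in> {\<Sum>j. \<bar>lam j\<bar> |lam A. block_decomp u v f lam A}"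
    then have "block_norm z w g \<le> C * t" using BS_block_norm(2)[OF *] by auto
    then show "block_norm z w g / C \<le> t" using C by (simp add: field_simps)
  qed
  then have "block_norm z w g \<le> C * block_norm u v f" using C by (simp add: field_simps)
  moreover have "in_block_space z w g"
  proof -
    obtain lam A where "block_decomp u v f lam A" using f by (auto simp: in_block_space_def)
    then show ?thesis by (rule BS_block_norm(1)[OF *])
  qed
  ultimately show ?thesis by simp
qed

section \<open>Content splitting and Hedberg's inequality\<close>

lemma suminf_enn2real:
  fixes e :: "nat \<Rightarrow> ennreal"
  assumes "(\<Sum>i. e i) \<le> ennreal \<sigma>" "\<sigma> \<ge> 0"
  shows "e i = ennreal (enn2real (e i))" "summable (\<lambda>i. enn2real (e i))" "(\<Sum>i. enn2real (e i)) \<le> \<sigma>"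
proof -
  have lt: "(\<Sum>i. e i) < top" using assms(1) by (rule le_less_trans) simp
  have "e i < top" for i using le_less_trans[OF ennreal_le_suminf lt] .
  then show eq: "e i = ennreal (enn2real (e i))" for i by simp
  have le: "(\<Sum>i. ennreal (enn2real (e i))) \<le> ennreal \<sigma>" using assms(1) eq by simp
  have ne: "(\<Sum>i. ennreal (enn2real (e i))) \<noteq> top" using lt eq by simp
  then show sm: "summable (\<lambda>i. enn2real (e i))"
    by (rule summable_suminf_not_top[OF enn2real_nonneg])
  have "ennreal (\<Sum>i. enn2real (e i)) \<le> ennreal \<sigma>"
    using le by (subst suminf_ennreal2[symmetric, OF enn2real_nonneg sm])
  then show "(\<Sum>i. enn2real (e i)) \<le> \<sigma>" using assms(2) by (simp only: ennreal_le_iff)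
qed

text \<open>By Hoelder's inequality for sums, a function supported on disjoint cubes of small total content
  \<open>\<Sum>|Q|\<^sup>\<kappa>\<close> is cheaper when cut into one block per cube. The hypothesis on \<open>F\<close> encodes the content bound.\<close>

lemma BS_content_split:
  fixes G :: "real^'n::finite \<Rightarrow> real" and Q :: "nat \<Rightarrow> (real^'n) set"
  assumes Q: "\<And>i. Q i = {} \<or> (\<exists>j x. Q i = cube j x \<and> ennreal (vol TYPE('n) j powr \<kappa>) \<le> (\<integral>\<^sup>+y\<in>Q i. F y \<partial>lebesgue))"
    and disj: "disjoint_family Q"
    and F[measurable]: "F \<in> borel_measurable lebesgue" and F\<sigma>: "(\<integral>\<^sup>+y. F y \<partial>lebesgue) \<le> ennreal \<sigma>" and \<sigma>: "\<sigma> > 0"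
    and G[measurable]: "G \<in> borel_measurable lebesgue" and supp: "{x. G x \<noteq> 0} \<subseteq> (\<Union>i. Q i)"
    and GN: "(\<integral>\<^sup>+x. ennreal (\<bar>G x\<bar> powr w) \<partial>lebesgue) \<le> ennreal (N powr w)" and N: "N > 0"
    and zw: "1 < z" "z \<le> w" and ex: "1/z - 1/w = \<kappa> * (1 - 1/w)"
  shows "BS z w (2 * \<sigma> powr (1 - 1/w) * N) G"
proof -
  have w: "w > 1" using zw by simp
  have [measurable]: "Q i \<in> sets lebesgue" for i using Q[of i] by auto
  define e where "e i = (\<integral>\<^sup>+y\<in>Q i. F y \<partial>lebesgue)" for i
  define f where "f i = (\<integral>\<^sup>+y\<in>Q i. ennreal (\<bar>G y\<bar> powr w) \<partial>lebesgue)" for i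
  have split: "(\<Sum>i. \<integral>\<^sup>+y\<in>Q i. g y \<partial>lebesgue) \<le> (\<integral>\<^sup>+y. g y \<partial>lebesgue)" if [measurable]: "g \<in> borel_measurable lebesgue" for g
  proof -
    have "(\<Sum>i. \<integral>\<^sup>+y\<in>Q i. g y \<partial>lebesgue) = (\<integral>\<^sup>+y\<in>(\<Union>i. Q i). g y \<partial>lebesgue)"
      by (rule nn_integral_disjoint_family[OF _ _ disj, symmetric]) auto
    also have "\<dots> \<le> (\<integral>\<^sup>+y. g y \<partial>lebesgue)" by (intro nn_integral_mono) (auto simp: indicator_def)
    finally show ?thesis .
  qed
  have es: "(\<Sum>i. e i) \<le> ennreal \<sigma>" unfolding e_def using split[OF F] F\<sigma> by (rule order_trans)
  have fs: "(\<Sum>i. f i) \<le> ennreal (N powr w)" unfolding f_def using split GN by (rule order_trans) measurable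
  define X where "X = \<sigma> powr (1 - 1/w)"
  have X: "X > 0" using \<sigma> by (simp add: X_def)
  define er where "er i = enn2real (e i)" for i
  define fr where "fr i = enn2real (f i)" for i
  have e: "e i = ennreal (er i)" "summable er" "(\<Sum>i. er i) \<le> \<sigma>" for i
    using suminf_enn2real[OF es] \<sigma> unfolding er_def by (auto simp del: ennreal_enn2real_if)
  have f: "f i = ennreal (fr i)" "summable fr" "(\<Sum>i. fr i) \<le> N powr w" for i
    using suminf_enn2real[OF fs] unfolding fr_def by (auto simp del: ennreal_enn2real_if)
  have er0: "er i \<ge> 0" and fr0: "fr i \<ge> 0" for i by (auto simp: er_def fr_def)
  \<comment> \<open>Young's inequality with scales X and N in place of Hoelder's inequality for
    sums: \<open>c i\<close> dominates er^(1 - 1/w) fr^(1/w) for the i-th cube, and the two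
    normalised sums are at most 1 each, so the total is at most 2 X N.\<close>
  define c where "c i = X * N * (er i * \<sigma> powr (-1) + fr i * N powr (-w))" for i
  have c0: "c i \<ge> 0" for i unfolding c_def using X N er0[of i] fr0[of i] by (intro mult_nonneg_nonneg add_nonneg_nonneg) auto
  have blk: "BS z w (c i) (\<lambda>x. G x * indicator (Q i) x)" for i
  proof (cases "Q i = {}")
    case True
    then show ?thesis using BS_zero[OF c0[of i], of w z] w by simp
  next
    case False
    have "\<exists>j x. Q i = cube j x \<and> ennreal (vol TYPE('n) j powr \<kappa>) \<le> e i"
      using Q[of i] unfolding e_def by (simp only: False simp_thms)
    then obtain j x where j: "Q i = cube j x" "ennreal (vol TYPE('n) j powr \<kappa>) \<le> e i"
      by (elim exE conjE)
    define V where "V = vol TYPE('n) j"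
    have V: "V > 0" by (simp add: V_def)
    have Ve: "V powr \<kappa> \<le> er i" using j(2) er0 unfolding e(1) by (simp add: V_def ennreal_le_iff)
    have pw: "1/(w/(w-1)) = 1 - 1/w" using w by (simp add: field_simps)
    have "(er i powr (1 - 1/w)) * (fr i powr (1/w)) \<le> X * N * ((er i powr (1 - 1/w)) powr (w/(w-1)) * X powr (-(w/(w-1))) + (fr i powr (1/w)) powr w * N powr (-w))"
      by (rule young_weighted) (use w X N in \<open>auto simp: field_simps\<close>)
    also have "(er i powr (1 - 1/w)) powr (w/(w-1)) = er i"
    proof -
      have "(1 - 1/w) * (w/(w-1)) = 1" using w by (simp add: field_simps)
      then show ?thesis using er0[of i] by (simp only: powr_powr powr_one)
    qed
    also have "X powr (-(w/(w-1))) = \<sigma> powr (-1)"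
    proof -
      have "(1 - 1/w) * (-(w/(w-1))) = -1" using w by (simp add: field_simps)
      then show ?thesis unfolding X_def by (simp only: powr_powr)
    qed
    also have "(fr i powr (1/w)) powr w = fr i" using w fr0[of i] by (simp add: powr_powr)
    finally have le: "(er i powr (1 - 1/w)) * (fr i powr (1/w)) \<le> c i" by (simp add: c_def)
    \<comment> \<open>Here the exponent relation enters: the normalising factor of a block is the
      content of its cube to the power 1 - 1/w.\<close>
    have "V powr (1/z - 1/w) = (V powr \<kappa>) powr (1 - 1/w)" by (simp only: ex powr_powr)
    also have "\<dots> \<le> er i powr (1 - 1/w)" using Ve w by (intro powr_mono2) auto
    finally have "V powr (1/z - 1/w) * fr i powr (1/w) \<le> c i"
      using le by (meson mult_right_mono order_trans powr_ge_zero)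
    then have "V powr (1/w - 1/z) * (V powr (1/z - 1/w) * fr i powr (1/w)) \<le> V powr (1/w - 1/z) * c i"
      by (intro mult_left_mono) auto
    moreover have "V powr (1/w - 1/z) * V powr (1/z - 1/w) = 1" using V by (simp flip: powr_add)
    ultimately have "fr i powr (1/w) \<le> V powr (1/w - 1/z) * c i" by (simp only: mult.assoc[symmetric] mult_1)
    then have "fr i powr (1/w) \<le> c i * V powr (1/w - 1/z)" by (simp only: mult.commute)
    then have "(fr i powr (1/w)) powr w \<le> (c i * V powr (1/w - 1/z)) powr w"
      using w by (intro powr_mono2) auto
    then have fr: "fr i \<le> (c i * V powr (1/w - 1/z)) powr w"
      using w fr0[of i] by (simp add: powr_powr)
    show ?thesis
    proof (rule BS_single)
      show "{x. G x * indicator (Q i) x \<noteq> 0} \<subseteq> cube j x" by (auto simp: j(1) indicator_def)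
      have "(\<integral>\<^sup>+x. ennreal (\<bar>G x * indicator (Q i) x\<bar> powr w) \<partial>lebesgue) = f i"
        unfolding f_def by (intro nn_integral_cong) (auto simp: indicator_def)
      also have "\<dots> \<le> ennreal ((c i * V powr (1/w - 1/z)) powr w)" unfolding f(1) by (rule ennreal_leI[OF fr])
      finally show "(\<integral>\<^sup>+x. ennreal (\<bar>G x * indicator (Q i) x\<bar> powr w) \<partial>lebesgue) \<le> ennreal ((c i * vol TYPE('n) j powr (1/w - 1/z)) powr w)"
        by (simp only: V_def)
    qed (use w c0 in auto)
  qed
  have sm: "summable (\<lambda>i. er i * \<sigma> powr (-1) + fr i * N powr (-w))"
    using e f by (intro summable_add summable_mult2) auto
  then have smc: "summable c" unfolding c_def by (rule summable_mult)
  have sums: "(\<lambda>i. G x * indicator (Q i) x) sums G x" for x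
  proof (cases "G x = 0")
    case False
    then obtain i where i: "x \<in> Q i" using supp by auto
    have "(\<lambda>i'. G x * indicator (Q i') x) = (\<lambda>i'. if i' = i then G x else 0)"
      using i disj by (auto simp: fun_eq_iff indicator_def disjoint_family_on_def)
    then show ?thesis using sums_single[of i "\<lambda>_. G x"] by simp
  qed simp
  have "BS z w (\<Sum>i. c i) G"
    by (rule BS_suminf[OF blk _ _ smc]) (use zw sums in auto)
  moreover have "(\<Sum>i. c i) \<le> 2 * X * N"
  proof -
    have "(\<Sum>i. c i) = X * N * ((\<Sum>i. er i) * \<sigma> powr (-1) + (\<Sum>i. fr i) * N powr (-w))"
      unfolding c_def suminf_mult[OF sm] suminf_add[OF summable_mult2[OF e(2)] summable_mult2[OF f(2)], symmetric]
        suminf_mult2[OF e(2)] suminf_mult2[OF f(2)] by (rule refl)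
    also have "\<dots> \<le> X * N * (\<sigma> * \<sigma> powr (-1) + N powr w * N powr (-w))"
      using X N e f by (intro mult_left_mono add_mono mult_right_mono) auto
    also have "\<sigma> * \<sigma> powr (-1) = 1" using \<sigma> by (simp add: powr_minus)
    also have "N powr w * N powr (-w) = 1" using N by (simp flip: powr_add)
    finally show ?thesis by simp
  qed
  ultimately show ?thesis unfolding X_def by (rule BS_mono)
qed

text \<open>The bound does not involve y: since every term is at most 1, the sum is compared with a
  geometric series that starts at its largest term. Here the largest term has the smallest index;
  for a ratio above 1 it has the largest.\<close>

lemma geometric_tail_le:
  fixes y q :: real
  assumes "finite I" "0 < q" "q < 1" "y > 0" and le: "\<And>i. i \<in> I \<Longrightarrow> y * q ^ i \<le> 1"
  shows "(\<Sum>i\<in>I. y * q ^ i) \<le> 1 / (1 - q)"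
proof (cases "I = {}")
  case False
  define a where "a = Min I"
  have a: "a \<in> I" "\<And>i. i \<in> I \<Longrightarrow> a \<le> i" using assms(1) False by (auto simp: a_def)
  have "(\<Sum>i\<in>I. y * q ^ i) = (\<Sum>i\<in>I. (y * q ^ a) * q ^ (i - a))"
    by (intro sum.cong refl) (use a in \<open>simp add: mult.assoc flip: power_add\<close>)
  also have "\<dots> \<le> (\<Sum>i\<in>I. 1 * q ^ (i - a))"
    using le[OF a(1)] assms by (intro sum_mono mult_right_mono) auto
  also have "\<dots> = (\<Sum>k\<in>(\<lambda>i. i - a) ` I. q ^ k)"
    using a by (subst sum.reindex) (auto simp: inj_on_def le_diff_iff' eq_diff_iff)
  also have "\<dots> \<le> (\<Sum>k. q ^ k)"
    using assms by (intro sum_le_suminf summable_geometric) auto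
  also have "\<dots> = 1 / (1 - q)" using assms by (intro suminf_geometric) auto
  finally show ?thesis .
qed (use assms in auto)

lemma geometric_head_le:
  fixes y q :: real
  assumes "finite I" "q > 1" "y > 0" and le: "\<And>i. i \<in> I \<Longrightarrow> y * q ^ i \<le> 1"
  shows "(\<Sum>i\<in>I. y * q ^ i) \<le> 1 / (1 - 1/q)"
proof (cases "I = {}")
  case False
  define b where "b = Max I"
  have b: "b \<in> I" "\<And>i. i \<in> I \<Longrightarrow> i \<le> b" using assms(1) False by (auto simp: b_def)
  have "(\<Sum>i\<in>I. y * q ^ i) = (\<Sum>i\<in>I. (y * q ^ b) * (1/q) ^ (b - i))"
    by (intro sum.cong refl) (use b assms in \<open>simp add: power_diff power_one_over field_simps\<close>)
  also have "\<dots> \<le> (\<Sum>i\<in>I. 1 * (1/q) ^ (b - i))"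
    using le[OF b(1)] assms by (intro sum_mono mult_right_mono) auto
  also have "\<dots> = (\<Sum>k\<in>(\<lambda>i. b - i) ` I. (1/q) ^ k)"
  proof (subst sum.reindex)
    show "inj_on (\<lambda>i. b - i) I"
    proof (rule inj_onI)
      fix x y assume "x \<in> I" "y \<in> I" "b - x = b - y"
      then show "x = y" using b(2)[of x] b(2)[of y] by linarith
    qed
  qed simp
  also have "\<dots> \<le> (\<Sum>k. (1/q) ^ k)"
    using assms by (intro sum_le_suminf summable_geometric) auto
  also have "\<dots> = 1 / (1 - 1/q)" using assms by (intro suminf_geometric) auto
  finally show ?thesis .
qed (use assms in auto)

text \<open>The sums of two geometric series, with ratio \<open>2 powr (-\<alpha>)\<close> towards
  finer scales and \<open>1 / 2 powr (\<alpha> * (1/\<eta> - 1))\<close> towards coarser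
  ones.\<close>

definition hedberg_const :: "real \<Rightarrow> real \<Rightarrow> real" where
  "hedberg_const \<alpha> \<eta> = 1 / (1 - 2 powr (-\<alpha>)) + 1 / (1 - 1 / 2 powr (\<alpha> * (1/\<eta> - 1)))"

lemma hedberg_const_pos:
  assumes "\<alpha> > 0" "0 < \<eta>" "\<eta> < 1" shows "hedberg_const \<alpha> \<eta> > 0"
proof -
  have "2 powr (-\<alpha>) < (1::real)" using assms by (simp add: powr_less_one)
  moreover have "(2::real) powr (\<alpha> * (1/\<eta> - 1)) > 1" using assms by (intro gr_one_powr) (auto simp: field_simps)
  ultimately show ?thesis unfolding hedberg_const_def by (intro add_pos_pos divide_pos_pos) auto
qed

text \<open>The two bounds for the scale \<open>2\<^sup>-\<^sup>i\<close> cross at one critical scale and decay geometrically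
  on either side of it (Hedberg's trick).\<close>

lemma hedberg_sum:
  fixes m R \<alpha> \<eta> :: real and j0 :: int and b :: "nat \<Rightarrow> real"
  assumes m: "m \<ge> 0" and R: "R > 0" and \<alpha>: "\<alpha> > 0" and \<eta>: "0 < \<eta>" "\<eta> < 1"
    and b1: "\<And>i. i \<in> I \<Longrightarrow> b i \<le> m * 2 powr (- real_of_int (j0 + int i) * \<alpha>)"
    and b2: "\<And>i. i \<in> I \<Longrightarrow> b i \<le> R * (2 powr (- real_of_int (j0 + int i) * \<alpha>)) powr (1 - 1/\<eta>)"
    and I: "finite I"
  shows "(\<Sum>i\<in>I. b i) \<le> hedberg_const \<alpha> \<eta> * m powr (1 - \<eta>) * R powr \<eta>"
proof (cases "m = 0")
  case True
  then have "(\<Sum>i\<in>I. b i) \<le> 0" using b1 by (intro sum_nonpos) auto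
  then show ?thesis using True by simp
next
  case False
  then have m: "m > 0" using m by simp
  \<comment> \<open>The critical value of 2^(-j \<alpha>): the bounds m x and R x^(1 - 1/\<eta>)
    agree exactly at x = \<rho>, and their common value there is m^(1 - \<eta>) R^\<eta>.\<close>
  define \<rho> where "\<rho> = (R / m) powr \<eta>"
  define \<gamma> where "\<gamma> = 1/\<eta> - 1"
  have \<gamma>: "\<gamma> > 0" using \<eta> by (simp add: \<gamma>_def field_simps)
  have \<rho>: "\<rho> > 0" using R m by (simp add: \<rho>_def)
  define x where "x i = 2 powr (- real_of_int (j0 + int i) * \<alpha>)" for i
  define y where "y i = x i / \<rho>" for i
  have x: "x i > 0" for i by (simp add: x_def)
  have y: "y i > 0" for i using x \<rho> by (simp add: y_def)
  have y_geo: "y i = y 0 * (2 powr (-\<alpha>)) ^ i" for i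
    unfolding y_def x_def by (simp add: powr_realpow[symmetric] powr_powr powr_add[symmetric] algebra_simps)
  have m\<rho>: "m * \<rho> = m powr (1 - \<eta>) * R powr \<eta>"
    using m R by (simp add: \<rho>_def powr_divide powr_diff)
  have "\<rho> powr (1/\<eta>) = R / m" using \<eta> R m by (simp add: \<rho>_def powr_powr)
  then have "m * \<rho> * \<rho> powr \<gamma> = R"
    unfolding \<gamma>_def using \<rho> m by (simp add: powr_diff)
  then have R\<rho>: "R * x i powr (- \<gamma>) = m * \<rho> * y i powr (- \<gamma>)" for i
    unfolding y_def using \<rho> x[of i] by (simp add: powr_divide powr_minus_divide field_simps)
  have c1: "b i \<le> m * \<rho> * y i" if "i \<in> I" for i
    using b1[OF that] \<rho> by (simp add: y_def x_def)
  have c2: "b i \<le> m * \<rho> * y i powr (-\<gamma>)" if "i \<in> I" for i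
    using b2[OF that] unfolding R\<rho>[symmetric] by (simp add: x_def \<gamma>_def)
  define P where "P = {i \<in> I. y i \<le> 1}"
  have "(\<Sum>i\<in>I. b i) = (\<Sum>i\<in>P. b i) + (\<Sum>i\<in>I - P. b i)"
    using I by (subst sum.subset_diff[of P I]) (auto simp: P_def)
  also have "\<dots> \<le> (\<Sum>i\<in>P. m * \<rho> * y i) + (\<Sum>i\<in>I-P. m * \<rho> * y i powr (-\<gamma>))"
    by (intro add_mono sum_mono c1 c2) (auto simp: P_def)
  also have "\<dots> = m * \<rho> * ((\<Sum>i\<in>P. y i) + (\<Sum>i\<in>I-P. y i powr (-\<gamma>)))"
    by (simp add: sum_distrib_left distrib_left)
  also have "\<dots> \<le> m * \<rho> * hedberg_const \<alpha> \<eta>"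
  proof (intro mult_left_mono)
    have "(\<Sum>i\<in>P. y i) = (\<Sum>i\<in>P. y 0 * (2 powr (-\<alpha>)) ^ i)" by (intro sum.cong refl y_geo)
    also have "\<dots> \<le> 1 / (1 - 2 powr (-\<alpha>))"
    proof (rule geometric_tail_le)
      show "2 powr (-\<alpha>) < (1::real)" using \<alpha> by (simp add: powr_less_one)
      show "y 0 * (2 powr (-\<alpha>)) ^ i \<le> 1" if "i \<in> P" for i using that y_geo[of i] by (simp add: P_def)
    qed (use I y in \<open>auto simp: P_def\<close>)
    finally have 1: "(\<Sum>i\<in>P. y i) \<le> 1 / (1 - 2 powr (-\<alpha>))" .
    have yg: "y i powr (-\<gamma>) = y 0 powr (-\<gamma>) * (2 powr (\<alpha> * \<gamma>)) ^ i" for i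
    proof -
      have "((2 powr (-\<alpha>)) ^ i) powr (-\<gamma>) = (2 powr (\<alpha> * \<gamma>)) ^ i"
        by (simp add: powr_realpow[symmetric] powr_powr mult_ac)
      then show ?thesis using y_geo[of i] y[of 0] by (simp add: powr_mult)
    qed
    have "(\<Sum>i\<in>I-P. y i powr (-\<gamma>)) = (\<Sum>i\<in>I-P. y 0 powr (-\<gamma>) * (2 powr (\<alpha> * \<gamma>)) ^ i)"
      by (intro sum.cong refl yg)
    also have "\<dots> \<le> 1 / (1 - 1 / 2 powr (\<alpha> * \<gamma>))"
    proof (rule geometric_head_le)
      show "(2::real) powr (\<alpha> * \<gamma>) > 1" using \<alpha> \<gamma> by (intro gr_one_powr) auto
      show "y 0 powr (-\<gamma>) * (2 powr (\<alpha> * \<gamma>)) ^ i \<le> 1" if "i \<in> I - P" for i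
      proof -
        have "y i > 1" using that by (auto simp: P_def)
        then have "y i powr (-\<gamma>) \<le> 1" using \<gamma> by (simp add: powr_le_one_le ge_one_powr_ge_zero powr_minus_divide)
        then show ?thesis using yg[of i] by simp
      qed
    qed (use I y[of 0] in auto)
    finally have 2: "(\<Sum>i\<in>I-P. y i powr (-\<gamma>)) \<le> 1 / (1 - 1 / 2 powr (\<alpha> * \<gamma>))" .
    show "(\<Sum>i\<in>P. y i) + (\<Sum>i\<in>I-P. y i powr (-\<gamma>)) \<le> hedberg_const \<alpha> \<eta>"
      using 1 2 unfolding hedberg_const_def \<gamma>_def by linarith
  qed (use m \<rho> in auto)
  finally show ?thesis unfolding m\<rho> by (simp only: mult_ac)
qed

text \<open>Sums over all levels are integrals against counting measure, so that no order of
  summation has to be chosen. With c the level of a block, the two series are the levels inside its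
  cube and the coarser ones.\<close>

lemma nn_integral_count_space_int:
  fixes f :: "int \<Rightarrow> ennreal"
  shows "(\<integral>\<^sup>+j. f j \<partial>count_space UNIV) = (\<Sum>n. f (c + int n)) + (\<Sum>n. f (c - 1 - int n))"
proof -
  have b1: "bij_betw (\<lambda>n. c + int n) UNIV {c..}"
    by (rule bij_betwI[where g = "\<lambda>j. nat (j - c)"]) auto
  have b2: "bij_betw (\<lambda>n. c - 1 - int n) UNIV {..<c}"
    by (rule bij_betwI[where g = "\<lambda>j. nat (c - 1 - j)"]) auto
  have "(\<integral>\<^sup>+j. f j \<partial>count_space UNIV) = (\<integral>\<^sup>+j. f j * indicator {c..} j + f j * indicator {..<c} j \<partial>count_space UNIV)"
    by (intro nn_integral_cong) (auto simp: indicator_def)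
  also have "\<dots> = (\<integral>\<^sup>+j. f j * indicator {c..} j \<partial>count_space UNIV) + (\<integral>\<^sup>+j. f j * indicator {..<c} j \<partial>count_space UNIV)"
    by (rule nn_integral_add) auto
  also have "(\<integral>\<^sup>+j. f j * indicator {c..} j \<partial>count_space UNIV) = (\<integral>\<^sup>+j. f j \<partial>count_space {c..})"
    by (simp add: nn_integral_count_space_indicator)
  also have "\<dots> = (\<Sum>n. f (c + int n))"
    by (simp add: nn_integral_bij_count_space[OF b1, symmetric] nn_integral_count_space_nat)
  also have "(\<integral>\<^sup>+j. f j * indicator {..<c} j \<partial>count_space UNIV) = (\<integral>\<^sup>+j. f j \<partial>count_space {..<c})"
    by (simp add: nn_integral_count_space_indicator)
  also have "\<dots> = (\<Sum>n. f (c - 1 - int n))"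
    by (simp add: nn_integral_bij_count_space[OF b2, symmetric] nn_integral_count_space_nat)
  finally show ?thesis .
qed

section \<open>The image of a block\<close>

lemma ennreal_le_enn2real: "a < \<infinity> \<Longrightarrow> enn2real a \<le> r \<Longrightarrow> a \<le> ennreal r"
  using ennreal_leI[of "enn2real a" r] by simp

lemma sum_powr_le:
  fixes a :: "nat \<Rightarrow> real"
  assumes "\<And>i. a i \<ge> 0" "w > 0"
  shows "(\<Sum>i\<le>N. a i) powr w \<le> real (Suc N) powr w * (\<Sum>i\<le>N. a i powr w)"
proof -
  obtain k where k: "k \<le> N" "\<And>i. i \<le> N \<Longrightarrow> a i \<le> a k"
  proof -
    have "Max (a ` {..N}) \<in> a ` {..N}" by (intro Max_in) auto
    then obtain k where k: "k \<in> {..N}" "Max (a ` {..N}) = a k" by (rule imageE)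
    have "a i \<le> a k" if "i \<le> N" for i unfolding k(2)[symmetric] using that by (intro Max_ge) auto
    with k(1) show ?thesis using that[of k] by simp
  qed
  have "(\<Sum>i\<le>N. a i) \<le> (\<Sum>i\<le>N. a k)" by (intro sum_mono k(2)) simp
  then have "(\<Sum>i\<le>N. a i) \<le> real (Suc N) * a k" by simp
  then have "(\<Sum>i\<le>N. a i) powr w \<le> (real (Suc N) * a k) powr w"
    using assms by (intro powr_mono2 sum_nonneg) auto
  also have "\<dots> = real (Suc N) powr w * a k powr w" using assms by (simp add: powr_mult)
  also have "a k powr w \<le> (\<Sum>i\<le>N. a i powr w)" using k(1) by (intro member_le_sum) auto
  finally show ?thesis by (simp add: mult_left_mono)
qed

text \<open>In terms of the exponents of the theorem, \<open>u = r\<^sub>0'\<close>, \<open>v = r'\<close>, \<open>z = p\<^sub>0'\<close>, \<open>w = p'\<close> and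
  \<open>\<kappa> = 1 - p/p\<^sub>0\<close>; the conjugate pair \<open>s, t\<close> leaves room for John--Nirenberg.\<close>

locale adams =
  fixes dim :: "'n::finite itself" and \<alpha> u v z w \<kappa> s t Kh :: real
  assumes \<alpha>: "0 < \<alpha>" and u: "1 < u" "u \<le> v" and z: "1 < z" "z \<le> w"
    and \<kappa>: "0 \<le> \<kappa>" "\<kappa> < 1"
    and e1: "1/u - 1/v = \<kappa> * (1 - 1/v)" and e2: "1/z - 1/w = \<kappa> * (1 - 1/w)"
    and e3: "1/z = 1/u - \<alpha> / real CARD('n)"
    and s: "1 < s" "s < u" and st: "1/s + 1/t = 1" and wt: "w < t" and Kh: "Kh > 0"
begin

text \<open>The Hedberg exponent. It is chosen so that the maximal function of A appears to the
  power 1 - \<eta> = v/w, whose w-th power is controlled by the maximal theorem in L^v.\<close>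

definition \<eta> :: real where "\<eta> = 1 - v/w"

lemma v: "v > 1" and w: "w > 1" and t: "t > 1" using u z wt by auto

text \<open>Both 1/u and 1/z are values of the same affine map \<kappa> + (1 - \<kappa>) x, at 1/v
  and 1/w, and \<open>e3\<close> gives their difference.\<close>

lemma exponent_gap: "(1 - \<kappa>) * (1/v - 1/w) = \<alpha> / real CARD('n)"
proof -
  have "1/u - 1/v = \<kappa> - \<kappa> * (1/v)" "1/z - 1/w = \<kappa> - \<kappa> * (1/w)"
    using e1 e2 by (simp_all only: right_diff_distrib mult_1_right)
  moreover have "(1 - \<kappa>) * (1/v - 1/w) = (1/v - 1/w) - \<kappa> * (1/v) + \<kappa> * (1/w)"
    by (simp only: left_diff_distrib right_diff_distrib mult_1_left)
  ultimately show ?thesis using e3 by linarith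
qed

lemma v_less_w: "v < w"
proof -
  have "0 < (1 - \<kappa>) * (1/v - 1/w)" unfolding exponent_gap using \<alpha> by simp
  then have "1/w < 1/v" using \<kappa> by (simp add: zero_less_mult_iff)
  then show ?thesis using v w by (simp add: field_simps)
qed

lemma \<eta>: "0 < \<eta>" "\<eta> < 1" "1 - \<eta> = v/w" "\<eta>/v = 1/v - 1/w"
  using v_less_w v w by (auto simp: \<eta>_def field_simps)

text \<open>Rewrites the volume power supplied by the stopping condition as a power of 2^(-j
  \<alpha>), the variable of Hedberg's trick.\<close>

lemma scale_exponent: "(\<kappa> - 1) / v * real CARD('n) = (\<alpha>) * (-1/\<eta>)"
proof -
  have "(1-\<kappa>) * \<eta> / v = \<alpha> / real CARD('n)" using exponent_gap \<eta>(4) by (simp add: mult.assoc[symmetric] flip: times_divide_eq_right)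
  then have "(1-\<kappa>) / v * real CARD('n) * \<eta> = \<alpha>" by (simp add: field_simps)
  then have "(1-\<kappa>) / v * real CARD('n) = \<alpha> / \<eta>" using \<eta> by (simp add: field_simps)
  then show ?thesis by (simp add: minus_divide_left[symmetric] left_diff_distrib diff_divide_distrib)
qed

definition p :: real where "p = w/(w-1)"

lemma p: "p > 1" "(w-1) * p = w" "1/p + 1/w = 1"
  using w by (auto simp: p_def field_simps)

lemma sp: "s < p"
proof -
  have "1/t < 1/w" using wt w by (simp add: field_simps)
  then have "1/p < 1/s" using st p(3) by linarith
  then show ?thesis using s p by (simp add: field_simps)
qed

text \<open>These are the exponents at which the maximal theorem is applied, to the s-th powers of
  the dual function and of A.\<close>

lemma ps: "p/s > 1" "v/s > 1" using sp s u by auto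

text \<open>In \<open>G1\<close> the factor 2 comes from \<open>dav_holder\<close> and
  \<open>2 powr (\<eta>/s)\<close> from the Jensen constant in the second Hedberg bound. In
  \<open>C1\<close> the factor 2 comes from absorption, and the power w - 1 from tuning Young's
  inequality so that the dual term is exactly one half.\<close>

definition G1 :: real where "G1 = 2 * Kh * hedberg_const \<alpha> \<eta> * 2 powr (\<eta>/s)"
definition C1 :: real where "C1 = 2 * G1 powr w * (2 * dmax_const (p/s)) powr (w-1) * dmax_const (v/s)"

lemma G1_pos: "G1 > 0" unfolding G1_def using Kh hedberg_const_pos[OF \<alpha> \<eta>(1,2)] by simp
lemma C1_pos: "C1 > 0"
  unfolding C1_def using G1_pos dmax_const_pos[OF ps(1)] dmax_const_pos[OF ps(2)] by simp

end

text \<open>\<open>A\<close> is a block on the cube of level \<open>j0\<close> around \<open>x0\<close>, and \<open>h j\<close> is the level \<open>j\<close> part of its image.\<close>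

locale adams_block = adams dim \<alpha> u v z w \<kappa> s t Kh
  for dim :: "'n::finite itself" and \<alpha> u v z w \<kappa> s t Kh +
  fixes A :: "real^'n \<Rightarrow> real" and j0 :: int and x0 :: "real^'n" and h :: "int \<Rightarrow> real^'n \<Rightarrow> real"
  assumes blk: "is_block u v A" and supp: "{x. A x \<noteq> 0} \<subseteq> cube j0 x0"
    and nrm: "(\<integral>\<^sup>+x. ennreal (\<bar>A x\<bar> powr v) \<partial>lebesgue) \<le> ennreal (vol TYPE('n) j0 powr (1 - v/u))"
    and h_meas [measurable]: "\<And>j. h j \<in> borel_measurable lebesgue" and h0: "\<And>j x. h j x \<ge> 0"
    and H: "\<And>j x. dav j (\<lambda>y. ennreal (h j y powr t)) x \<le>
      ennreal ((Kh * 2 powr (- real_of_int j * \<alpha>) * enn2real (dav j (\<lambda>y. ennreal (\<bar>A y\<bar> powr s)) x) powr (1/s)) powr t)"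
begin

definition aA :: "int \<Rightarrow> real^'n \<Rightarrow> real" where
  "aA j x = enn2real (dav j (\<lambda>y. ennreal (\<bar>A y\<bar> powr s)) x) powr (1/s)"

definition V0 :: real where "V0 = vol TYPE('n) j0"
definition Bv :: real where "Bv = V0 powr (1 - v/u)"

lemma V0: "V0 > 0" by (simp add: V0_def)
lemma Bv: "Bv > 0" using V0 by (simp add: Bv_def)

lemma A_meas [measurable]: "A \<in> borel_measurable lebesgue" by (rule block_measurable[OF blk])

lemma nrm_Bv: "(\<integral>\<^sup>+x. ennreal (\<bar>A x\<bar> powr v) \<partial>lebesgue) \<le> ennreal Bv"
  using nrm by (simp only: Bv_def V0_def)

lemma nrm_fin: "(\<integral>\<^sup>+x. ennreal (\<bar>A x\<bar> powr v) \<partial>lebesgue) < \<infinity>"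
  using nrm_Bv by (rule le_less_trans) simp

lemma aA0: "aA j x \<ge> 0" by (simp add: aA_def)

lemma powr_s_v: "(\<bar>A y\<bar> powr s) powr (v/s) = \<bar>A y\<bar> powr v"
  using s by (simp add: powr_powr)

lemma dav_s_fin: "dav j (\<lambda>y. ennreal (\<bar>A y\<bar> powr s)) x < \<infinity>"
  by (rule le_less_trans[OF block_dav_bound[OF blk]]) (use s u in auto)

lemma H': "dav j (\<lambda>y. ennreal (h j y powr t)) x \<le> ennreal ((Kh * 2 powr (- real_of_int j * \<alpha>) * aA j x) powr t)"
  using H by (simp only: aA_def)

lemma aA_bound: "aA j x \<le> (2 * vol TYPE('n) j powr (-s/u)) powr (1/s)"
proof -
  have "enn2real (dav j (\<lambda>y. ennreal (\<bar>A y\<bar> powr s)) x) \<le> 2 * vol TYPE('n) j powr (-s/u)"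
    using enn2real_mono[OF block_dav_bound[OF blk, of s j x]] s u by simp
  then show ?thesis unfolding aA_def using s by (intro powr_mono2) auto
qed

definition S :: "nat \<Rightarrow> real^'n \<Rightarrow> real" where "S N x = (\<Sum>i\<le>N. h (j0 + int i) x)"

lemma S_meas [measurable]: "S N \<in> borel_measurable lebesgue" unfolding S_def by measurable
lemma S0: "S N x \<ge> 0" unfolding S_def by (intro sum_nonneg h0)

text \<open>Each level has a finite average of order t by \<open>H\<close>, hence one of order w <
  t. The bound grows with N; finiteness is what the absorption in \<open>local_estimate\<close>
  requires.\<close>

lemma S_fin: "(\<integral>\<^sup>+x\<in>cube j0 x0. ennreal (S N x powr w) \<partial>lebesgue) < \<infinity>"
proof -
  have hfin: "dav j0 (\<lambda>y. ennreal (h (j0 + int i) y powr w)) x0 < \<infinity>" for i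
  proof -
    let ?j = "j0 + int i"
    define c where "c = (Kh * 2 powr (- real_of_int ?j * \<alpha>) * (2 * vol TYPE('n) ?j powr (-s/u)) powr (1/s)) powr t"
    have le: "dav ?j (\<lambda>y. ennreal (h ?j y powr t)) x \<le> ennreal c" for x
    proof (rule order_trans[OF H'])
      show "ennreal ((Kh * 2 powr (- real_of_int ?j * \<alpha>) * aA ?j x) powr t) \<le> ennreal c"
        unfolding c_def using Kh t by (intro ennreal_leI powr_mono2 mult_left_mono aA_bound mult_nonneg_nonneg aA0) auto
    qed
    have "dav j0 (\<lambda>y. ennreal (h ?j y powr w)) x0 \<le> dav j0 (\<lambda>y. 1 + ennreal (h ?j y powr t)) x0"
    proof (rule dav_mono)
      fix y
      have "h ?j y powr w \<le> 1 + h ?j y powr t"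
        using powr_young_level[of "h ?j y" 1 w t] h0[of ?j y] w wt by simp
      then have "ennreal (h ?j y powr w) \<le> ennreal (1 + h ?j y powr t)" by (rule ennreal_leI)
      then show "ennreal (h ?j y powr w) \<le> 1 + ennreal (h ?j y powr t)" by simp
    qed
    also have "\<dots> = 1 + dav j0 (\<lambda>y. ennreal (h ?j y powr t)) x0" by (subst dav_add) auto
    also have "dav j0 (\<lambda>y. ennreal (h ?j y powr t)) x0 = dav j0 (dav ?j (\<lambda>y. ennreal (h ?j y powr t))) x0"
      by (rule dav_tower[symmetric]) auto
    also have "\<dots> \<le> dav j0 (\<lambda>y. ennreal c) x0" by (intro dav_mono le)
    finally have "dav j0 (\<lambda>y. ennreal (h ?j y powr w)) x0 \<le> 1 + ennreal c" by simp
    then show ?thesis by (rule le_less_trans) simp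
  qed
  have "dav j0 (\<lambda>x. ennreal (S N x powr w)) x0 \<le> dav j0 (\<lambda>x. ennreal (real (Suc N) powr w) * (\<Sum>i\<le>N. ennreal (h (j0 + int i) x powr w))) x0"
  proof (rule dav_mono)
    fix x
    have "ennreal (S N x powr w) \<le> ennreal (real (Suc N) powr w * (\<Sum>i\<le>N. h (j0 + int i) x powr w))"
      unfolding S_def using h0 w by (intro ennreal_leI sum_powr_le) auto
    also have "\<dots> = ennreal (real (Suc N) powr w) * (\<Sum>i\<le>N. ennreal (h (j0 + int i) x powr w))"
      by (subst ennreal_mult) (auto intro: sum_nonneg simp: sum_ennreal)
    finally show "ennreal (S N x powr w) \<le> \<dots>" .
  qed
  also have "\<dots> = ennreal (real (Suc N) powr w) * dav j0 (\<lambda>x. \<Sum>i\<le>N. ennreal (h (j0 + int i) x powr w)) x0"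
    by (rule dav_cmult) auto
  also have "dav j0 (\<lambda>x. \<Sum>i\<le>N. ennreal (h (j0 + int i) x powr w)) x0 = (\<Sum>i\<le>N. dav j0 (\<lambda>x. ennreal (h (j0 + int i) x powr w)) x0)"
    by (induction N) (auto simp: dav_add)
  also have "ennreal (real (Suc N) powr w) * \<dots> < \<infinity>"
    using hfin by (auto simp: ennreal_mult_less_top)
  finally show ?thesis unfolding vol_dav by (auto simp: ennreal_mult_less_top)
qed

text \<open>Dualise against \<open>\<phi> = S\<^sup>w\<^sup>-\<^sup>1\<close> on \<open>E\<close>: only cubes meeting \<open>E\<close> contribute, on them Hedberg's trick
  applies, and the resulting power of the left-hand side is absorbed.\<close>

lemma local_estimate:
  assumes E[measurable]: "E \<in> sets lebesgue" and Esub: "E \<subseteq> cube j0 x0" and T: "T > 0"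
    and stop: "\<And>i y. cube (j0 + int i) y \<inter> E \<noteq> {} \<Longrightarrow>
      dav (j0 + int i) (\<lambda>y. ennreal (\<bar>A y\<bar> powr v)) y \<le> ennreal (T * vol TYPE('n) (j0 + int i) powr (\<kappa> - 1))"
  shows "(\<integral>\<^sup>+x\<in>E. ennreal (S N x powr w) \<partial>lebesgue) \<le> ennreal (C1 * T powr (\<eta>*w/v) * Bv)"
proof -
  define \<phi> where "\<phi> x = S N x powr (w-1) * indicator E x" for x
  have [measurable]: "\<phi> \<in> borel_measurable lebesgue" unfolding \<phi>_def by measurable
  have \<phi>0: "\<phi> x \<ge> 0" for x by (simp add: \<phi>_def)
  define P where "P = (\<integral>\<^sup>+x\<in>E. ennreal (S N x powr w) \<partial>lebesgue)"
  have \<phi>p: "(\<integral>\<^sup>+x. ennreal (\<phi> x powr p) \<partial>lebesgue) = P"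
    unfolding P_def \<phi>_def using p by (intro nn_integral_cong) (auto simp: indicator_def powr_powr)
  have Pfin: "P < \<infinity>"
  proof -
    have "P \<le> (\<integral>\<^sup>+x\<in>cube j0 x0. ennreal (S N x powr w) \<partial>lebesgue)"
      unfolding P_def using Esub by (intro nn_integral_mono) (auto simp: indicator_def)
    then show ?thesis using S_fin by (rule le_less_trans)
  qed
  define M\<phi> where "M\<phi> y = dmax j0 (\<lambda>x. \<phi> x powr s) N y powr (1/s)" for y
  define m where "m y = dmax j0 (\<lambda>x. \<bar>A x\<bar> powr s) N y powr (1/s)" for y
  have [measurable]: "M\<phi> \<in> borel_measurable lebesgue" "m \<in> borel_measurable lebesgue"
    unfolding M\<phi>_def m_def by measurable
  have m0: "m y \<ge> 0" "M\<phi> y \<ge> 0" for y by (auto simp: m_def M\<phi>_def)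
  have \<phi>sp: "(\<phi> x powr s) powr (p/s) = \<phi> x powr p" for x using s by (simp add: powr_powr)
  have \<phi>fin: "dav j (\<lambda>y. ennreal (\<phi> y powr s)) x < \<infinity>" for j x
  proof (rule dav_jensen(1)[of _ "p/s"])
    show "dav j (\<lambda>y. ennreal ((\<phi> y powr s) powr (p/s))) x < \<infinity>"
      unfolding \<phi>sp by (rule dav_finite) (use \<phi>p Pfin in simp)
  qed (use ps in auto)
  \<comment> \<open>The constant of the second Hedberg bound: the v-th root of T, times the constant
    that Jensen's inequality from exponent s to exponent v leaves behind.\<close>
  define R where "R = 2 powr (1/s) * T powr (1/v)"
  have R: "R > 0" using T by (simp add: R_def)
  define I where "I y = {i. i \<le> N \<and> cube (j0 + int i) y \<inter> E \<noteq> {}}" for y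
  have fI: "finite (I y)" for y by (rule finite_subset[of _ "{..N}"]) (auto simp: I_def)
  define b where "b y i = 2 powr (- real_of_int (j0 + int i) * \<alpha>) * aA (j0 + int i) y" for y i
  have b0: "b y i \<ge> 0" for y i unfolding b_def using aA0 by simp
  have hterm: "dav (j0 + int i) (\<lambda>x. ennreal (h (j0 + int i) x * \<phi> x)) y \<le> (if i \<in> I y then ennreal (2 * Kh * M\<phi> y * b y i) else 0)"
    if "i \<le> N" for i y
  proof (cases "i \<in> I y")
    case True
    let ?j = "j0 + int i"
    have "dav ?j (\<lambda>x. ennreal (h ?j x * \<phi> x)) y \<le> ennreal (2 * (Kh * 2 powr (- real_of_int ?j * \<alpha>) * aA ?j y) * M\<phi> y)"
    proof (rule dav_holder[where p = t and q = s])
      show "dav ?j (\<lambda>y. ennreal (h ?j y powr t)) y \<le> ennreal ((Kh * 2 powr (- real_of_int ?j * \<alpha>) * aA ?j y) powr t)"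
        by (rule H')
      show "dav ?j (\<lambda>y. ennreal (\<phi> y powr s)) y \<le> ennreal (M\<phi> y powr s)"
      proof -
        have "M\<phi> y powr s = dmax j0 (\<lambda>x. \<phi> x powr s) N y"
          unfolding M\<phi>_def using s dmax_nonneg[of j0 "\<lambda>x. \<phi> x powr s" N y] by (simp add: powr_powr)
        then show ?thesis
          using ennreal_le_enn2real[OF \<phi>fin dmax_ge[OF that]] by simp
      qed
      show "0 \<le> Kh * 2 powr (- real_of_int ?j * \<alpha>) * aA ?j y" using Kh aA0 by simp
    qed (use h0 \<phi>0 t st m0 in auto)
    then show ?thesis using True by (simp add: b_def mult_ac)
  next
    case False
    then have "\<phi> x = 0" if "x \<in> cube (j0 + int i) y" for x
      using that \<open>i \<le> N\<close> by (auto simp: I_def \<phi>_def indicator_def)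
    then have "dav (j0 + int i) (\<lambda>x. ennreal (h (j0 + int i) x * \<phi> x)) y = dav (j0 + int i) (\<lambda>x. 0) y"
      by (intro dav_cong) simp
    then show ?thesis using False by simp
  qed
  have aA_eq: "aA j y powr s = enn2real (dav j (\<lambda>y. ennreal (\<bar>A y\<bar> powr s)) y)" for j y
    unfolding aA_def using s by (simp add: powr_powr)
  have hed: "(\<Sum>i\<in>I y. b y i) \<le> hedberg_const \<alpha> \<eta> * m y powr (1 - \<eta>) * R powr \<eta>" for y
  proof (rule hedberg_sum[OF m0(1) R \<alpha> \<eta>(1,2) _ _ fI])
    fix i assume i: "i \<in> I y"
    let ?j = "j0 + int i"
    have "aA ?j y \<le> m y"
      unfolding aA_def m_def using i s dmax_ge[of i N j0 "\<lambda>x. \<bar>A x\<bar> powr s" y]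
      by (intro powr_mono2) (auto simp: I_def)
    then show "b y i \<le> m y * 2 powr (- real_of_int ?j * \<alpha>)"
      unfolding b_def by (subst mult.commute) (intro mult_right_mono, auto)
    \<comment> \<open>The second bound uses that the cube meets E: Jensen raises the exponent from s
      to v, where the stopping condition applies.\<close>
    have "ennreal (enn2real (dav ?j (\<lambda>y. ennreal (\<bar>A y\<bar> powr s)) y) powr (v/s)) \<le> ennreal (2 powr (v/s)) * dav ?j (\<lambda>y. ennreal ((\<bar>A y\<bar> powr s) powr (v/s))) y"
      by (rule dav_jensen(2)) (use ps in \<open>auto simp: powr_s_v dav_finite[OF nrm_fin, simplified]\<close>)
    also have "\<dots> \<le> ennreal (2 powr (v/s)) * ennreal (T * vol TYPE('n) ?j powr (\<kappa> - 1))"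
      unfolding powr_s_v using i by (intro mult_left_mono stop) (auto simp: I_def)
    also have "\<dots> = ennreal (2 powr (v/s) * (T * vol TYPE('n) ?j powr (\<kappa> - 1)))"
      using T by (intro ennreal_mult[symmetric]) auto
    finally have "enn2real (dav ?j (\<lambda>y. ennreal (\<bar>A y\<bar> powr s)) y) powr (v/s) \<le> 2 powr (v/s) * (T * vol TYPE('n) ?j powr (\<kappa> - 1))"
      using T by (subst (asm) ennreal_le_iff) auto
    then have "aA ?j y powr v \<le> 2 powr (v/s) * (T * vol TYPE('n) ?j powr (\<kappa> - 1))"
      unfolding aA_def powr_powr by (simp add: mult.commute)
    then have "(aA ?j y powr v) powr (1/v) \<le> (2 powr (v/s) * (T * vol TYPE('n) ?j powr (\<kappa> - 1))) powr (1/v)"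
      using v by (intro powr_mono2) auto
    also have "(aA ?j y powr v) powr (1/v) = aA ?j y" using v aA0[of ?j y] by (simp add: powr_powr)
    also have "(2 powr (v/s) * (T * vol TYPE('n) ?j powr (\<kappa> - 1))) powr (1/v) = R * vol TYPE('n) ?j powr ((\<kappa>-1)/v)"
    proof -
      have "v / s * (1/v) = 1/s" "(\<kappa> - 1) * (1/v) = (\<kappa>-1)/v" using v by auto
      then show ?thesis unfolding R_def using T by (simp only: powr_mult powr_powr mult.assoc)
    qed
    also have "vol TYPE('n) ?j powr ((\<kappa>-1)/v) = (2 powr (- real_of_int ?j * \<alpha>)) powr (-1/\<eta>)"
    proof -
      have "- real_of_int ?j * real CARD('n) * ((\<kappa>-1)/v) = - real_of_int ?j * ((\<kappa>-1)/v * real CARD('n))" by (simp only: mult_ac)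
      also have "\<dots> = - real_of_int ?j * \<alpha> * (-1/\<eta>)" unfolding scale_exponent by (simp only: mult_ac)
      finally show ?thesis by (simp only: powr_powr)
    qed
    finally have le: "aA ?j y \<le> R * (2 powr (- real_of_int ?j * \<alpha>)) powr (-1/\<eta>)" .
    define X where "X = (2::real) powr (- real_of_int ?j * \<alpha>)"
    have X: "X > 0" by (simp add: X_def)
    have "b y i \<le> X * (R * X powr (-1/\<eta>))"
      unfolding b_def X_def[symmetric] using le X by (intro mult_left_mono) (auto simp: X_def)
    also have "\<dots> = R * (X * X powr (-1/\<eta>))" by (simp only: mult_ac)
    also have "X * X powr (-1/\<eta>) = X powr (1 - 1/\<eta>)" using X by (simp add: powr_diff powr_minus divide_inverse)
    finally show "b y i \<le> R * (2 powr (- real_of_int ?j * \<alpha>)) powr (1 - 1/\<eta>)" by (simp only: X_def)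
  qed
  define G0 where "G0 = G1 * T powr (\<eta>/v)"
  have G0: "G0 > 0" using G1_pos T by (simp add: G0_def)
  have sumterm: "(\<Sum>i\<le>N. dav (j0 + int i) (\<lambda>x. ennreal (h (j0 + int i) x * \<phi> x)) y) \<le> ennreal (G0 * (M\<phi> y * m y powr (v/w)))" for y
  proof -
    have "(\<Sum>i\<le>N. dav (j0 + int i) (\<lambda>x. ennreal (h (j0 + int i) x * \<phi> x)) y) \<le> (\<Sum>i\<le>N. if i \<in> I y then ennreal (2 * Kh * M\<phi> y * b y i) else 0)"
      by (intro sum_mono hterm) simp
    also have "\<dots> = (\<Sum>i\<in>I y. ennreal (2 * Kh * M\<phi> y * b y i))"
      by (subst sum.inter_restrict[symmetric]) (auto intro!: sum.cong simp: I_def)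
    also have "\<dots> = ennreal (\<Sum>i\<in>I y. 2 * Kh * M\<phi> y * b y i)"
      using Kh m0 b0 by (intro sum_ennreal) auto
    also have "\<dots> = ennreal (2 * Kh * M\<phi> y * (\<Sum>i\<in>I y. b y i))" by (simp only: sum_distrib_left)
    also have "\<dots> \<le> ennreal (2 * Kh * M\<phi> y * (hedberg_const \<alpha> \<eta> * m y powr (1 - \<eta>) * R powr \<eta>))"
      using Kh m0 hed by (intro ennreal_leI mult_left_mono) auto
    also have "R powr \<eta> = 2 powr (\<eta>/s) * T powr (\<eta>/v)"
    proof -
      have "1/s * \<eta> = \<eta>/s" "1/v * \<eta> = \<eta>/v" by auto
      then show ?thesis unfolding R_def using T by (simp only: powr_mult powr_powr)
    qed
    finally show ?thesis unfolding G0_def G1_def \<eta>(3) by (simp only: mult_ac)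
  qed
  define C\<phi> where "C\<phi> = dmax_const (p/s)"
  define CA where "CA = dmax_const (v/s)"
  have C\<phi>: "C\<phi> > 0" "CA > 0" using dmax_const_pos ps by (auto simp: C\<phi>_def CA_def)
  \<comment> \<open>Chosen so that after Young's inequality and the maximal theorem the dual term is
    exactly P/2, which is then absorbed.\<close>
  define c where "c = (2 * G0 * C\<phi>) powr (1/p)"
  have c: "c > 0" using G0 C\<phi> by (simp add: c_def)
  have cp: "c powr (-p) = 1 / (2 * G0 * C\<phi>)"
  proof -
    have "1/p * (-p) = -1" using p by simp
    then have "c powr (-p) = (2 * G0 * C\<phi>) powr (-1)" unfolding c_def by (simp only: powr_powr)
    moreover have "(2 * G0 * C\<phi>) powr (-1) = 1 / (2 * G0 * C\<phi>)" by (rule powr_neg_one) (use G0 C\<phi> in simp)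
    ultimately show ?thesis by simp
  qed
  have cw: "c powr w = (2 * G0 * C\<phi>) powr (w-1)"
  proof -
    have "1/p * w = w-1" using w by (simp add: p_def field_simps)
    then show ?thesis unfolding c_def by (simp only: powr_powr)
  qed
  have young: "M\<phi> y * m y powr (v/w) \<le> c powr (-p) * M\<phi> y powr p + c powr w * m y powr v" for y
  proof -
    have "M\<phi> y * m y powr (v/w) \<le> c * (1/c) * (M\<phi> y powr p * c powr (-p) + (m y powr (v/w)) powr w * (1/c) powr (-w))"
      by (rule young_weighted) (use p c m0 in auto)
    also have "(1/c) powr (-w) = c powr w" using c by (simp add: powr_divide powr_minus_divide)
    also have "(m y powr (v/w)) powr w = m y powr v" using w by (simp add: powr_powr)
    finally show ?thesis using c by (simp add: mult.commute)
  qed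
  have IM: "(\<integral>\<^sup>+y. ennreal (M\<phi> y powr p) \<partial>lebesgue) \<le> ennreal C\<phi> * P"
  proof -
    have "(\<integral>\<^sup>+y. ennreal (M\<phi> y powr p) \<partial>lebesgue) = (\<integral>\<^sup>+y. ennreal (dmax j0 (\<lambda>x. \<phi> x powr s) N y powr (p/s)) \<partial>lebesgue)"
      unfolding M\<phi>_def powr_powr by simp
    also have "\<dots> \<le> ennreal C\<phi> * (\<integral>\<^sup>+y. ennreal ((\<phi> y powr s) powr (p/s)) \<partial>lebesgue)"
      unfolding C\<phi>_def by (rule dmax_Lq) (use ps \<phi>p Pfin \<phi>sp in auto)
    finally show ?thesis unfolding \<phi>sp \<phi>p .
  qed
  have IA: "(\<integral>\<^sup>+y. ennreal (m y powr v) \<partial>lebesgue) \<le> ennreal CA * ennreal Bv"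
  proof -
    have "(\<integral>\<^sup>+y. ennreal (m y powr v) \<partial>lebesgue) = (\<integral>\<^sup>+y. ennreal (dmax j0 (\<lambda>x. \<bar>A x\<bar> powr s) N y powr (v/s)) \<partial>lebesgue)"
      unfolding m_def powr_powr by simp
    also have "\<dots> \<le> ennreal CA * (\<integral>\<^sup>+y. ennreal ((\<bar>A y\<bar> powr s) powr (v/s)) \<partial>lebesgue)"
      unfolding CA_def by (rule dmax_Lq) (use ps nrm_fin powr_s_v in auto)
    also have "\<dots> \<le> ennreal CA * ennreal Bv" unfolding powr_s_v by (intro mult_left_mono nrm_Bv) simp
    finally show ?thesis .
  qed
  have "P = (\<integral>\<^sup>+x. (\<Sum>i\<le>N. ennreal (h (j0 + int i) x * \<phi> x)) \<partial>lebesgue)"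
    unfolding P_def
  proof (rule nn_integral_cong)
    fix x
    have "(\<Sum>i\<le>N. ennreal (h (j0 + int i) x * \<phi> x)) = ennreal (S N x * \<phi> x)"
      unfolding S_def sum_distrib_right using h0 \<phi>0 by (intro sum_ennreal) simp
    also have "S N x * \<phi> x = S N x powr w * indicator E x"
      unfolding \<phi>_def using S0[of N x] by (simp add: mult.assoc[symmetric] powr_mult_base)
    finally show "ennreal (S N x powr w) * indicator E x = (\<Sum>i\<le>N. ennreal (h (j0 + int i) x * \<phi> x))"
      by (simp add: indicator_def)
  qed
  also have "\<dots> = (\<Sum>i\<le>N. \<integral>\<^sup>+x. ennreal (h (j0 + int i) x * \<phi> x) \<partial>lebesgue)"
    by (rule nn_integral_sum) auto
  \<comment> \<open>Replacing each product by its average at its own level keeps the integral and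
    brings it to the form bounded by \<open>hterm\<close>.\<close>
  also have "\<dots> = (\<Sum>i\<le>N. \<integral>\<^sup>+y. dav (j0 + int i) (\<lambda>x. ennreal (h (j0 + int i) x * \<phi> x)) y \<partial>lebesgue)"
    by (intro sum.cong refl nn_integral_dav[symmetric]) measurable
  also have "\<dots> = (\<integral>\<^sup>+y. (\<Sum>i\<le>N. dav (j0 + int i) (\<lambda>x. ennreal (h (j0 + int i) x * \<phi> x)) y) \<partial>lebesgue)"
    by (rule nn_integral_sum[symmetric]) auto
  also have "\<dots> \<le> (\<integral>\<^sup>+y. ennreal (G0 * c powr (-p)) * ennreal (M\<phi> y powr p) + ennreal (G0 * c powr w) * ennreal (m y powr v) \<partial>lebesgue)"
  proof (rule nn_integral_mono)
    fix y
    have "G0 * (M\<phi> y * m y powr (v/w)) \<le> (G0 * c powr (-p)) * (M\<phi> y powr p) + (G0 * c powr w) * (m y powr v)"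
      using mult_left_mono[OF young, of G0 y] G0 by (simp add: distrib_left mult.assoc)
    then have "ennreal (G0 * (M\<phi> y * m y powr (v/w))) \<le> ennreal ((G0 * c powr (-p)) * (M\<phi> y powr p) + (G0 * c powr w) * (m y powr v))"
      by (rule ennreal_leI)
    also have "\<dots> = ennreal (G0 * c powr (-p)) * ennreal (M\<phi> y powr p) + ennreal (G0 * c powr w) * ennreal (m y powr v)"
      using G0 by (intro ennreal_mult_add) auto
    finally have "ennreal (G0 * (M\<phi> y * m y powr (v/w))) \<le> ennreal (G0 * c powr (-p)) * ennreal (M\<phi> y powr p) + ennreal (G0 * c powr w) * ennreal (m y powr v)" .
    with sumterm[of y] show "(\<Sum>i\<le>N. dav (j0 + int i) (\<lambda>x. ennreal (h (j0 + int i) x * \<phi> x)) y) \<le> \<dots>" by (rule order_trans)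
  qed
  also have "\<dots> = ennreal (G0 * c powr (-p)) * (\<integral>\<^sup>+y. ennreal (M\<phi> y powr p) \<partial>lebesgue) + ennreal (G0 * c powr w) * (\<integral>\<^sup>+y. ennreal (m y powr v) \<partial>lebesgue)"
    by (subst nn_integral_add) (auto simp: nn_integral_cmult)
  also have "\<dots> \<le> ennreal (G0 * c powr (-p)) * (ennreal C\<phi> * P) + ennreal (G0 * c powr w) * (ennreal CA * ennreal Bv)"
    by (intro add_mono mult_left_mono IM IA) auto
  also have "ennreal (G0 * c powr (-p)) * (ennreal C\<phi> * P) = ennreal (1/2) * P"
  proof -
    have "G0 * c powr (-p) * C\<phi> = 1/2" using G0 C\<phi> by (simp add: cp)
    moreover have "ennreal (G0 * c powr (-p)) * ennreal C\<phi> = ennreal (G0 * c powr (-p) * C\<phi>)"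
      using G0 C\<phi> by (intro ennreal_mult[symmetric]) auto
    ultimately show ?thesis by (simp only: mult.assoc[symmetric])
  qed
  finally have "P \<le> 2 * (ennreal (G0 * c powr w) * (ennreal CA * ennreal Bv))"
    by (rule ennreal_absorb[OF _ Pfin])
  also have "\<dots> = ennreal (2 * (G0 * c powr w * (CA * Bv)))"
    using G0 C\<phi> Bv by (simp add: ennreal_mult)
  also have "2 * (G0 * c powr w * (CA * Bv)) = C1 * T powr (\<eta>*w/v) * Bv"
  proof -
    have "G0 * (2 * G0 * C\<phi>) powr (w-1) = (G0 * G0 powr (w-1)) * (2 * C\<phi>) powr (w-1)"
      using G0 C\<phi> by (simp add: powr_mult mult_ac)
    also have "G0 * G0 powr (w-1) = G0 powr w" using G0 by (simp add: powr_mult_base)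
    also have "G0 powr w = G1 powr w * T powr (\<eta>*w/v)"
      unfolding G0_def using G1_pos T by (simp add: powr_mult powr_powr)
    finally show ?thesis unfolding cw C1_def C\<phi>_def[symmetric] CA_def[symmetric] by (simp add: mult_ac)
  qed
  finally show ?thesis by (simp only: P_def)
qed

end

section \<open>Level sets of the fractional maximal function on the cube of a block\<close>

context adams_block begin

definition Sinf :: "real^'n \<Rightarrow> real" where "Sinf x = (\<Sum>i. h (j0 + int i) x)"

lemma Sinf_meas [measurable]: "Sinf \<in> borel_measurable lebesgue" unfolding Sinf_def by measurable

text \<open>Monotone convergence serves both claims: the supremum is finite almost everywhere on E,
  which forces convergence, and it dominates the limit. Where the series diverges
  \<open>suminf\<close> has no meaning, but this is a null subset of E.\<close>

lemma local_limit:
  assumes E[measurable]: "E \<in> sets lebesgue"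
    and est: "\<And>N. (\<integral>\<^sup>+x\<in>E. ennreal (S N x powr w) \<partial>lebesgue) \<le> ennreal c"
  shows "AE x in lebesgue. x \<in> E \<longrightarrow> summable (\<lambda>i. h (j0 + int i) x)"
    and "(\<integral>\<^sup>+x\<in>E. ennreal (\<bar>Sinf x\<bar> powr w) \<partial>lebesgue) \<le> ennreal c"
proof -
  define g where "g N x = ennreal (S N x powr w) * indicator E x" for N x
  have [measurable]: "g N \<in> borel_measurable lebesgue" for N unfolding g_def by measurable
  have mono: "S N x \<le> S (Suc N) x" for N x unfolding S_def using h0 by simp
  have inc: "incseq g"
    unfolding incseq_Suc_iff le_fun_def g_def using mono S0 w
    by (auto intro!: mult_right_mono ennreal_leI powr_mono2)
  have "(\<integral>\<^sup>+x. (SUP N. g N x) \<partial>lebesgue) = (SUP N. \<integral>\<^sup>+x. g N x \<partial>lebesgue)"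
    by (rule nn_integral_monotone_convergence_SUP[OF inc]) auto
  also have "\<dots> \<le> ennreal c" unfolding g_def by (intro SUP_least est)
  finally have SUPle: "(\<integral>\<^sup>+x. (SUP N. g N x) \<partial>lebesgue) \<le> ennreal c" .
  then have "(\<integral>\<^sup>+x. (SUP N. g N x) \<partial>lebesgue) \<noteq> \<infinity>" by (auto simp: top_unique)
  then have ae: "AE x in lebesgue. (SUP N. g N x) \<noteq> \<infinity>"
    by (intro nn_integral_PInf_AE) auto
  have sm: "summable (\<lambda>i. h (j0 + int i) x) \<and> ennreal (\<bar>Sinf x\<bar> powr w) \<le> (SUP N. g N x)"
    if x: "x \<in> E" and fin: "(SUP N. g N x) \<noteq> \<infinity>" for x
  proof -
    obtain r where r: "(SUP N. g N x) = ennreal r" "r \<ge> 0" using fin by (cases "SUP N. g N x") auto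
    have Sr: "S N x powr w \<le> r" for N
    proof -
      have "g N x \<le> ennreal r" unfolding r(1)[symmetric] by (rule SUP_upper) simp
      then show ?thesis using x r(2) by (simp add: g_def)
    qed
    have bd: "S N x \<le> r powr (1/w)" for N
    proof -
      have "(S N x powr w) powr (1/w) \<le> r powr (1/w)" using Sr w by (intro powr_mono2) auto
      then show ?thesis using S0[of N x] w by (simp add: powr_powr)
    qed
    have sm: "summable (\<lambda>i. h (j0 + int i) x)"
    proof (rule summableI_nonneg_bounded)
      fix n
      have "(\<Sum>i<n. h (j0 + int i) x) \<le> S n x" unfolding S_def by (intro sum_mono2 h0) auto
      then show "(\<Sum>i<n. h (j0 + int i) x) \<le> r powr (1/w)" using bd[of n] by simp
    qed (rule h0)
    then have "(\<lambda>N. S N x) \<longlonglongrightarrow> Sinf x" unfolding S_def Sinf_def by (rule summable_LIMSEQ')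
    moreover have Sinf0: "Sinf x \<ge> 0" unfolding Sinf_def by (rule suminf_nonneg[OF sm h0])
    ultimately have "(\<lambda>N. S N x powr w) \<longlonglongrightarrow> Sinf x powr w"
      using w by (intro tendsto_powr2) (auto simp: S0)
    then have "Sinf x powr w \<le> r" by (rule LIMSEQ_le_const2) (use Sr in auto)
    then show ?thesis using sm r Sinf0 by (simp add: ennreal_leI)
  qed
  show "AE x in lebesgue. x \<in> E \<longrightarrow> summable (\<lambda>i. h (j0 + int i) x)"
    using ae by eventually_elim (use sm in auto)
  have "(\<integral>\<^sup>+x\<in>E. ennreal (\<bar>Sinf x\<bar> powr w) \<partial>lebesgue) \<le> (\<integral>\<^sup>+x. (SUP N. g N x) \<partial>lebesgue)"
    by (rule nn_integral_mono_AE, use ae in eventually_elim) (use sm in \<open>auto simp: indicator_def\<close>)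
  then show "(\<integral>\<^sup>+x\<in>E. ennreal (\<bar>Sinf x\<bar> powr w) \<partial>lebesgue) \<le> ennreal c" using SUPle by (rule order_trans)
qed

text \<open>\<open>Bv\<close> bounds the integral of |A|^v, so the starting threshold bounds the
  fractional average of the block over its own cube; the thresholds double from there.\<close>

definition T :: "nat \<Rightarrow> real" where "T k = 2 ^ k * (Bv * V0 powr (-\<kappa>))"

lemma T_pos: "T k > 0" unfolding T_def using Bv V0 by simp

text \<open>After multiplication by the volume the condition reads |Q|^(-\<kappa>) times the
  integral of |A|^v over Q exceeds \<open>T k\<close>, for the subcube Q of level j0 + n that
  contains x.\<close>

definition bad :: "nat \<Rightarrow> nat \<Rightarrow> real^'n \<Rightarrow> bool" where
  "bad k n x \<longleftrightarrow> x \<in> cube j0 x0 \<and> dav (j0 + int n) (\<lambda>y. ennreal (\<bar>A y\<bar> powr v)) x > ennreal (T k * vol TYPE('n) (j0 + int n) powr (\<kappa> - 1))"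

definition Dk :: "nat \<Rightarrow> (real^'n) set" where "Dk k = {x. \<exists>n. bad k n x}"
text \<open>The first set starts from the whole cube instead of \<open>Dk 0\<close>, so that points
  with a small maximal function are covered too.\<close>

definition Ek :: "nat \<Rightarrow> (real^'n) set" where "Ek k = (if k = 0 then cube j0 x0 else Dk k) - Dk (Suc k)"

lemma bad_meas [measurable]: "Measurable.pred lebesgue (bad k n)"
  unfolding bad_def by measurable

lemma Dk_sets [measurable]: "Dk k \<in> sets lebesgue"
proof -
  have "Dk k = {x \<in> space lebesgue. \<exists>n. bad k n x}" by (simp add: Dk_def)
  also have "\<dots> \<in> sets lebesgue" by measurable
  finally show ?thesis .
qed

lemma Ek_sets [measurable]: "Ek k \<in> sets lebesgue" unfolding Ek_def by auto

lemma Dk_sub: "Dk k \<subseteq> cube j0 x0" by (auto simp: Dk_def bad_def)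

lemma Dk_mono: "Dk (Suc k) \<subseteq> Dk k"
proof -
  have "bad k n x" if "bad (Suc k) n x" for n x
  proof -
    have "ennreal (T k * vol TYPE('n) (j0 + int n) powr (\<kappa> - 1)) \<le> ennreal (T (Suc k) * vol TYPE('n) (j0 + int n) powr (\<kappa> - 1))"
      using Bv V0 by (intro ennreal_leI mult_right_mono) (auto simp: T_def)
    then show ?thesis using that unfolding bad_def by (auto intro: le_less_trans)
  qed
  then show ?thesis by (auto simp: Dk_def)
qed

lemma bad_cube: assumes "y \<in> cube (j0 + int n) x" "l \<le> n" shows "bad k l y = bad k l x"
proof -
  have "y \<in> cube (j0 + int l) x" using assms cube_mono[of "j0 + int l" "j0 + int n" x] by auto
  moreover have "y \<in> cube j0 x" using assms cube_mono[of "j0" "j0 + int n" x] by auto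
  then have "y \<in> cube j0 x0 \<longleftrightarrow> x \<in> cube j0 x0" by (simp add: mem_cube)
  ultimately show ?thesis unfolding bad_def by (simp add: cinvD[OF cinv_dav])
qed

text \<open>Badness belongs to the cube, not to the point: a single point outside
  \<open>Dk (Suc k)\<close> clears every cube of level j0 or finer that contains it, even if most of
  that cube lies outside \<open>Ek k\<close>.\<close>

lemma Ek_stop:
  assumes "cube (j0 + int i) y \<inter> Ek k \<noteq> {}"
  shows "dav (j0 + int i) (\<lambda>y. ennreal (\<bar>A y\<bar> powr v)) y \<le> ennreal (T (Suc k) * vol TYPE('n) (j0 + int i) powr (\<kappa> - 1))"
proof -
  obtain x where x: "x \<in> cube (j0 + int i) y" "x \<in> Ek k" using assms by auto
  then have "\<not> bad (Suc k) i x" "x \<in> cube j0 x0" using Dk_sub by (auto simp: Ek_def Dk_def split: if_splits)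
  then have "dav (j0 + int i) (\<lambda>y. ennreal (\<bar>A y\<bar> powr v)) x \<le> ennreal (T (Suc k) * vol TYPE('n) (j0 + int i) powr (\<kappa> - 1))"
    unfolding bad_def by (simp add: not_less)
  then show ?thesis using cinvD[OF cinv_dav x(1)] by simp
qed

lemma lint_Av: "lint (\<lambda>x. \<bar>A x\<bar> powr v)"
  unfolding lint_def using dav_finite[OF nrm_fin] by auto

text \<open>At a Lebesgue point of |A|^v the averages stay bounded. As \<kappa> < 1, the fractional
  averages over subcubes stay bounded as well, so some threshold is never exceeded.\<close>

lemma Dk_null: "AE x in lebesgue. \<not> (\<forall>k. x \<in> Dk k)"
  using dyadic_lebesgue_diff[OF lint_Av]
proof eventually_elim
  case (elim x)
  let ?r = "\<lambda>n. rav (j0 + int n) (\<lambda>x. \<bar>A x\<bar> powr v) x"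
  \<comment> \<open>At most one of \<open>nat j0\<close> and \<open>nat (- j0)\<close> is nonzero;
    the two shifts align levels counted from j0 with levels counted from 0.\<close>
  have "(\<lambda>n. rav (int (n + nat j0)) (\<lambda>x. \<bar>A x\<bar> powr v) x) \<longlonglongrightarrow> \<bar>A x\<bar> powr v"
    by (rule LIMSEQ_ignore_initial_segment[OF elim])
  moreover have "?r (n + nat (- j0)) = rav (int (n + nat j0)) (\<lambda>x. \<bar>A x\<bar> powr v) x" for n
    by (intro arg_cong3[of _ _ _ _ _ _ rav] refl) auto
  ultimately have "(\<lambda>n. ?r (n + nat (- j0))) \<longlonglongrightarrow> \<bar>A x\<bar> powr v" by simp
  then have "?r \<longlonglongrightarrow> \<bar>A x\<bar> powr v" by (rule LIMSEQ_offset)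
  then have "Bseq ?r" by (rule convergent_imp_Bseq[OF convergentI])
  then obtain M where M: "M > 0" "\<And>n. \<bar>?r n\<bar> \<le> M" by (auto elim!: BseqE)
  have "\<exists>k. M * V0 powr (1 - \<kappa>) / (Bv * V0 powr (-\<kappa>)) < 2 ^ k"
    by (rule real_arch_pow) simp
  then obtain k where k: "M * V0 powr (1 - \<kappa>) / (Bv * V0 powr (-\<kappa>)) < 2 ^ k" ..
  have "M * V0 powr (1 - \<kappa>) < 2 ^ k * (Bv * V0 powr (-\<kappa>))"
    using k Bv V0 by (subst (asm) pos_divide_less_eq) auto
  then have Tk: "M * V0 powr (1 - \<kappa>) < T k" by (simp only: T_def)
  have "\<not> bad k n x" for n
  proof
    assume "bad k n x"
    let ?V = "vol TYPE('n) (j0 + int n)"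
    have "ennreal (T k * ?V powr (\<kappa> - 1)) < ennreal (?r n)"
      using \<open>bad k n x\<close> rav_dav[OF lint_Av, of "j0 + int n" x] unfolding bad_def by simp
    then have "T k * ?V powr (\<kappa> - 1) < ?r n" using T_pos[of k] by (subst (asm) ennreal_less_iff) auto
    then have "T k * ?V powr (\<kappa> - 1) < M" using M(2)[of n] by linarith
    then have "T k * ?V powr (\<kappa> - 1) * ?V powr (1 - \<kappa>) < M * ?V powr (1 - \<kappa>)" by (intro mult_strict_right_mono) auto
    moreover have "?V powr (\<kappa> - 1) * ?V powr (1 - \<kappa>) = 1" by (simp flip: powr_add)
    moreover have "?V \<le> V0" unfolding V0_def by (intro powr_mono mult_right_mono) auto
    then have "?V powr (1 - \<kappa>) \<le> V0 powr (1 - \<kappa>)" using \<kappa> by (intro powr_mono2) auto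
    then have "M * ?V powr (1 - \<kappa>) \<le> M * V0 powr (1 - \<kappa>)" using M by (intro mult_left_mono) auto
    ultimately show False using Tk by (simp only: mult.assoc mult_1_right)
  qed
  then show ?case by (auto simp: Dk_def)
qed

lemma Ek_cover: "AE x in lebesgue. x \<in> cube j0 x0 \<longrightarrow> (\<exists>k. x \<in> Ek k)"
  using Dk_null
proof eventually_elim
  case (elim x)
  show ?case
  proof
    assume x: "x \<in> cube j0 x0"
    obtain k where k: "x \<notin> Dk k" "\<forall>l<k. x \<in> Dk l" using elim exists_least_iff[of "\<lambda>k. x \<notin> Dk k"] by auto
    show "\<exists>k. x \<in> Ek k"
    proof (cases "k \<le> 1")
      case True
      then have "x \<notin> Dk (Suc 0)" using k Dk_mono[of 0] by (cases k) auto
      then have "x \<in> Ek 0" using x by (simp add: Ek_def)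
      then show ?thesis ..
    next
      case False
      then obtain l where "k = Suc l" "l \<noteq> 0" by (cases k) auto
      then have "x \<in> Ek l" using k by (simp add: Ek_def)
      then show ?thesis ..
    qed
  qed
qed

lemma Ek_disjoint: "disjoint_family Ek"
proof -
  have sub: "Dk l \<subseteq> Dk k" if "k \<le> l" for k l
    using that by (induction l rule: dec_induct) (use Dk_mono in auto)
  have "x \<notin> Ek l" if "x \<in> Ek k" "k < l" for x k l
    using that sub[of "Suc k" l] by (auto simp: Ek_def)
  then show ?thesis unfolding disjoint_family_on_def by (metis disjoint_iff linorder_neqE_nat)
qed

text \<open>A maximal bad cube satisfies |Q|^\<kappa> < (1 / T k) times the integral of |A|^v over
  Q. These cubes are disjoint, so their content is at most Bv / T k, which is V0^\<kappa> 2^(-k).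
  The density F below is this integrand.\<close>

lemma level_block_pos:
  assumes G[measurable]: "G \<in> borel_measurable lebesgue" and suppG: "{x. G x \<noteq> 0} \<subseteq> Dk k"
    and GN: "(\<integral>\<^sup>+x. ennreal (\<bar>G x\<bar> powr w) \<partial>lebesgue) \<le> ennreal (N powr w)" and N: "N > 0"
  shows "BS z w (2 * (V0 powr \<kappa> * (1/2)^k) powr (1 - 1/w) * N) G"
proof -
  define U where "U n = {x. bad k n x \<and> (\<forall>l<n. \<not> bad k l x)}" for n
  define cb where "cb e = (case from_nat e of (n, m) \<Rightarrow> dcube (j0 + int n) (m :: int^'n))" for e
  \<comment> \<open>\<open>from_nat\<close> may decode several numbers to the same pair; the round
    trip through \<open>to_nat\<close> makes every cube appear at most once, as disjointness of the
    family demands.\<close>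
  define ok where "ok e \<longleftrightarrow> (case from_nat e of (n, m :: int^'n) \<Rightarrow> to_nat (n, m) = e \<and> dcube (j0 + int n) m \<subseteq> U n)" for e
  define Q where "Q e = (if ok e then cb e else {})" for e
  define F where "F x = ennreal (1 / T k) * ennreal (\<bar>A x\<bar> powr v)" for x
  show ?thesis
  proof (rule BS_content_split)
    show "F \<in> borel_measurable lebesgue" unfolding F_def by measurable
    fix e
    show "Q e = {} \<or> (\<exists>j x. Q e = cube j x \<and> ennreal (vol TYPE('n) j powr \<kappa>) \<le> (\<integral>\<^sup>+y\<in>Q e. F y \<partial>lebesgue))"
    proof (cases "ok e")
      case True
      obtain n m where nm: "from_nat e = (n :: nat, m :: int^'n)" by (rule prod.exhaust)
      let ?j = "j0 + int n"
      obtain x where x: "dcube ?j m = cube ?j x" using dcube_eq_cube by blast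
      have Qe: "Q e = cube ?j x" using True by (simp add: Q_def cb_def nm x)
      have "x \<in> U n" using True by (auto simp: ok_def nm x)
      then have bad: "bad k n x" by (simp add: U_def)
      let ?V = "vol TYPE('n) ?j"
      have "ennreal (?V powr \<kappa>) = ennreal ?V * (ennreal (1/T k) * ennreal (T k * ?V powr (\<kappa> - 1)))"
      proof -
        have "?V * (1/T k * (T k * ?V powr (\<kappa> - 1))) = ?V * ?V powr (\<kappa> - 1)" using T_pos[of k] by simp
        also have "\<dots> = ?V powr \<kappa>" by (simp add: powr_diff)
        finally show ?thesis using T_pos[of k] by (simp flip: ennreal_mult del: times_divide_eq_left)
      qed
      also have "\<dots> \<le> ennreal ?V * (ennreal (1/T k) * dav ?j (\<lambda>y. ennreal (\<bar>A y\<bar> powr v)) x)"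
        using bad unfolding bad_def by (intro mult_left_mono) auto
      also have "ennreal (1/T k) * dav ?j (\<lambda>y. ennreal (\<bar>A y\<bar> powr v)) x = dav ?j F x"
        unfolding F_def by (rule dav_cmult[symmetric]) auto
      also have "ennreal ?V * dav ?j F x = (\<integral>\<^sup>+y\<in>Q e. F y \<partial>lebesgue)" by (simp only: Qe vol_dav)
      finally show ?thesis using Qe by blast
    qed (simp add: Q_def)
  next
    show "disjoint_family Q"
      unfolding disjoint_family_on_def
    proof (intro ballI impI)
      fix e e' :: nat assume ne: "e \<noteq> e'"
      show "Q e \<inter> Q e' = {}"
      proof (rule ccontr)
        assume "Q e \<inter> Q e' \<noteq> {}"
        then obtain x where x: "x \<in> Q e" "x \<in> Q e'" by auto
        then have ok: "ok e" "ok e'" by (auto simp: Q_def split: if_splits)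
        obtain n m where nm: "from_nat e = (n :: nat, m :: int^'n)" by (rule prod.exhaust)
        obtain n' m' where nm': "from_nat e' = (n' :: nat, m' :: int^'n)" by (rule prod.exhaust)
        have xx: "x \<in> dcube (j0 + int n) m" "x \<in> dcube (j0 + int n') m'" using x ok by (auto simp: Q_def cb_def nm nm')
        have "x \<in> U n" "x \<in> U n'" using xx ok by (auto simp: ok_def nm nm')
        then have "n = n'" unfolding U_def by (auto intro: linorder_cases[of n n'])
        then have "m = m'" using xx by (simp add: mem_dcube)
        then show False using ok ne \<open>n = n'\<close> by (auto simp: ok_def nm nm')
      qed
    qed
    show "(\<integral>\<^sup>+y. F y \<partial>lebesgue) \<le> ennreal (V0 powr \<kappa> * (1/2)^k)"
    proof -
      have "(\<integral>\<^sup>+y. F y \<partial>lebesgue) = ennreal (1/T k) * (\<integral>\<^sup>+y. ennreal (\<bar>A y\<bar> powr v) \<partial>lebesgue)"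
        unfolding F_def by (rule nn_integral_cmult) auto
      also have "\<dots> \<le> ennreal (1/T k) * ennreal Bv" by (intro mult_left_mono nrm_Bv) auto
      also have "\<dots> = ennreal (1/T k * Bv)" using T_pos[of k] Bv by (intro ennreal_mult[symmetric]) auto
      also have "1/T k * Bv = V0 powr \<kappa> * (1/2)^k"
        using Bv V0 by (simp add: T_def powr_minus power_one_over field_simps)
      finally show ?thesis .
    qed
    show "{x. G x \<noteq> 0} \<subseteq> (\<Union>e. Q e)"
    proof
      fix x assume "x \<in> {x. G x \<noteq> 0}"
      then have "\<exists>n. bad k n x" using suppG by (auto simp: Dk_def)
      then obtain n where n: "bad k n x" "\<forall>l<n. \<not> bad k l x" using exists_least_iff[of "\<lambda>n. bad k n x"] by auto
      define m where "m = cidx (j0 + int n) x"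
      define e where "e = to_nat (n, m)"
      have fe: "from_nat e = (n, m)" by (simp add: e_def)
      have d: "dcube (j0 + int n) m = cube (j0 + int n) x" by (simp add: m_def cube_eq_dcube)
      have "cube (j0 + int n) x \<subseteq> U n"
      proof
        fix y assume y: "y \<in> cube (j0 + int n) x"
        have "bad k l y = bad k l x" if "l \<le> n" for l by (rule bad_cube[OF y that])
        then show "y \<in> U n" using n by (simp add: U_def)
      qed
      then have "ok e" by (simp add: ok_def fe d) (simp add: e_def)
      then have "x \<in> Q e" by (simp add: Q_def cb_def fe d)
      then show "x \<in> (\<Union>e. Q e)" by blast
    qed
  qed (use V0 N GN z e2 in auto)
qed

text \<open>On the lowest set there are no stopping cubes. The splitting lemma is applied to the
  block's own cube alone, with a constant density of total mass V0^\<kappa>, so that the coefficient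
  has the same form as for k > 0.\<close>

lemma level_block_zero:
  assumes G[measurable]: "G \<in> borel_measurable lebesgue" and suppG: "{x. G x \<noteq> 0} \<subseteq> cube j0 x0"
    and GN: "(\<integral>\<^sup>+x. ennreal (\<bar>G x\<bar> powr w) \<partial>lebesgue) \<le> ennreal (N powr w)" and N: "N > 0"
  shows "BS z w (2 * (V0 powr \<kappa>) powr (1 - 1/w) * N) G"
proof (rule BS_content_split)
  define F :: "real^'n \<Rightarrow> ennreal" where "F x = ennreal (V0 powr \<kappa> / V0) * indicator (cube j0 x0) x" for x
  define Q where "Q e = (if e = 0 then cube j0 x0 else {})" for e :: nat
  have IF: "(\<integral>\<^sup>+y\<in>cube j0 x0. F y \<partial>lebesgue) = ennreal (V0 powr \<kappa>)" "(\<integral>\<^sup>+y. F y \<partial>lebesgue) = ennreal (V0 powr \<kappa>)"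
  proof -
    have "ennreal (V0 powr \<kappa> / V0) * emeasure lebesgue (cube j0 x0) = ennreal (V0 powr \<kappa>)"
      unfolding emeasure_cube V0_def[symmetric] using V0 by (simp flip: ennreal_mult)
    then show "(\<integral>\<^sup>+y. F y \<partial>lebesgue) = ennreal (V0 powr \<kappa>)" unfolding F_def by (subst nn_integral_cmult_indicator) auto
    moreover have "(\<integral>\<^sup>+y\<in>cube j0 x0. F y \<partial>lebesgue) = (\<integral>\<^sup>+y. F y \<partial>lebesgue)"
      by (intro nn_integral_cong) (auto simp: F_def indicator_def)
    ultimately show "(\<integral>\<^sup>+y\<in>cube j0 x0. F y \<partial>lebesgue) = ennreal (V0 powr \<kappa>)" by simp
  qed
  show "F \<in> borel_measurable lebesgue" unfolding F_def by measurable
  show "disjoint_family Q" by (auto simp: disjoint_family_on_def Q_def)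
  show "Q e = {} \<or> (\<exists>j x. Q e = cube j x \<and> ennreal (vol TYPE('n) j powr \<kappa>) \<le> (\<integral>\<^sup>+y\<in>Q e. F y \<partial>lebesgue))" for e
  proof (cases "e = 0")
    case True
    then have Qe: "Q e = cube j0 x0" by (simp add: Q_def)
    have "ennreal (vol TYPE('n) j0 powr \<kappa>) \<le> (\<integral>\<^sup>+y\<in>Q e. F y \<partial>lebesgue)"
      unfolding Qe IF(1) V0_def by (rule order_refl)
    then show ?thesis using Qe by blast
  qed (simp add: Q_def)
  show "(\<integral>\<^sup>+y. F y \<partial>lebesgue) \<le> ennreal (V0 powr \<kappa>)" using IF by simp
  show "{x. G x \<noteq> 0} \<subseteq> (\<Union>e. Q e)" using suppG by (auto simp: Q_def)
qed (use V0 N GN z e2 in auto)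

lemma level_block:
  assumes G[measurable]: "G \<in> borel_measurable lebesgue" and suppG: "{x. G x \<noteq> 0} \<subseteq> Ek k"
    and GN: "(\<integral>\<^sup>+x. ennreal (\<bar>G x\<bar> powr w) \<partial>lebesgue) \<le> ennreal (N powr w)" and N: "N > 0"
  shows "BS z w (2 * (V0 powr \<kappa> * (1/2)^k) powr (1 - 1/w) * N) G"
proof (cases "k = 0")
  case True
  then show ?thesis using level_block_zero[OF G _ GN N] suppG by (auto simp: Ek_def)
next
  case False
  then show ?thesis using level_block_pos[OF G _ GN N] suppG by (auto simp: Ek_def)
qed

text \<open>By \<open>e1\<close> all powers of V0 cancel, as scale invariance predicts. Among the
  powers of 2, the content contributes -k(1 - 1/w) and the threshold (k + 1)(1/v - 1/w), which
  leaves a decay of -k(1 - 1/v).\<close>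

lemma coefficient:
  "2 * (V0 powr \<kappa> * (1/2)^k) powr (1 - 1/w) * (C1 * T (Suc k) powr (\<eta>*w/v) * Bv) powr (1/w)
    = 2 * C1 powr (1/w) * 2 powr (\<eta>/v) * (2 powr (- (1 - 1/v))) ^ k"
proof -
  have half: "(1/2::real)^k = 2 powr (- real k)"
  proof -
    have "(1/2::real)^k = (1/2) powr real k" by (rule powr_realpow[symmetric]) simp
    then show ?thesis by (simp add: powr_divide powr_minus_divide)
  qed
  have Tk: "T (Suc k) = 2 powr (real k + 1) * V0 powr (1 - v/u - \<kappa>)"
  proof -
    have "(2::real) ^ Suc k = 2 powr (real k + 1)" by (simp add: powr_add powr_realpow)
    moreover have "V0 powr (1 - v/u) * V0 powr (-\<kappa>) = V0 powr (1 - v/u - \<kappa>)"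
      by (subst powr_add[symmetric]) simp
    ultimately show ?thesis unfolding T_def Bv_def by (simp only:)
  qed
  have ex: "\<eta>*w/v * (1/w) = \<eta>/v" using w by simp
  have "(V0 powr \<kappa> * (1/2)^k) powr (1 - 1/w) = V0 powr (\<kappa> * (1 - 1/w)) * 2 powr (- real k * (1 - 1/w))"
    unfolding half by (simp only: powr_mult powr_powr powr_ge_zero)
  moreover have "(C1 * T (Suc k) powr (\<eta>*w/v) * Bv) powr (1/w) = C1 powr (1/w) * (2 powr ((real k + 1) * (\<eta>/v)) * V0 powr ((1 - v/u - \<kappa>) * (\<eta>/v))) * V0 powr ((1 - v/u) * (1/w))"
    unfolding Tk Bv_def using C1_pos V0 by (simp only: powr_mult powr_powr ex mult.assoc)
  ultimately have "2 * (V0 powr \<kappa> * (1/2)^k) powr (1 - 1/w) * (C1 * T (Suc k) powr (\<eta>*w/v) * Bv) powr (1/w)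
    = 2 * C1 powr (1/w) * (2 powr (- real k * (1 - 1/w)) * 2 powr ((real k + 1) * (\<eta>/v))) * (V0 powr (\<kappa> * (1 - 1/w)) * V0 powr ((1 - v/u - \<kappa>) * (\<eta>/v)) * V0 powr ((1 - v/u) * (1/w)))"
    by (simp only: mult_ac)
  also have "V0 powr (\<kappa> * (1 - 1/w)) * V0 powr ((1 - v/u - \<kappa>) * (\<eta>/v)) * V0 powr ((1 - v/u) * (1/w)) = 1"
  proof -
    have "(1 - v/u) * (1/v) = 1/v - 1/u" using v u by (simp add: field_simps)
    moreover have "\<kappa> * (1 - 1/w) + (1 - v/u - \<kappa>) * (\<eta>/v) + (1 - v/u) * (1/w) = \<kappa> * (1 - 1/v) + (1 - v/u) * (1/v)"
      unfolding \<eta>(4) by (simp only: ring_distribs)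
    ultimately have "\<kappa> * (1 - 1/w) + (1 - v/u - \<kappa>) * (\<eta>/v) + (1 - v/u) * (1/w) = 0" using e1 by simp
    then show ?thesis using V0 by (simp only: powr_add[symmetric]) simp
  qed
  also have "2 powr (- real k * (1 - 1/w)) * 2 powr ((real k + 1) * (\<eta>/v)) = 2 powr (\<eta>/v) * (2::real) powr (real k * (- (1 - 1/v)))"
    unfolding \<eta>(4) by (simp only: powr_add[symmetric]) (simp add: algebra_simps)
  also have "(2::real) powr (real k * (- (1 - 1/v))) = (2 powr (- (1 - 1/v))) ^ k"
  proof -
    have "(2 powr (- (1 - 1/v))) ^ k = (2 powr (- (1 - 1/v))) powr real k" by (rule powr_realpow[symmetric]) simp
    then show ?thesis by (simp only: powr_powr mult.commute)
  qed
  finally show ?thesis by (simp only: mult_ac mult_1_right)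
qed

lemma local_part:
  shows "AE x in lebesgue. x \<in> cube j0 x0 \<longrightarrow> summable (\<lambda>i. h (j0 + int i) x)"
    and "BS z w (2 * C1 powr (1/w) * 2 powr (\<eta>/v) * (1 / (1 - 2 powr (- (1 - 1/v))))) (\<lambda>x. Sinf x * indicator (cube j0 x0) x)"
proof -
  let ?b = "\<lambda>k. C1 * T (Suc k) powr (\<eta>*w/v) * Bv"
  have Esub: "Ek k \<subseteq> cube j0 x0" for k using Dk_sub by (auto simp: Ek_def)
  have est: "(\<integral>\<^sup>+x\<in>Ek k. ennreal (S N x powr w) \<partial>lebesgue) \<le> ennreal (?b k)" for k N
    by (rule local_estimate[OF Ek_sets Esub T_pos Ek_stop])
  have b: "?b k > 0" for k using C1_pos T_pos[of "Suc k"] Bv by simp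
  have "AE x in lebesgue. \<forall>k. x \<in> Ek k \<longrightarrow> summable (\<lambda>i. h (j0 + int i) x)"
    unfolding AE_all_countable using local_limit(1)[OF Ek_sets est] by blast
  then show "AE x in lebesgue. x \<in> cube j0 x0 \<longrightarrow> summable (\<lambda>i. h (j0 + int i) x)"
    using Ek_cover by eventually_elim blast
  define G where "G k x = Sinf x * indicator (Ek k) x" for k x
  define c where "c k = 2 * C1 powr (1/w) * 2 powr (\<eta>/v) * (2 powr (- (1 - 1/v))) ^ k" for k
  have blk: "BS z w (c k) (G k)" for k
  proof -
    have "BS z w (2 * (V0 powr \<kappa> * (1/2)^k) powr (1 - 1/w) * (?b k) powr (1/w)) (G k)"
    proof (rule level_block)
      show "G k \<in> borel_measurable lebesgue" unfolding G_def by measurable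
      show "{x. G k x \<noteq> 0} \<subseteq> Ek k" by (auto simp: G_def indicator_def)
      have "(\<integral>\<^sup>+x. ennreal (\<bar>G k x\<bar> powr w) \<partial>lebesgue) = (\<integral>\<^sup>+x\<in>Ek k. ennreal (\<bar>Sinf x\<bar> powr w) \<partial>lebesgue)"
        by (intro nn_integral_cong) (auto simp: G_def indicator_def)
      also have "\<dots> \<le> ennreal (?b k)" by (rule local_limit(2)[OF Ek_sets est])
      also have "?b k = (?b k powr (1/w)) powr w" using w b[of k] by (simp add: powr_powr)
      finally show "(\<integral>\<^sup>+x. ennreal (\<bar>G k x\<bar> powr w) \<partial>lebesgue) \<le> ennreal ((?b k powr (1/w)) powr w)" .
      show "?b k powr (1/w) > 0" by (subst powr_gt_zero) (use b[of k] in linarith)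
    qed
    then show ?thesis unfolding coefficient c_def .
  qed
  have q: "2 powr (- (1 - 1/v)) < (1::real)" using v by (simp add: powr_less_one)
  have c: "c sums (2 * C1 powr (1/w) * 2 powr (\<eta>/v) * (1 / (1 - 2 powr (- (1 - 1/v)))))"
    unfolding c_def by (intro sums_mult geometric_sums) (use q in simp)
  have "AE x in lebesgue. (\<lambda>k. G k x) sums (Sinf x * indicator (cube j0 x0) x)"
    using Ek_cover
  proof eventually_elim
    case (elim x)
    show ?case
    proof (cases "x \<in> cube j0 x0")
      case True
      then obtain k where k: "x \<in> Ek k" using elim by blast
      have "(\<lambda>l. G l x) = (\<lambda>l. if l = k then Sinf x else 0)"
        using k Ek_disjoint by (auto simp: fun_eq_iff G_def indicator_def disjoint_family_on_def)
      then show ?thesis using sums_single[of k "\<lambda>_. Sinf x"] True by simp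
    next
      case False
      then have "G l x = 0" for l using Esub by (auto simp: G_def indicator_def)
      then show ?thesis using False by simp
    qed
  qed
  then have "BS z w (\<Sum>k. c k) (\<lambda>x. Sinf x * indicator (cube j0 x0) x)"
    using c z by (intro BS_suminf[OF blk]) (auto simp: sums_iff)
  then show "BS z w (2 * C1 powr (1/w) * 2 powr (\<eta>/v) * (1 / (1 - 2 powr (- (1 - 1/v))))) (\<lambda>x. Sinf x * indicator (cube j0 x0) x)"
    using c by (simp add: sums_iff)
qed

end

section \<open>Levels coarser than the block, and the sum over all levels\<close>

context adams begin

text \<open>The gain at coarse levels. Over a cube of volume V containing the block, the L^s average
  of the block is smaller than V^(-1/u) by the factor (V0/V)^\<delta>, up to a constant, and s < u
  makes this a decay; \<open>qc\<close> is the gain per level.\<close>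

definition \<delta> :: real where "\<delta> = 1/s - 1/u"
definition qc :: real where "qc = 2 powr (- real CARD('n) * \<delta>)"
definition Cc :: real where "Cc = 2 powr (1/w) * Kh * 2 powr (1/s)"
definition Cl :: real where "Cl = 2 * C1 powr (1/w) * 2 powr (\<eta>/v) * (1 / (1 - 2 powr (- (1 - 1/v))))"
definition Ctot :: real where "Ctot = Cl + Cc * (1 / (1 - qc))"

lemma \<delta>: "\<delta> > 0" unfolding \<delta>_def using s u by (simp add: field_simps)
lemma qc: "0 < qc" "qc < 1" unfolding qc_def using \<delta> by (simp_all add: powr_less_one)
lemma Cc: "Cc > 0" unfolding Cc_def using Kh by simp

lemma Cl: "Cl > 0"
proof -
  have "2 powr (- (1 - 1/v)) < (1::real)" using v by (simp add: powr_less_one)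
  moreover have "C1 powr (1/w) > 0" using C1_pos by simp
  ultimately show ?thesis unfolding Cl_def by (intro mult_pos_pos divide_pos_pos) auto
qed

lemma Ctot: "Ctot > 0" unfolding Ctot_def using Cl Cc qc by (intro add_pos_pos mult_pos_pos divide_pos_pos) auto

end

context adams_block begin

text \<open>\<open>H\<close> bounds \<open>h j\<close> on a cube by the average of A there, which is
  zero on cubes that miss the support. The choice l = j serves the coarse levels, l = j0 the fine
  ones.\<close>

lemma h_outside:
  assumes l: "l \<le> j" "l \<le> j0"
  shows "AE x in lebesgue. x \<notin> cube l x0 \<longrightarrow> h j x = 0"
proof -
  define f where "f x = ennreal (h j x powr t) * indicator (- cube l x0) x" for x
  have [measurable]: "f \<in> borel_measurable lebesgue" unfolding f_def by measurable
  have z: "dav j f x = 0" for x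
  proof (cases "x \<in> cube l x0")
    case True
    have "cube j x \<subseteq> cube l x0" using cube_mono[OF l(1), of x] cube_eq[OF True] by simp
    then have "dav j f x = dav j (\<lambda>_. 0) x" by (intro dav_cong) (auto simp: f_def)
    then show ?thesis by simp
  next
    case False
    have "A y = 0" if "y \<in> cube j x" for y
    proof (rule ccontr)
      assume "A y \<noteq> 0"
      then have "y \<in> cube l x0" using supp cube_mono[OF l(2), of x0] by auto
      moreover have "y \<in> cube l x" using that cube_mono[OF l(1), of x] by auto
      ultimately show False using False by (simp add: mem_cube)
    qed
    then have "dav j (\<lambda>y. ennreal (\<bar>A y\<bar> powr s)) x = dav j (\<lambda>_. 0) x" by (intro dav_cong) simp
    then have "aA j x = 0" by (simp add: aA_def)
    then have "dav j (\<lambda>y. ennreal (h j y powr t)) x \<le> 0" using H'[of j x] by simp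
    moreover have "dav j f x \<le> dav j (\<lambda>y. ennreal (h j y powr t)) x" by (intro dav_mono) (auto simp: f_def indicator_def)
    ultimately show ?thesis by (metis le_zero_eq order_trans)
  qed
  have "(\<integral>\<^sup>+x. f x \<partial>lebesgue) = 0"
    using nn_integral_dav[of f j] z by simp
  then have "AE x in lebesgue. f x = 0" by (subst (asm) nn_integral_0_iff_AE) auto
  then show ?thesis
  proof eventually_elim
    case (elim x)
    then show ?case using h0[of j x] by (auto simp: f_def indicator_def ennreal_eq_0_iff split: if_splits)
  qed
qed

lemma coarse_aA:
  assumes "j \<le> j0"
  shows "aA j x0 \<le> (2 * V0 powr (1 - s/u) / vol TYPE('n) j) powr (1/s)"
proof -
  let ?f = "\<lambda>y. ennreal (\<bar>A y\<bar> powr s)" and ?V = "vol TYPE('n) j"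
  have "ennreal ?V * dav j ?f x0 = (\<integral>\<^sup>+y\<in>cube j x0. ?f y \<partial>lebesgue)" by (simp only: vol_dav)
  also have "\<dots> = (\<integral>\<^sup>+y\<in>cube j0 x0. ?f y \<partial>lebesgue)"
    using supp cube_mono[OF assms, of x0] by (intro nn_integral_cong) (auto simp: indicator_def)
  also have "\<dots> = ennreal V0 * dav j0 ?f x0" by (simp only: vol_dav V0_def)
  also have "\<dots> \<le> ennreal V0 * ennreal (2 * V0 powr (-s/u))"
    unfolding V0_def using s u by (intro mult_left_mono block_dav_bound[OF blk]) auto
  also have "\<dots> = ennreal (V0 * (2 * V0 powr (-s/u)))" using V0 by (intro ennreal_mult[symmetric]) auto
  also have "V0 * (2 * V0 powr (-s/u)) = 2 * V0 powr (1 - s/u)"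
  proof -
    have "V0 powr 1 * V0 powr (-s/u) = V0 powr (1 - s/u)" by (subst powr_add[symmetric]) simp
    then show ?thesis using V0 by simp
  qed
  finally have "ennreal ?V * ennreal (enn2real (dav j ?f x0)) \<le> ennreal (2 * V0 powr (1 - s/u))"
    using dav_s_fin[of j x0] by simp
  then have "?V * enn2real (dav j ?f x0) \<le> 2 * V0 powr (1 - s/u)"
    by (subst (asm) ennreal_mult[symmetric]) (auto simp: ennreal_le_iff)
  then have "enn2real (dav j ?f x0) \<le> 2 * V0 powr (1 - s/u) / ?V" by (subst pos_le_divide_eq) (auto simp: mult.commute)
  then show ?thesis unfolding aA_def using s by (intro powr_mono2) auto
qed

text \<open>At such a level the only relevant cube is the one around x0, so one block suffices.
  Jensen lowers the exponent from t to w, and \<open>e3\<close> turns V^(\<alpha>/n) V^(-1/s) into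
  the block normalisation V^(-1/z) times V^(-\<delta>).\<close>

lemma coarse_part:
  fixes n :: nat
  defines "j \<equiv> j0 - 1 - int n"
  shows "BS z w (Cc * qc ^ n) (\<lambda>x. h j x * indicator (cube j x0) x)"
proof -
  define V where "V = vol TYPE('n) j"
  have V: "V > 0" by (simp add: V_def)
  define X where "X = Kh * 2 powr (- real_of_int j * \<alpha>) * aA j x0"
  have X: "X \<ge> 0" unfolding X_def using Kh aA0 by simp
  define c where "c = Cc * (V0 / V) powr \<delta>"
  have c: "c \<ge> 0" using Cc by (simp add: c_def)
  have htw: "(h j y powr w) powr (t/w) = h j y powr t" for y using w by (simp add: powr_powr)
  have fin: "dav j (\<lambda>y. ennreal (h j y powr t)) x0 < \<infinity>" using H'[of j x0] by (rule le_less_trans) simp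
  have fin': "dav j (\<lambda>y. ennreal (h j y powr w)) x0 < \<infinity>"
    by (rule dav_jensen(1)[of _ "t/w"]) (use w wt fin htw in auto)
  have "ennreal (enn2real (dav j (\<lambda>y. ennreal (h j y powr w)) x0) powr (t/w)) \<le> ennreal (2 powr (t/w)) * dav j (\<lambda>y. ennreal ((h j y powr w) powr (t/w))) x0"
    by (rule dav_jensen(2)) (use w wt fin htw in auto)
  also have "\<dots> \<le> ennreal (2 powr (t/w)) * ennreal (X powr t)"
    unfolding htw X_def by (intro mult_left_mono H') simp
  also have "\<dots> = ennreal (2 powr (t/w) * X powr t)" by (intro ennreal_mult[symmetric]) auto
  finally have "enn2real (dav j (\<lambda>y. ennreal (h j y powr w)) x0) powr (t/w) \<le> 2 powr (t/w) * X powr t"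
    by (subst (asm) ennreal_le_iff) auto
  then have "(enn2real (dav j (\<lambda>y. ennreal (h j y powr w)) x0) powr (t/w)) powr (w/t) \<le> (2 powr (t/w) * X powr t) powr (w/t)"
    using w t by (intro powr_mono2) auto
  also have "(2 powr (t/w) * X powr t) powr (w/t) = 2 * X powr w"
    using w t X by (simp add: powr_mult powr_powr)
  also have "(enn2real (dav j (\<lambda>y. ennreal (h j y powr w)) x0) powr (t/w)) powr (w/t) = enn2real (dav j (\<lambda>y. ennreal (h j y powr w)) x0)"
    using w t by (simp add: powr_powr)
  finally have dw: "dav j (\<lambda>y. ennreal (h j y powr w)) x0 \<le> ennreal (2 * X powr w)"
    by (rule ennreal_le_enn2real[OF fin'])
  have Xle: "X \<le> Kh * 2 powr (1/s) * (V0/V) powr \<delta> * V powr (-1/z)"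
  proof -
    have "2 powr (- real_of_int j * \<alpha>) = V powr (\<alpha> / real CARD('n))"
    proof -
      have "- real_of_int j * real CARD('n) * (\<alpha> / real CARD('n)) = - real_of_int j * \<alpha>" by simp
      then show ?thesis unfolding V_def by (simp only: powr_powr)
    qed
    moreover have "aA j x0 \<le> 2 powr (1/s) * V0 powr (1/s - 1/u) * V powr (-1/s)"
    proof -
      have "aA j x0 \<le> (2 * V0 powr (1 - s/u) / V) powr (1/s)" unfolding V_def by (rule coarse_aA) (simp add: j_def)
      also have "\<dots> = (2 * V0 powr (1 - s/u) * V powr (-1)) powr (1/s)"
        using V by (simp add: powr_neg_one)
      also have "\<dots> = 2 powr (1/s) * V0 powr ((1 - s/u) * (1/s)) * V powr (-1 * (1/s))"
        by (simp only: powr_mult powr_powr)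
      also have "(1 - s/u) * (1/s) = 1/s - 1/u" using s u by (simp add: field_simps)
      finally show ?thesis by simp
    qed
    ultimately have "X \<le> Kh * V powr (\<alpha> / real CARD('n)) * (2 powr (1/s) * V0 powr (1/s - 1/u) * V powr (-1/s))"
      unfolding X_def using Kh by (metis mult_left_mono mult_nonneg_nonneg less_imp_le powr_ge_zero)
    also have "\<dots> = Kh * 2 powr (1/s) * V0 powr \<delta> * (V powr (\<alpha> / real CARD('n)) * V powr (-1/s))"
      by (simp only: \<delta>_def mult_ac)
    also have "V powr (\<alpha> / real CARD('n)) * V powr (-1/s) = V powr (-\<delta>) * V powr (-1/z)"
    proof -
      have "\<alpha> / real CARD('n) + -1/s = -\<delta> + -1/z" unfolding \<delta>_def using e3 by simp
      then show ?thesis by (simp only: powr_add[symmetric])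
    qed
    also have "Kh * 2 powr (1/s) * V0 powr \<delta> * (V powr (-\<delta>) * V powr (-1/z)) = Kh * 2 powr (1/s) * (V0/V) powr \<delta> * V powr (-1/z)"
      using V V0 by (simp add: powr_divide powr_minus_divide)
    finally show ?thesis .
  qed
  have Vw: "V * (V powr (-1/z)) powr w = (V powr (1/w - 1/z)) powr w"
  proof -
    have "V powr 1 * (V powr (-1/z)) powr w = V powr (1 + (-1/z) * w)" by (simp only: powr_powr powr_add)
    moreover have "1 + (-1/z) * w = (1/w - 1/z) * w" using w by (simp add: left_diff_distrib)
    ultimately show ?thesis using V by (simp only: powr_powr powr_one)
  qed
  have "BS z w c (\<lambda>x. h j x * indicator (cube j x0) x)"
  proof (rule BS_single)
    show "{x. h j x * indicator (cube j x0) x \<noteq> 0} \<subseteq> cube j x0" by (auto simp: indicator_def)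
    have "(\<integral>\<^sup>+x. ennreal (\<bar>h j x * indicator (cube j x0) x\<bar> powr w) \<partial>lebesgue) = (\<integral>\<^sup>+x\<in>cube j x0. ennreal (h j x powr w) \<partial>lebesgue)"
      using h0 by (intro nn_integral_cong) (auto simp: indicator_def)
    also have "\<dots> = ennreal V * dav j (\<lambda>x. ennreal (h j x powr w)) x0" by (simp only: vol_dav V_def)
    also have "\<dots> \<le> ennreal V * ennreal (2 * X powr w)" by (intro mult_left_mono dw) simp
    also have "\<dots> = ennreal (V * (2 * X powr w))" using V by (intro ennreal_mult[symmetric]) auto
    also have "\<dots> \<le> ennreal ((c * V powr (1/w - 1/z)) powr w)"
    proof (rule ennreal_leI)
      have "X powr w \<le> (Kh * 2 powr (1/s) * (V0/V) powr \<delta> * V powr (-1/z)) powr w"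
        using Xle X w by (intro powr_mono2) auto
      then have "V * (2 * X powr w) \<le> V * (2 * (Kh * 2 powr (1/s) * (V0/V) powr \<delta> * V powr (-1/z)) powr w)"
        using V by (intro mult_left_mono) auto
      also have "\<dots> = 2 * (Kh * 2 powr (1/s) * (V0/V) powr \<delta>) powr w * (V * (V powr (-1/z)) powr w)"
        using Kh V V0 by (simp add: powr_mult mult_ac)
      also have "\<dots> = (2 powr (1/w)) powr w * (Kh * 2 powr (1/s) * (V0/V) powr \<delta>) powr w * (V powr (1/w - 1/z)) powr w"
        unfolding Vw using w by (simp add: powr_powr)
      also have "\<dots> = (c * V powr (1/w - 1/z)) powr w"
        unfolding c_def Cc_def by (simp only: powr_mult[symmetric] mult_ac)
      finally show "V * (2 * X powr w) \<le> (c * V powr (1/w - 1/z)) powr w" .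
    qed
    finally show "(\<integral>\<^sup>+x. ennreal (\<bar>h j x * indicator (cube j x0) x\<bar> powr w) \<partial>lebesgue) \<le> ennreal ((c * vol TYPE('n) j powr (1/w - 1/z)) powr w)"
      by (simp only: V_def)
  qed (use w c in auto)
  moreover have "c \<le> Cc * qc ^ n"
  proof -
    have "V0 / V = 2 powr (- real CARD('n) * (1 + real n))"
      unfolding V0_def V_def j_def by (simp add: powr_diff[symmetric] algebra_simps)
    then have "(V0 / V) powr \<delta> = 2 powr (- real CARD('n) * (1 + real n) * \<delta>)" by (simp only: powr_powr)
    also have "- real CARD('n) * (1 + real n) * \<delta> = (- real CARD('n) * \<delta>) * real (Suc n)" by simp
    also have "2 powr ((- real CARD('n) * \<delta>) * real (Suc n)) = qc powr real (Suc n)" by (simp only: qc_def powr_powr)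
    also have "qc powr real (Suc n) = qc ^ Suc n" by (rule powr_realpow[OF qc(1)])
    also have "\<dots> \<le> qc ^ n" using qc by (simp add: mult_left_le_one_le)
    finally show ?thesis unfolding c_def using Cc by (intro mult_left_mono) auto
  qed
  ultimately show ?thesis by (rule BS_mono)
qed

theorem block_image:
  "\<exists>G. BS z w Ctot G \<and> (\<forall>x. G x \<ge> 0) \<and> (AE x in lebesgue. (\<integral>\<^sup>+j. ennreal (h j x) \<partial>count_space UNIV) \<le> ennreal (G x))"
proof -
  \<comment> \<open>Entry 0 collects all levels from j0 on, entry \<open>Suc n\<close> is the coarse
    level j0 - 1 - n; a single sequence lets \<open>BS_suminf\<close> add everything.\<close>
  define sq where "sq i x = (case i of 0 \<Rightarrow> Sinf x * indicator (cube j0 x0) x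
      | Suc n \<Rightarrow> h (j0 - 1 - int n) x * indicator (cube (j0 - 1 - int n) x0) x)" for i x
  define c where "c i = (case i of 0 \<Rightarrow> Cl | Suc n \<Rightarrow> Cc * qc ^ n)" for i
  have blkS: "BS z w (c i) (sq i)" for i
  proof (cases i)
    case 0
    have "sq 0 = (\<lambda>x. Sinf x * indicator (cube j0 x0) x)" "c 0 = Cl" by (simp_all add: sq_def c_def fun_eq_iff)
    then show ?thesis using local_part(2)[folded Cl_def] 0 by simp
  next
    case (Suc n)
    have "sq (Suc n) = (\<lambda>x. h (j0 - 1 - int n) x * indicator (cube (j0 - 1 - int n) x0) x)" "c (Suc n) = Cc * qc ^ n"
      by (simp_all add: sq_def c_def fun_eq_iff)
    then show ?thesis using coarse_part[of n] Suc by simp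
  qed
  have "(\<lambda>n. c (Suc n)) sums (Cc * (1 / (1 - qc)))"
    unfolding c_def nat.case using qc by (intro sums_mult geometric_sums) simp
  then have "c sums (Cc * (1 / (1 - qc)) + c 0)" by (rule sums_Suc)
  then have c: "c sums Ctot" unfolding Ctot_def c_def by (simp add: add.commute)
  have z1: "1 \<le> z" using z by simp
  have sm: "AE x in lebesgue. summable (\<lambda>i. \<bar>sq i x\<bar>)"
    by (rule BS_suminf_AE[OF blkS z1 z(2) sums_summable[OF c]])
  define G where "G x = (\<Sum>i. sq i x)" for x
  have "BS z w (\<Sum>i. c i) G"
    by (rule BS_suminf[OF blkS z1 z(2) sums_summable[OF c]])
       (use sm in \<open>eventually_elim, auto simp: G_def intro!: summable_sums dest: summable_rabs_cancel\<close>)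
  then have BG: "BS z w Ctot G" using sums_unique[OF c] by simp
  \<comment> \<open>The sum defining G has no controlled sign where it diverges; the absolute value
    makes the majorant nonnegative at every point.\<close>
  then have Babs: "BS z w (1 * Ctot) (\<lambda>x. \<bar>G x\<bar>)"
    by (rule BS_dominated) (use BS_measurable[OF BG] w in auto)
  have out: "AE x in lebesgue. \<forall>n. (x \<notin> cube (j0 - 1 - int n) x0 \<longrightarrow> h (j0 - 1 - int n) x = 0)"
    unfolding AE_all_countable using h_outside by auto
  have out0: "AE x in lebesgue. \<forall>n. (x \<notin> cube j0 x0 \<longrightarrow> h (j0 + int n) x = 0)"
    unfolding AE_all_countable using h_outside by auto
  have "AE x in lebesgue. (\<integral>\<^sup>+j. ennreal (h j x) \<partial>count_space UNIV) \<le> ennreal \<bar>G x\<bar>"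
    using out out0 sm local_part(1)
  proof eventually_elim
    case (elim x)
    have h1: "(\<Sum>n. ennreal (h (j0 + int n) x)) = ennreal (sq 0 x)" and nn: "sq 0 x \<ge> 0"
    proof -
      have "(\<Sum>n. ennreal (h (j0 + int n) x)) = ennreal (sq 0 x) \<and> sq 0 x \<ge> 0"
      proof (cases "x \<in> cube j0 x0")
        case True
        then have s: "summable (\<lambda>n. h (j0 + int n) x)" using elim by blast
        show ?thesis using suminf_ennreal2[OF h0 s] suminf_nonneg[OF s h0] True by (simp add: sq_def Sinf_def)
      next
        case False
        then have "h (j0 + int n) x = 0" for n using elim by blast
        then show ?thesis using False by (simp add: sq_def)
      qed
      then show "(\<Sum>n. ennreal (h (j0 + int n) x)) = ennreal (sq 0 x)" "sq 0 x \<ge> 0" by auto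
    qed
    have hs: "h (j0 - 1 - int n) x = sq (Suc n) x" for n
      using elim(1) by (cases "x \<in> cube (j0 - 1 - int n) x0") (auto simp: sq_def)
    have sm': "summable (\<lambda>i. sq i x)" using elim(3) by (rule summable_rabs_cancel)
    then have smS: "summable (\<lambda>n. sq (Suc n) x)" using summable_Suc_iff[of "\<lambda>i. sq i x"] by simp
    have nnS: "sq (Suc n) x \<ge> 0" for n unfolding hs[symmetric] by (rule h0)
    have "(\<integral>\<^sup>+j. ennreal (h j x) \<partial>count_space UNIV) = ennreal (sq 0 x) + (\<Sum>n. ennreal (sq (Suc n) x))"
      unfolding nn_integral_count_space_int[of _ j0] h1 hs ..
    also have "(\<Sum>n. ennreal (sq (Suc n) x)) = ennreal (\<Sum>n. sq (Suc n) x)"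
      by (rule suminf_ennreal2[OF nnS smS])
    also have "ennreal (sq 0 x) + \<dots> = ennreal (sq 0 x + (\<Sum>n. sq (Suc n) x))"
      using nn suminf_nonneg[OF smS nnS] by (rule ennreal_plus[symmetric])
    also have "sq 0 x + (\<Sum>n. sq (Suc n) x) = G x"
      unfolding G_def using suminf_split_head[OF sm'] by simp
    also have "ennreal (G x) \<le> ennreal \<bar>G x\<bar>" by (intro ennreal_leI) simp
    finally show ?case .
  qed
  then show ?thesis using Babs by (intro exI[of _ "\<lambda>x. \<bar>G x\<bar>"]) simp
qed

end

lemma exists_adams_block:
  fixes A :: "real^'n::finite \<Rightarrow> real"
  assumes "adams TYPE('n) \<alpha> u v z w \<kappa> s t Kh" and A: "is_block u v A"
    and "\<And>j. h j \<in> borel_measurable lebesgue" "\<And>j x. h j x \<ge> 0"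
    and "\<And>j x. dav j (\<lambda>y. ennreal (h j y powr t)) x \<le>
      ennreal ((Kh * 2 powr (- real_of_int j * \<alpha>) * enn2real (dav j (\<lambda>y. ennreal (\<bar>A y\<bar> powr s)) x) powr (1/s)) powr t)"
  shows "\<exists>j0 x0. adams_block \<alpha> u v z w \<kappa> s t Kh A j0 x0 h"
proof -
  interpret adams "TYPE('n)" \<alpha> u v z w \<kappa> s t Kh by fact
  have v0: "v > 0" using v by simp
  obtain j0 x0 where "{x. A x \<noteq> 0} \<subseteq> cube j0 x0"
     "(\<integral>\<^sup>+x. ennreal (\<bar>A x\<bar> powr v) \<partial>lebesgue) \<le> ennreal (vol TYPE('n) j0 powr (1 - v/u))"
    using A unfolding is_block_iff[OF v0] by blast
  then have "adams_block \<alpha> u v z w \<kappa> s t Kh A j0 x0 h"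
    by unfold_locales (use A assms(3-5) in auto)
  then show ?thesis by blast
qed

section \<open>The positive majorant\<close>

text \<open>The summand 1 lets one weight serve both operators. It makes weighted averages dominate
  plain ones, and since A + B \<le> (1 + A)(1 + B), the difference of \<open>a\<close> at two points
  of a cube is at most the product of the two weights.\<close>

definition osc_weight :: "(real^'n::finite \<Rightarrow> real) \<Rightarrow> int \<Rightarrow> real^'n \<Rightarrow> real" where
  "osc_weight a j x = 1 + \<bar>a x - rav j a x\<bar>"

text \<open>Positive majorant of the level \<open>j\<close> parts of both the dyadic fractional integral and the commutator.\<close>

definition Lop :: "(real^'n::finite \<Rightarrow> real) \<Rightarrow> real \<Rightarrow> int \<Rightarrow> (real^'n \<Rightarrow> real) \<Rightarrow> real^'n \<Rightarrow> ennreal" where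
  "Lop a \<alpha> j f x = ennreal (2 powr (- real_of_int j * \<alpha>) * osc_weight a j x) * dav j (\<lambda>y. ennreal (osc_weight a j y * \<bar>f y\<bar>)) x"

lemma osc_weight_ge1: "osc_weight a j x \<ge> 1" by (simp add: osc_weight_def)

lemma adams_Kh: "adams TYPE('n::finite) \<alpha> u v z w \<kappa> s t Kh \<Longrightarrow> Kh' > 0 \<Longrightarrow> adams TYPE('n) \<alpha> u v z w \<kappa> s t Kh'"
  by (simp add: adams_def)

context bmo begin

lemma osc_weight_measurable [measurable]: "osc_weight a j \<in> borel_measurable lebesgue"
  unfolding osc_weight_def by measurable

lemma osc_weight_moment:
  assumes "t > 1"
  shows "\<exists>B>0. \<forall>j x. dav j (\<lambda>y. ennreal (osc_weight a j y powr t)) x \<le> ennreal B"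
proof -
  obtain C where C: "C > 0" "\<And>j x. dav j (\<lambda>y. ennreal (\<bar>a y - rav j a y\<bar> powr t)) x \<le> ennreal C"
    using john_nirenberg[of t] assms by auto
  show ?thesis
  proof (intro exI[of _ "2 powr t * (1 + C)"] conjI allI)
    show "2 powr t * (1 + C) > 0" using C by simp
    fix j x
    have "dav j (\<lambda>y. ennreal (osc_weight a j y powr t)) x \<le> dav j (\<lambda>y. ennreal (2 powr t) * (1 + ennreal (\<bar>a y - rav j a y\<bar> powr t))) x"
    proof (rule dav_mono)
      fix y
      let ?r = "\<bar>a y - rav j a y\<bar>"
      have "1 + ?r \<le> 2 * max 1 ?r" by (cases "?r \<le> 1") (auto simp: max_def)
      then have "osc_weight a j y powr t \<le> (2 * max 1 ?r) powr t"
        unfolding osc_weight_def using assms by (intro powr_mono2) auto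
      also have "\<dots> = 2 powr t * (max 1 ?r) powr t" by (simp add: powr_mult)
      also have "\<dots> \<le> 2 powr t * (1 + ?r powr t)" by (intro mult_left_mono) (auto simp: max_def)
      finally have "ennreal (osc_weight a j y powr t) \<le> ennreal (2 powr t * (1 + ?r powr t))" by (rule ennreal_leI)
      also have "\<dots> = ennreal (2 powr t) * (1 + ennreal (?r powr t))" by (simp add: ennreal_mult)
      finally show "ennreal (osc_weight a j y powr t) \<le> ennreal (2 powr t) * (1 + ennreal (?r powr t))" .
    qed
    also have "\<dots> = ennreal (2 powr t) * dav j (\<lambda>y. 1 + ennreal (\<bar>a y - rav j a y\<bar> powr t)) x"
      by (rule dav_cmult) measurable
    also have "dav j (\<lambda>y. 1 + ennreal (\<bar>a y - rav j a y\<bar> powr t)) x = 1 + dav j (\<lambda>y. ennreal (\<bar>a y - rav j a y\<bar> powr t)) x"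
      by (subst dav_add) auto
    also have "ennreal (2 powr t) * \<dots> \<le> ennreal (2 powr t) * (1 + ennreal C)"
      by (intro mult_left_mono add_mono C order_refl) auto
    also have "\<dots> = ennreal (2 powr t * (1 + C))" using C by (simp add: ennreal_mult)
    finally show "dav j (\<lambda>y. ennreal (osc_weight a j y powr t)) x \<le> ennreal (2 powr t * (1 + C))" .
  qed
qed

lemma weighted_dav:
  assumes st: "s > 1" "t > 1" "1/s + 1/t = 1"
    and B: "B > 0" "\<And>j x. dav j (\<lambda>y. ennreal (osc_weight a j y powr t)) x \<le> ennreal B"
    and f[measurable]: "f \<in> borel_measurable lebesgue" and fin: "dav j (\<lambda>y. ennreal (\<bar>f y\<bar> powr s)) x < \<infinity>"
  shows "dav j (\<lambda>y. ennreal (osc_weight a j y * \<bar>f y\<bar>)) x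
      \<le> ennreal (2 * B powr (1/t) * enn2real (dav j (\<lambda>y. ennreal (\<bar>f y\<bar> powr s)) x) powr (1/s))"
proof (rule dav_holder[where p = t and q = s])
  show "dav j (\<lambda>y. ennreal (osc_weight a j y powr t)) x \<le> ennreal ((B powr (1/t)) powr t)"
    using B st by (simp add: powr_powr)
  show "dav j (\<lambda>y. ennreal (\<bar>f y\<bar> powr s)) x \<le> ennreal ((enn2real (dav j (\<lambda>y. ennreal (\<bar>f y\<bar> powr s)) x) powr (1/s)) powr s)"
    using st fin by (simp add: powr_powr)
  show "0 \<le> osc_weight a j y" for y using osc_weight_ge1[of a j y] by simp
qed (use st in auto)

text \<open>A level of the majorant carries a weight outside the average, which sits in L^t, and one
  inside, which Hoelder's inequality trades for the L^s average of the block. This verifies the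
  hypothesis \<open>H\<close> of \<open>adams_block\<close>. The second claim keeps the inner
  estimate for later control of coarse boundary terms.\<close>

lemma Lop_block:
  assumes ad: "adams TYPE('n) \<alpha> u v z w \<kappa> s t 1"
  shows "\<exists>C>0. \<forall>A. is_block u v A \<longrightarrow> (\<exists>G. BS z w C G \<and> (\<forall>x. G x \<ge> 0) \<and>
           (AE x in lebesgue. (\<integral>\<^sup>+j. Lop a \<alpha> j A x \<partial>count_space UNIV) \<le> ennreal (G x)))"
    and "\<exists>C>0. \<forall>A j x. is_block u v A \<longrightarrow> dav j (\<lambda>y. ennreal (osc_weight a j y * \<bar>A y\<bar>)) x \<le> ennreal (C * vol TYPE('n) j powr (-1/u))"
proof -
  interpret ad1: adams "TYPE('n)" \<alpha> u v z w \<kappa> s t 1 by (rule ad)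
  have st: "s > 1" "t > 1" "1/s + 1/t = 1" using ad1.s ad1.t ad1.st by auto
  obtain B where B: "B > 0" "\<And>j x. dav j (\<lambda>y. ennreal (osc_weight a j y powr t)) x \<le> ennreal B"
    using osc_weight_moment[OF st(2)] by blast
  define Y where "Y A j x = enn2real (dav j (\<lambda>y. ennreal (osc_weight a j y * \<bar>A y\<bar>)) x)" for A :: "real^'n \<Rightarrow> real" and j x
  define aA where "aA A j x = enn2real (dav j (\<lambda>y. ennreal (\<bar>A y\<bar> powr s)) x) powr (1/s)" for A :: "real^'n \<Rightarrow> real" and j x
  have fin: "dav j (\<lambda>y. ennreal (\<bar>A y\<bar> powr s)) x < \<infinity>" if "is_block u v A" for A :: "real^'n \<Rightarrow> real" and j x
    by (rule le_less_trans[OF block_dav_bound[OF that]]) (use ad1.s ad1.u in auto)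
  have Yle: "dav j (\<lambda>y. ennreal (osc_weight a j y * \<bar>A y\<bar>)) x \<le> ennreal (2 * B powr (1/t) * aA A j x)" if "is_block u v A" for A j x
    unfolding aA_def by (rule weighted_dav[OF st B block_measurable[OF that] fin[OF that]])
  have Y: "dav j (\<lambda>y. ennreal (osc_weight a j y * \<bar>A y\<bar>)) x = ennreal (Y A j x)" if "is_block u v A" for A j x
    unfolding Y_def using le_less_trans[OF Yle[OF that]] by simp
  have Y0: "Y A j x \<ge> 0" for A j x by (simp add: Y_def)
  have aA0: "aA A j x \<ge> 0" for A j x by (simp add: aA_def)
  have Y_le: "Y A j x \<le> 2 * B powr (1/t) * aA A j x" if "is_block u v A" for A j x
    using Yle[OF that, of j x] B aA0[of A j x] unfolding Y[OF that] by (simp add: ennreal_le_iff)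
  \<comment> \<open>One factor \<open>B powr (1/t)\<close> for the weight outside the average, one
    for the weight inside, and 2 from \<open>dav_holder\<close>.\<close>
  define Kh where "Kh = 2 * B powr (1/t) * B powr (1/t)"
  have Kh: "Kh > 0" using B by (simp add: Kh_def)
  \<comment> \<open>The value 1 in the hypothesis is a placeholder: the true constant depends on the
    moment bound, which is available only once t is fixed.\<close>
  have ad': "adams TYPE('n) \<alpha> u v z w \<kappa> s t Kh" by (rule adams_Kh[OF ad Kh])
  interpret ad2: adams "TYPE('n)" \<alpha> u v z w \<kappa> s t Kh by (rule ad')
  show "\<exists>C>0. \<forall>A. is_block u v A \<longrightarrow> (\<exists>G. BS z w C G \<and> (\<forall>x. G x \<ge> 0) \<and>
           (AE x in lebesgue. (\<integral>\<^sup>+j. Lop a \<alpha> j A x \<partial>count_space UNIV) \<le> ennreal (G x)))"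
  proof (intro exI[of _ ad2.Ctot] conjI allI impI)
    show "ad2.Ctot > 0" by (rule ad2.Ctot)
    fix A :: "real^'n \<Rightarrow> real" assume A: "is_block u v A"
    have [measurable]: "A \<in> borel_measurable lebesgue" using A by (rule block_measurable)
    define h where "h j x = osc_weight a j x * (2 powr (- real_of_int j * \<alpha>) * Y A j x)" for j x
    have cY: "cinv j (Y A j)" for j unfolding Y_def by (rule cinv_enn2real_dav)
    have [measurable]: "Y A j \<in> borel_measurable lebesgue" for j by (rule cinv_borel[OF cY])
    have w0: "osc_weight a j x \<ge> 0" for j x using osc_weight_ge1[of a j x] by simp
    have "\<exists>j0 x0. adams_block \<alpha> u v z w \<kappa> s t Kh A j0 x0 h"
    proof (rule exists_adams_block[OF ad' A])
      show "h j \<in> borel_measurable lebesgue" for j unfolding h_def by measurable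
      show "h j x \<ge> 0" for j x unfolding h_def using w0 Y0 by simp
      fix j x
      define c where "c = (2 powr (- real_of_int j * \<alpha>) * Y A j x) powr t"
      have "dav j (\<lambda>y. ennreal (h j y powr t)) x = dav j (\<lambda>y. ennreal c * ennreal (osc_weight a j y powr t)) x"
      proof (rule dav_cong)
        fix y assume "y \<in> cube j x"
        then have "Y A j y = Y A j x" by (rule cinvD[OF cY])
        then have "h j y powr t = c * osc_weight a j y powr t"
          unfolding h_def c_def by (simp add: powr_mult mult_ac)
        then show "ennreal (h j y powr t) = ennreal c * ennreal (osc_weight a j y powr t)"
          by (simp add: ennreal_mult c_def)
      qed
      also have "\<dots> = ennreal c * dav j (\<lambda>y. ennreal (osc_weight a j y powr t)) x"
        by (rule dav_cmult) measurable
      also have "\<dots> \<le> ennreal c * ennreal B" by (intro mult_left_mono B) auto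
      also have "\<dots> = ennreal (c * B)" using B by (intro ennreal_mult[symmetric]) (auto simp: c_def)
      also have "\<dots> \<le> ennreal ((Kh * 2 powr (- real_of_int j * \<alpha>) * aA A j x) powr t)"
      proof (rule ennreal_leI)
        have "c * B = (2 powr (- real_of_int j * \<alpha>) * Y A j x) powr t * (B powr (1/t)) powr t"
          unfolding c_def using B st by (simp add: powr_powr)
        also have "\<dots> = (2 powr (- real_of_int j * \<alpha>) * Y A j x * B powr (1/t)) powr t"
          by (simp only: powr_mult)
        also have "\<dots> \<le> (2 powr (- real_of_int j * \<alpha>) * (2 * B powr (1/t) * aA A j x) * B powr (1/t)) powr t"
          using st Y0 Y_le[OF A] by (intro powr_mono2 mult_right_mono mult_left_mono) auto
        also have "\<dots> = (Kh * 2 powr (- real_of_int j * \<alpha>) * aA A j x) powr t"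
          unfolding Kh_def by (simp only: mult_ac)
        finally show "c * B \<le> (Kh * 2 powr (- real_of_int j * \<alpha>) * aA A j x) powr t" .
      qed
      finally show "dav j (\<lambda>y. ennreal (h j y powr t)) x \<le>
         ennreal ((Kh * 2 powr (- real_of_int j * \<alpha>) * enn2real (dav j (\<lambda>y. ennreal (\<bar>A y\<bar> powr s)) x) powr (1/s)) powr t)"
        by (simp only: aA_def)
    qed
    then obtain j0 x0 where ab: "adams_block \<alpha> u v z w \<kappa> s t Kh A j0 x0 h" by blast
    have Lh: "Lop a \<alpha> j A x = ennreal (h j x)" for j x
      unfolding Lop_def Y[OF A] h_def using w0 Y0 by (subst ennreal_mult[symmetric]) (auto simp: mult_ac)
    show "\<exists>G. BS z w ad2.Ctot G \<and> (\<forall>x. G x \<ge> 0) \<and>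
           (AE x in lebesgue. (\<integral>\<^sup>+j. Lop a \<alpha> j A x \<partial>count_space UNIV) \<le> ennreal (G x))"
      unfolding Lh by (rule adams_block.block_image[OF ab])
  qed
  define C where "C = 2 * B powr (1/t) * 2 powr (1/s)"
  show "\<exists>C>0. \<forall>A j x. is_block u v A \<longrightarrow> dav j (\<lambda>y. ennreal (osc_weight a j y * \<bar>A y\<bar>)) x \<le> ennreal (C * vol TYPE('n) j powr (-1/u))"
  proof (intro exI[of _ C] conjI allI impI)
    show "C > 0" using B by (simp add: C_def)
    fix A :: "real^'n \<Rightarrow> real" and j x assume A: "is_block u v A"
    have "enn2real (dav j (\<lambda>y. ennreal (\<bar>A y\<bar> powr s)) x) \<le> 2 * vol TYPE('n) j powr (-s/u)"
      using enn2real_mono[OF block_dav_bound[OF A, of s j x]] ad1.s ad1.u by simp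
    then have "aA A j x \<le> (2 * vol TYPE('n) j powr (-s/u)) powr (1/s)"
      unfolding aA_def using st by (intro powr_mono2) auto
    also have "\<dots> = 2 powr (1/s) * vol TYPE('n) j powr (-1/u)"
    proof -
      have "(-s/u) * (1/s) = -1/u" using st by simp
      then show ?thesis by (simp only: powr_mult powr_powr mult.assoc)
    qed
    finally have "2 * B powr (1/t) * aA A j x \<le> C * vol TYPE('n) j powr (-1/u)"
      unfolding C_def mult.assoc using B by (intro mult_left_mono) (auto simp: mult.assoc)
    then show "dav j (\<lambda>y. ennreal (osc_weight a j y * \<bar>A y\<bar>)) x \<le> ennreal (C * vol TYPE('n) j powr (-1/u))"
      using Yle[OF A, of j x] by (meson ennreal_leI order_trans)
  qed
qed

text \<open>The majorant is countably sublinear in f, so the images of the blocks add up with the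
  coefficients of any given decomposition.\<close>

theorem Lop_BS:
  assumes ad: "adams TYPE('n) \<alpha> u v z w \<kappa> s t 1"
  obtains C C' where "C > 0" "C' > 0"
    "\<And>f S. BS u v S f \<Longrightarrow> \<exists>G. BS z w (C * S) G \<and> (\<forall>x. G x \<ge> 0) \<and>
           (AE x in lebesgue. (\<integral>\<^sup>+j. Lop a \<alpha> j f x \<partial>count_space UNIV) \<le> ennreal (G x))"
    "\<And>f S j x. BS u v S f \<Longrightarrow> dav j (\<lambda>y. ennreal (osc_weight a j y * \<bar>f y\<bar>)) x \<le> ennreal (C' * S * vol TYPE('n) j powr (-1/u))"
proof -
  interpret ad1: adams "TYPE('n)" \<alpha> u v z w \<kappa> s t 1 by (rule ad)
  have zw: "1 \<le> z" "z \<le> w" using ad1.z by auto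
  from Lop_block(1)[OF ad] obtain C where C: "C > 0" and CG: "\<forall>A. is_block u v A \<longrightarrow> (\<exists>G. BS z w C G \<and> (\<forall>x. G x \<ge> 0) \<and>
           (AE x in lebesgue. (\<integral>\<^sup>+j. Lop a \<alpha> j A x \<partial>count_space UNIV) \<le> ennreal (G x)))" by blast
  from Lop_block(2)[OF ad] obtain C' where C': "C' > 0" and CW: "\<forall>A j x. is_block u v A \<longrightarrow> dav j (\<lambda>y. ennreal (osc_weight a j y * \<bar>A y\<bar>)) x \<le> ennreal (C' * vol TYPE('n) j powr (-1/u))"
    by blast
  have wle: "dav j (\<lambda>y. ennreal (osc_weight a j y * \<bar>f y\<bar>)) x \<le> (\<Sum>i. ennreal \<bar>lam i\<bar> * dav j (\<lambda>y. ennreal (osc_weight a j y * \<bar>A i y\<bar>)) x)"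
    if bd: "block_decomp u v f lam A" for f lam A j x
  proof -
    have [measurable]: "A i \<in> borel_measurable lebesgue" for i using bd by (auto simp: block_decomp_def intro: block_measurable)
    have "AE y in lebesgue. (\<lambda>i. lam i * A i y) sums f y" using bd by (simp add: block_decomp_def)
    then have "dav j (\<lambda>y. ennreal (osc_weight a j y * \<bar>f y\<bar>)) x \<le> dav j (\<lambda>y. \<Sum>i. ennreal \<bar>lam i\<bar> * ennreal (osc_weight a j y * \<bar>A i y\<bar>)) x"
    proof (intro dav_mono_AE, eventually_elim)
      case (elim y)
      have w0: "osc_weight a j y \<ge> 0" using osc_weight_ge1[of a j y] by simp
      have "(\<lambda>i. osc_weight a j y * (lam i * A i y)) sums (osc_weight a j y * f y)" using elim(2) by (rule sums_mult)
      from sums_abs_le_suminf[OF this] w0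
      have "ennreal (osc_weight a j y * \<bar>f y\<bar>) \<le> (\<Sum>i. ennreal (osc_weight a j y * (\<bar>lam i\<bar> * \<bar>A i y\<bar>)))" by (simp add: abs_mult)
      also have "\<dots> = (\<Sum>i. ennreal \<bar>lam i\<bar> * ennreal (osc_weight a j y * \<bar>A i y\<bar>))"
        using w0 by (intro suminf_cong) (simp add: mult.left_commute flip: ennreal_mult)
      finally show ?case .
    qed
    also have "\<dots> = (\<Sum>i. dav j (\<lambda>y. ennreal \<bar>lam i\<bar> * ennreal (osc_weight a j y * \<bar>A i y\<bar>)) x)"
      by (rule dav_suminf) measurable
    also have "\<dots> = (\<Sum>i. ennreal \<bar>lam i\<bar> * dav j (\<lambda>y. ennreal (osc_weight a j y * \<bar>A i y\<bar>)) x)"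
      by (intro suminf_cong dav_cmult) measurable
    finally show ?thesis .
  qed
  show thesis
  proof (rule that[OF C C'])
    fix f :: "real^'n \<Rightarrow> real" and S assume "BS u v S f"
    then obtain lam A where bd: "block_decomp u v f lam A" and le: "(\<Sum>j. \<bar>lam j\<bar>) \<le> S" by (auto simp: BS_def)
    then have blk: "is_block u v (A i)" and lam: "summable (\<lambda>i. \<bar>lam i\<bar>)" for i by (auto simp: block_decomp_def)
    have "\<forall>i. \<exists>G. BS z w C G \<and> (\<forall>x. G x \<ge> 0) \<and>
           (AE x in lebesgue. (\<integral>\<^sup>+j. Lop a \<alpha> j (A i) x \<partial>count_space UNIV) \<le> ennreal (G x))" using CG blk by blast
    from choice[OF this] obtain Gi where Gi: "\<And>i. BS z w C (Gi i)" "\<And>i x. Gi i x \<ge> 0"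
      "\<And>i. AE x in lebesgue. (\<integral>\<^sup>+j. Lop a \<alpha> j (A i) x \<partial>count_space UNIV) \<le> ennreal (Gi i x)" by blast
    define G where "G x = (\<Sum>i. \<bar>lam i\<bar> * Gi i x)" for x
    have blkG: "BS z w (\<bar>lam i\<bar> * C) (\<lambda>x. \<bar>lam i\<bar> * Gi i x)" for i using BS_scale[OF Gi(1)[of i], of "\<bar>lam i\<bar>"] by simp
    have smc: "summable (\<lambda>i. \<bar>lam i\<bar> * C)" using lam by (rule summable_mult2)
    have ae: "AE x in lebesgue. summable (\<lambda>i. \<bar>\<bar>lam i\<bar> * Gi i x\<bar>)" by (rule BS_suminf_AE[OF blkG zw smc])
    have "BS z w (\<Sum>i. \<bar>lam i\<bar> * C) G"
      by (rule BS_suminf[OF blkG zw smc])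
         (use ae in \<open>eventually_elim, auto simp: G_def intro!: summable_sums dest: summable_rabs_cancel\<close>)
    moreover have "(\<Sum>i. \<bar>lam i\<bar> * C) \<le> C * S"
    proof -
      have "(\<Sum>i. \<bar>lam i\<bar> * C) = (\<Sum>i. \<bar>lam i\<bar>) * C" by (rule suminf_mult2[OF lam, symmetric])
      also have "\<dots> \<le> S * C" using C by (intro mult_right_mono le) simp
      finally show ?thesis by (simp only: mult.commute)
    qed
    ultimately have BG: "BS z w (C * S) G" by (rule BS_mono)
    have [measurable]: "G \<in> borel_measurable lebesgue" by (rule BS_measurable[OF BG])
    have w0: "w > 0" using zw by simp
    have Babs: "BS z w (1 * (C * S)) (\<lambda>x. \<bar>G x\<bar>)" by (rule BS_dominated[OF BG _ w0]) auto
    have "AE x in lebesgue. \<forall>i. (\<integral>\<^sup>+j. Lop a \<alpha> j (A i) x \<partial>count_space UNIV) \<le> ennreal (Gi i x)"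
      unfolding AE_all_countable using Gi(3) by blast
    then have "AE x in lebesgue. (\<integral>\<^sup>+j. Lop a \<alpha> j f x \<partial>count_space UNIV) \<le> ennreal \<bar>G x\<bar>"
      using ae
    proof eventually_elim
      case (elim x)
      have "(\<integral>\<^sup>+j. Lop a \<alpha> j f x \<partial>count_space UNIV) \<le> (\<integral>\<^sup>+j. (\<Sum>i. ennreal \<bar>lam i\<bar> * Lop a \<alpha> j (A i) x) \<partial>count_space UNIV)"
      proof (rule nn_integral_mono)
        fix j
        let ?c = "ennreal (2 powr (- real_of_int j * \<alpha>) * osc_weight a j x)"
        have "Lop a \<alpha> j f x \<le> ?c * (\<Sum>i. ennreal \<bar>lam i\<bar> * dav j (\<lambda>y. ennreal (osc_weight a j y * \<bar>A i y\<bar>)) x)"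
          unfolding Lop_def by (intro mult_left_mono wle[OF bd]) simp
        also have "\<dots> = (\<Sum>i. ennreal \<bar>lam i\<bar> * Lop a \<alpha> j (A i) x)"
          unfolding Lop_def by (subst ennreal_suminf_cmult[symmetric]) (simp only: mult_ac)
        finally show "Lop a \<alpha> j f x \<le> (\<Sum>i. ennreal \<bar>lam i\<bar> * Lop a \<alpha> j (A i) x)" .
      qed
      also have "\<dots> = (\<Sum>i. \<integral>\<^sup>+j. ennreal \<bar>lam i\<bar> * Lop a \<alpha> j (A i) x \<partial>count_space UNIV)"
        by (rule nn_integral_suminf) simp
      also have "\<dots> = (\<Sum>i. ennreal \<bar>lam i\<bar> * (\<integral>\<^sup>+j. Lop a \<alpha> j (A i) x \<partial>count_space UNIV))"
        by (intro suminf_cong nn_integral_cmult) simp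
      also have "\<dots> \<le> (\<Sum>i. ennreal \<bar>lam i\<bar> * ennreal (Gi i x))"
        using elim(1) by (intro suminf_le mult_left_mono) auto
      also have "\<dots> = (\<Sum>i. ennreal (\<bar>lam i\<bar> * Gi i x))"
        using Gi(2) by (intro suminf_cong ennreal_mult[symmetric]) auto
      also have "\<dots> = ennreal (G x)"
        unfolding G_def by (rule suminf_ennreal2) (use Gi(2) elim(2) in \<open>auto dest: summable_rabs_cancel\<close>)
      also have "\<dots> \<le> ennreal \<bar>G x\<bar>" by (intro ennreal_leI) simp
      finally show ?case .
    qed
    then show "\<exists>G. BS z w (C * S) G \<and> (\<forall>x. G x \<ge> 0) \<and>
           (AE x in lebesgue. (\<integral>\<^sup>+j. Lop a \<alpha> j f x \<partial>count_space UNIV) \<le> ennreal (G x))"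
      using Babs by (intro exI[of _ "\<lambda>x. \<bar>G x\<bar>"]) simp
  next
    fix f :: "real^'n \<Rightarrow> real" and S j x assume "BS u v S f"
    then obtain lam A where bd: "block_decomp u v f lam A" and le: "(\<Sum>j. \<bar>lam j\<bar>) \<le> S" by (auto simp: BS_def)
    then have blk: "is_block u v (A i)" and lam: "summable (\<lambda>i. \<bar>lam i\<bar>)" for i by (auto simp: block_decomp_def)
    let ?V = "vol TYPE('n) j powr (-1/u)"
    have "dav j (\<lambda>y. ennreal (osc_weight a j y * \<bar>f y\<bar>)) x \<le> (\<Sum>i. ennreal \<bar>lam i\<bar> * ennreal (C' * ?V))"
      by (rule order_trans[OF wle[OF bd]]) (intro suminf_le mult_left_mono CW[rule_format] blk, auto)
    also have "\<dots> = ennreal (\<Sum>i. \<bar>lam i\<bar>) * ennreal (C' * ?V)"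
      by (subst ennreal_suminf_multc) (simp only: suminf_ennreal2[OF abs_ge_zero lam])
    also have "\<dots> = ennreal ((\<Sum>i. \<bar>lam i\<bar>) * (C' * ?V))"
      using C' suminf_nonneg[OF lam] by (intro ennreal_mult[symmetric]) auto
    also have "\<dots> \<le> ennreal (S * (C' * ?V))"
      using C' le by (intro ennreal_leI mult_right_mono) auto
    finally show "dav j (\<lambda>y. ennreal (osc_weight a j y * \<bar>f y\<bar>)) x \<le> ennreal (C' * S * ?V)" by (simp only: mult_ac)
  qed
qed

end

section \<open>Haar expansions\<close>

lemma haar1_support: "haar1 b r \<noteq> 0 \<Longrightarrow> 0 \<le> r \<and> r < 1"
  by (rule ccontr) (auto simp: haar1_def indicator_def)

lemma haarQ_support: "haarQ j m e x \<noteq> 0 \<Longrightarrow> cidx j x = m"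
proof -
  assume "haarQ j m e x \<noteq> 0"
  then have "haar1 (e i) (2 powr real_of_int j * x$i - real_of_int (m$i)) \<noteq> 0" for i
    by (auto simp: haarQ_def haar_def)
  then have "0 \<le> 2 powr real_of_int j * x$i - real_of_int (m$i) \<and> 2 powr real_of_int j * x$i - real_of_int (m$i) < 1" for i
    by (intro haar1_support)
  then show ?thesis by (auto simp: cidx_def vec_eq_iff floor_eq_iff algebra_simps)
qed

text \<open>In one variable, both Haar functions together give the kernel of averaging over half
  intervals, whereas the nonnegative one alone gives that of the full interval. The values 2 and 1
  are the reciprocals of the interval lengths.\<close>

lemma haar1_kernel:
  fixes p q :: real and k :: int
  assumes "\<lfloor>q\<rfloor> = k"
  shows "(\<Sum>b\<in>UNIV. haar1 b (p - k) * haar1 b (q - k)) = (if \<lfloor>2 * p\<rfloor> = \<lfloor>2 * q\<rfloor> then 2 else 0)"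
    and "haar1 False (p - k) * haar1 False (q - k) = (if \<lfloor>p\<rfloor> = k then 1 else 0)"
proof -
  have q: "real_of_int k \<le> q" "q < real_of_int k + 1" using assms by (auto simp: floor_eq_iff)
  have I0: "2 * (r - real_of_int k) \<in> {0..<1} \<longleftrightarrow> \<lfloor>2 * r\<rfloor> = 2 * k" for r :: real
    by (auto simp: floor_eq_iff)
  have I1: "2 * (r - real_of_int k) \<in> {1..<2} \<longleftrightarrow> \<lfloor>2 * r\<rfloor> = 2 * k + 1" for r :: real
    by (auto simp: floor_eq_iff)
  have fq: "\<lfloor>2 * q\<rfloor> = 2 * k \<or> \<lfloor>2 * q\<rfloor> = 2 * k + 1" using q by linarith
  have fp: "\<lfloor>p\<rfloor> = k \<longleftrightarrow> \<lfloor>2 * p\<rfloor> = 2 * k \<or> \<lfloor>2 * p\<rfloor> = 2 * k + 1" by linarith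
  show "(\<Sum>b\<in>UNIV. haar1 b (p - k) * haar1 b (q - k)) = (if \<lfloor>2 * p\<rfloor> = \<lfloor>2 * q\<rfloor> then 2 else 0)"
    unfolding UNIV_bool haar1_def indicator_def I0 I1 using fq by auto
  show "haar1 False (p - k) * haar1 False (q - k) = (if \<lfloor>p\<rfloor> = k then 1 else 0)"
    unfolding haar1_def indicator_def I0 I1 fp using fq by auto
qed

text \<open>Summed over all e, the tensor products factor into one-dimensional sums and give the
  kernel of averaging at level j + 1. Subtracting the missing index e = 0 subtracts the kernel at
  level j.\<close>

lemma haar_kernel:
  fixes x y :: "real^'n::finite"
  shows "(\<Sum>e\<in>haar_E. haarQ j (cidx j x) e y * haarQ j (cidx j x) e x)
     = 2 powr (real_of_int (j+1) * real CARD('n)) * indicator (cube (j+1) x) y - 2 powr (real_of_int j * real CARD('n)) * indicator (cube j x) y"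
proof -
  define p q where "p i = 2 powr real_of_int j * y$i" and "q i = 2 powr real_of_int j * x$i" for i
  define k where "k i = cidx j x $ i" for i
  have fq: "\<lfloor>q i\<rfloor> = k i" for i by (simp add: q_def k_def cidx_def)
  let ?c = "2 powr (real_of_int j * real CARD('n) / 2) :: real"
  have cc: "?c * ?c = 2 powr (real_of_int j * real CARD('n))" by (simp flip: powr_add)
  let ?t = "\<lambda>e. \<Prod>i\<in>UNIV. haar1 (e i) (p i - k i) * haar1 (e i) (q i - k i)"
  have hterm: "haarQ j (cidx j x) e y * haarQ j (cidx j x) e x = 2 powr (real_of_int j * real CARD('n)) * ?t e" for e
    unfolding cc[symmetric] by (simp add: haarQ_def haar_def p_def q_def k_def prod.distrib)
  have E: "(haar_E :: ('n \<Rightarrow> bool) set) = UNIV - {\<lambda>_. False}" by (auto simp: haar_E_def)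
  have "(\<Sum>e\<in>haar_E. ?t e) = (\<Sum>e\<in>UNIV. ?t e) - ?t (\<lambda>_. False)"
    unfolding E by (subst sum_diff1) auto
  also have "(\<Sum>e\<in>UNIV. ?t e) = (\<Prod>i\<in>UNIV. \<Sum>b\<in>UNIV. haar1 b (p i - k i) * haar1 b (q i - k i))"
    by (subst prod_sum_PiE) (auto simp: PiE_UNIV_domain)
  also have "\<dots> = (\<Prod>i\<in>UNIV. if \<lfloor>2 * p i\<rfloor> = \<lfloor>2 * q i\<rfloor> then 2 else 0)"
    by (intro prod.cong refl haar1_kernel(1) fq)
  also have "\<dots> = 2 ^ CARD('n) * indicator (cube (j+1) x) y"
  proof -
    have "2 * p i = 2 powr real_of_int (j+1) * y$i" "2 * q i = 2 powr real_of_int (j+1) * x$i" for i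
      by (simp_all add: p_def q_def powr_add)
    then have "y \<in> cube (j+1) x \<longleftrightarrow> (\<forall>i. \<lfloor>2 * p i\<rfloor> = \<lfloor>2 * q i\<rfloor>)"
      by (simp only: mem_cube cidx_def vec_eq_iff vec_lambda_beta)
    then show ?thesis by (auto simp: indicator_def)
  qed
  also have "?t (\<lambda>_. False) = (\<Prod>i\<in>UNIV. if \<lfloor>p i\<rfloor> = k i then 1 else 0)"
    by (intro prod.cong refl haar1_kernel(2) fq)
  also have "\<dots> = indicator (cube j x) y"
  proof -
    have "y \<in> cube j x \<longleftrightarrow> (\<forall>i. \<lfloor>p i\<rfloor> = k i)"
      unfolding mem_cube k_def by (simp add: cidx_def vec_eq_iff p_def)
    then show ?thesis by (auto simp: indicator_def)
  qed
  finally have "(\<Sum>e\<in>haar_E. ?t e) = 2 ^ CARD('n) * indicator (cube (j+1) x) y - indicator (cube j x) y" .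
  moreover have "(2::real) powr (real_of_int (j+1) * real CARD('n)) = 2 powr (real_of_int j * real CARD('n)) * 2 ^ CARD('n)"
    by (simp add: distrib_right powr_add powr_realpow)
  ultimately show ?thesis unfolding hterm sum_distrib_left[symmetric] by (simp add: right_diff_distrib)
qed

lemma haar1_measurable: "haar1 b \<in> borel_measurable borel"
proof -
  have I: "(\<lambda>r::real. indicator S (2 * r) :: real) \<in> borel_measurable borel" if "S \<in> sets borel" for S
    by (rule measurable_compose[OF _ borel_measurable_indicator[OF that]]) measurable
  show ?thesis
    unfolding haar1_def[abs_def] by (intro borel_measurable_add borel_measurable_times borel_measurable_const I) auto
qed

lemma haarQ_measurable [measurable]: "haarQ j m e \<in> borel_measurable lebesgue"
proof -
  have eq: "haarQ j m e = (\<lambda>x. 2 powr (real_of_int j * real CARD('a) / 2) * (\<Prod>i\<in>UNIV. haar1 (e i) (2 powr real_of_int j * x$i - real_of_int (m$i))))"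
    by (simp add: haarQ_def haar_def fun_eq_iff)
  have "haarQ j m e \<in> borel_measurable borel"
    unfolding eq
    by (intro borel_measurable_times borel_measurable_const borel_measurable_prod measurable_compose[OF _ haar1_measurable]) measurable
  then show ?thesis by (simp add: measurable_completion)
qed

lemma haarQ_bounded: "\<bar>haarQ j m e (x::real^'n::finite)\<bar> \<le> 2 powr (real_of_int j * real CARD('n) / 2)"
proof -
  have "\<bar>haar1 b r\<bar> \<le> 1" for b r by (auto simp: haar1_def indicator_def)
  then have "(\<Prod>i\<in>UNIV. \<bar>haar1 (e i) (y i)\<bar>) \<le> (\<Prod>i\<in>(UNIV::'n set). 1)" for y
    by (intro prod_mono) auto
  then show ?thesis unfolding haarQ_def haar_def abs_mult abs_prod by (simp add: mult_left_le)
qed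

lemma integrable_haarQ:
  fixes f :: "real^'n::finite \<Rightarrow> real"
  assumes f: "lint f" shows "integrable lebesgue (\<lambda>y. f y * haarQ j m e y)"
proof -
  have [measurable]: "f \<in> borel_measurable lebesgue" using f by (rule lint_measurable)
  obtain x where x: "dcube j m = cube j x" using dcube_eq_cube by blast
  let ?c = "2 powr (real_of_int j * real CARD('n) / 2) :: real"
  have "integrable lebesgue (\<lambda>y. ?c * (indicator (cube j x) y *\<^sub>R f y))"
    using lint_cube[OF f, of j x] unfolding set_integrable_def by simp
  then show ?thesis
  proof (rule Bochner_Integration.integrable_bound)
    show "AE y in lebesgue. norm (f y * haarQ j m e y) \<le> norm (?c * (indicator (cube j x) y *\<^sub>R f y))"
    proof (rule AE_I2)
      fix y
      show "norm (f y * haarQ j m e y) \<le> norm (?c * (indicator (cube j x) y *\<^sub>R f y))"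
      proof (cases "haarQ j m e y = 0")
        case False
        then have "y \<in> cube j x" using haarQ_support[OF False] by (simp add: x[symmetric] mem_dcube)
        then show ?thesis using mult_left_mono[OF haarQ_bounded[of j m e y], of "\<bar>f y\<bar>"] by (simp add: abs_mult mult.commute)
      qed simp
    qed
  qed measurable
qed

text \<open>At a given point only the cube containing it is seen, so the sum over all m has one
  possibly nonzero term. What remains is a finite sum over e, which moves under the integral and
  meets \<open>haar_kernel\<close>.\<close>

lemma haar_level:
  fixes f :: "real^'n::finite \<Rightarrow> real"
  assumes f: "lint f"
  shows "(\<Sum>e\<in>haar_E. \<Sum>\<^sub>\<infinity>m. pairing f (haarQ j m e) * haarQ j m e x) = rav (j+1) f x - rav j f x"
proof -
  let ?m = "cidx j x"
  have "(\<Sum>\<^sub>\<infinity>m. pairing f (haarQ j m e) * haarQ j m e x) = pairing f (haarQ j ?m e) * haarQ j ?m e x" for e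
  proof -
    have "(\<Sum>\<^sub>\<infinity>m. pairing f (haarQ j m e) * haarQ j m e x) = (\<Sum>\<^sub>\<infinity>m\<in>{?m}. pairing f (haarQ j m e) * haarQ j m e x)"
    proof (rule infsum_cong_neutral)
      fix m assume "m \<in> UNIV - {?m}"
      then have "cidx j x \<noteq> m" by simp
      then have "haarQ j m e x = 0" using haarQ_support by metis
      then show "pairing f (haarQ j m e) * haarQ j m e x = 0" by simp
    qed auto
    then show ?thesis by simp
  qed
  then have "(\<Sum>e\<in>haar_E. \<Sum>\<^sub>\<infinity>m. pairing f (haarQ j m e) * haarQ j m e x) = (\<Sum>e\<in>haar_E. pairing f (haarQ j ?m e) * haarQ j ?m e x)"
    by simp
  also have "\<dots> = (\<Sum>e\<in>haar_E. \<integral>y. f y * haarQ j ?m e y * haarQ j ?m e x \<partial>lebesgue)"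
    by (simp add: pairing_def)
  also have "\<dots> = (\<integral>y. (\<Sum>e\<in>haar_E. f y * haarQ j ?m e y * haarQ j ?m e x) \<partial>lebesgue)"
    by (rule Bochner_Integration.integral_sum[symmetric]) (intro integrable_mult_left integrable_haarQ f)
  also have "\<dots> = (\<integral>y. 2 powr (real_of_int (j+1) * real CARD('n)) * (indicator (cube (j+1) x) y *\<^sub>R f y) - 2 powr (real_of_int j * real CARD('n)) * (indicator (cube j x) y *\<^sub>R f y) \<partial>lebesgue)"
  proof (rule Bochner_Integration.integral_cong[OF refl])
    fix y
    have "(\<Sum>e\<in>haar_E. f y * haarQ j ?m e y * haarQ j ?m e x) = f y * (\<Sum>e\<in>haar_E. haarQ j ?m e y * haarQ j ?m e x)"
      by (simp only: sum_distrib_left mult.assoc)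
    then show "(\<Sum>e\<in>haar_E. f y * haarQ j ?m e y * haarQ j ?m e x) = 2 powr (real_of_int (j+1) * real CARD('n)) * (indicator (cube (j+1) x) y *\<^sub>R f y) - 2 powr (real_of_int j * real CARD('n)) * (indicator (cube j x) y *\<^sub>R f y)"
      unfolding haar_kernel by (simp add: right_diff_distrib mult_ac)
  qed
  also have "\<dots> = 2 powr (real_of_int (j+1) * real CARD('n)) * (LINT y:cube (j+1) x|lebesgue. f y) - 2 powr (real_of_int j * real CARD('n)) * (LINT y:cube j x|lebesgue. f y)"
    unfolding set_lebesgue_integral_def
    using lint_cube[OF f, of "j+1" x] lint_cube[OF f, of j x] unfolding set_integrable_def
    by (subst Bochner_Integration.integral_diff) (auto simp del: of_int_add)
  also have "\<dots> = rav (j+1) f x - rav j f x"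
    unfolding rav_def cube_avg_def measure_cube by (simp add: powr_minus divide_inverse del: of_int_add)
  finally show ?thesis .
qed

lemma haar_partial_eq:
  fixes f :: "real^'n::finite \<Rightarrow> real"
  assumes f: "lint f"
  shows "haar_partial (\<lambda>j m e. \<omega> j * pairing f (haarQ j m e)) M x = (\<Sum>j\<in>{- int M..int M}. \<omega> j * (rav (j+1) f x - rav j f x))"
proof -
  have "haar_partial (\<lambda>j m e. \<omega> j * pairing f (haarQ j m e)) M x
     = (\<Sum>e\<in>haar_E. \<Sum>j\<in>{- int M..int M}. \<omega> j * (\<Sum>\<^sub>\<infinity>m. pairing f (haarQ j m e) * haarQ j m e x))"
    unfolding haar_partial_def mult.assoc by (simp only: infsum_cmult_right')
  also have "\<dots> = (\<Sum>j\<in>{- int M..int M}. \<omega> j * (\<Sum>e\<in>haar_E. \<Sum>\<^sub>\<infinity>m. pairing f (haarQ j m e) * haarQ j m e x))"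
    by (subst sum.swap) (simp only: sum_distrib_left)
  finally show ?thesis unfolding haar_level[OF f] .
qed

section \<open>Abel summation and the values of the limits in the definitions\<close>

lemma sum_int_symmetric_Suc:
  fixes g :: "int \<Rightarrow> real"
  shows "(\<Sum>j\<in>{- int (Suc M)..int (Suc M)}. g j) = (\<Sum>j\<in>{- int M..int M}. g j) + g (int M + 1) + g (- int M - 1)"
proof -
  have "{- int (Suc M)..int (Suc M)} = insert (- int M - 1) (insert (int M + 1) {- int M..int M})" by auto
  then show ?thesis by simp
qed

text \<open>The induction step of \<open>abel_sum\<close> as a polynomial identity: P and Q stand
  for 2 to the powers \<alpha> and -\<alpha>, x and y for 2 to the powers -M\<alpha> and
  M\<alpha>.\<close>

lemma abel_step:
  fixes P Q x y s e0 e1 e2 e3 :: real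
  assumes "Q * P = 1"
  shows "(P - 1) * s + x * e1 - P * (y * e0) + x * Q * (e2 - e1) + y * P * (e0 - e3)
    = (P - 1) * (s + x * Q * e1 + y * P * e3) + x * Q * e2 - P * (y * P * e3)"
  using assms by algebra

text \<open>At \<alpha> = 0 the main term disappears and this is plain telescoping, the form used
  for the outer expansion of the commutator.\<close>

lemma abel_sum:
  fixes E :: "int \<Rightarrow> real"
  shows "(\<Sum>j\<in>{- int M..int M}. 2 powr (- real_of_int j * \<alpha>) * (E (j+1) - E j))
    = (2 powr \<alpha> - 1) * (\<Sum>j\<in>{- int M..int M}. 2 powr (- real_of_int j * \<alpha>) * E j)
      + 2 powr (- real M * \<alpha>) * E (int M + 1) - 2 powr \<alpha> * (2 powr (real M * \<alpha>) * E (- int M))"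
proof (induction M)
  case 0
  then show ?case by (simp add: algebra_simps)
next
  case (Suc M)
  have a: "2 powr (- real_of_int (int M + 1) * \<alpha>) = 2 powr (- real M * \<alpha>) * 2 powr (- \<alpha>)"
    "2 powr (- real_of_int (- int M - 1) * \<alpha>) = 2 powr (real M * \<alpha>) * 2 powr \<alpha>"
    "2 powr (- real (Suc M) * \<alpha>) = 2 powr (- real M * \<alpha>) * 2 powr (- \<alpha>)"
    "2 powr (real (Suc M) * \<alpha>) = 2 powr (real M * \<alpha>) * 2 powr \<alpha>"
    by (simp_all flip: powr_add add: algebra_simps)
  have b: "2 powr (- \<alpha>) * 2 powr \<alpha> = (1::real)" by (simp flip: powr_add)
  have i: "int (Suc M) + 1 = int M + 1 + 1" "- int (Suc M) = - int M - 1" "- int M - 1 + 1 = - int M" by auto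
  define P Q x y where "P = 2 powr \<alpha>" and "Q = 2 powr (-\<alpha>)" and "x = 2 powr (- real M * \<alpha>)" and "y = 2 powr (real M * \<alpha>)"
  have b': "Q * P = 1" using b by (simp add: P_def Q_def)
  show ?case
    unfolding sum_int_symmetric_Suc unfolding Suc.IH a i P_def[symmetric] Q_def[symmetric] x_def[symmetric] y_def[symmetric]
    by (rule abel_step[OF b'])
qed

lemma has_sum_symmetric:
  fixes g :: "int \<Rightarrow> real"
  assumes "(g has_sum s) UNIV"
  shows "(\<lambda>M. \<Sum>j\<in>{- int M..int M}. g j) \<longlonglongrightarrow> s"
proof -
  have "filterlim (\<lambda>M. {- int M..int M}) (finite_subsets_at_top UNIV) sequentially"
    unfolding filterlim_def le_filter_def eventually_filtermap
  proof (intro allI impI)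
    fix P :: "int set \<Rightarrow> bool" assume "eventually P (finite_subsets_at_top UNIV)"
    then obtain X where X: "finite X" "\<And>Y. finite Y \<Longrightarrow> X \<subseteq> Y \<Longrightarrow> P Y"
      unfolding eventually_finite_subsets_at_top by auto
    obtain b where b: "\<And>x. x \<in> X \<Longrightarrow> \<bar>x\<bar> \<le> b"
      using X(1) by (metis Max_ge finite_imageI imageI)
    have "P {- int M..int M}" if "M \<ge> nat b" for M
    proof (rule X(2))
      show "X \<subseteq> {- int M..int M}" using b that by (force simp: abs_le_iff)
    qed simp
    then show "eventually (\<lambda>M. P {- int M..int M}) sequentially" by (auto simp: eventually_sequentially)
  qed
  from filterlim_compose[OF assms[unfolded has_sum_def] this] show ?thesis .
qed

lemma dominated_int_sum:
  fixes g :: "int \<Rightarrow> real"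
  assumes le: "\<And>j. ennreal \<bar>g j\<bar> \<le> e j" and e: "(\<integral>\<^sup>+j. e j \<partial>count_space UNIV) \<le> ennreal r" and r: "r \<ge> 0"
  obtains s where "(g has_sum s) UNIV" "\<bar>s\<bar> \<le> r"
proof -
  have fin: "(\<Sum>j\<in>F. \<bar>g j\<bar>) \<le> r" if F: "finite F" for F
  proof -
    have "ennreal (\<Sum>j\<in>F. \<bar>g j\<bar>) = (\<Sum>j\<in>F. ennreal \<bar>g j\<bar>)" by (rule sum_ennreal[symmetric]) simp
    also have "\<dots> \<le> (\<Sum>j\<in>F. e j)" by (intro sum_mono le)
    also have "\<dots> = (\<integral>\<^sup>+j. e j \<partial>count_space F)" using F by (simp add: nn_integral_count_space_finite)
    also have "\<dots> = (\<integral>\<^sup>+j. e j * indicator F j \<partial>count_space UNIV)" by (simp add: nn_integral_count_space_indicator)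
    also have "\<dots> \<le> (\<integral>\<^sup>+j. e j \<partial>count_space UNIV)" by (intro nn_integral_mono) (auto simp: indicator_def)
    finally show ?thesis using e r by (meson ennreal_le_iff order_trans)
  qed
  have abs: "(\<lambda>j. \<bar>g j\<bar>) summable_on UNIV"
    by (rule nonneg_bdd_above_summable_on) (use fin in \<open>auto intro!: bdd_aboveI[of _ r]\<close>)
  then have norm: "(\<lambda>j. norm (g j)) summable_on UNIV" unfolding real_norm_def .
  then have sg: "g summable_on UNIV" by (rule abs_summable_summable)
  then obtain s where s: "(g has_sum s) UNIV" by (auto simp: summable_on_def)
  have "\<bar>s\<bar> \<le> r"
  proof -
    have "norm (infsum g UNIV) \<le> infsum (\<lambda>j. norm (g j)) UNIV" by (rule norm_infsum_bound[OF norm])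
    also have "\<dots> \<le> r" by (rule infsum_le_finite_sums[OF norm]) (simp only: real_norm_def fin)
    finally show ?thesis using infsumI[OF s] by simp
  qed
  with s show thesis by (rule that)
qed

lemma measure_dcube: "measure lebesgue (dcube j (m :: int^'n::finite)) = vol TYPE('n) j"
  using dcube_eq_cube[of j m] measure_cube by metis

lemma fracint_partial:
  fixes f :: "real^'n::finite \<Rightarrow> real"
  assumes f: "lint f"
  shows "haar_partial (\<lambda>j m e. measure lebesgue (dcube j m) powr (\<alpha> / real CARD('n)) * pairing f (haarQ j m e)) M x
    = (\<Sum>j\<in>{- int M..int M}. 2 powr (- real_of_int j * \<alpha>) * (rav (j+1) f x - rav j f x))"
proof -
  have "vol TYPE('n) j powr (\<alpha> / real CARD('n)) = 2 powr (- real_of_int j * \<alpha>)" for j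
  proof -
    have "- real_of_int j * real CARD('n) * (\<alpha> / real CARD('n)) = - real_of_int j * \<alpha>" by simp
    then show ?thesis by (simp only: powr_powr)
  qed
  then show ?thesis unfolding measure_dcube by (simp only: haar_partial_eq[OF f])
qed

lemma fracint_measurable:
  fixes f :: "real^'n::finite \<Rightarrow> real"
  assumes f: "lint f" shows "fracint_dyadic \<alpha> f \<in> borel_measurable lebesgue"
  unfolding fracint_dyadic_def[abs_def] fracint_partial[OF f] by measurable

text \<open>The fine boundary term is a convergent sequence times 2^(-M\<alpha>); the coarse one is
  left as a hypothesis, since its decay depends on the function. As the operator is defined by
  \<open>lim\<close>, convergence has to be established before its value means anything.\<close>

lemma fracint_eqI:
  fixes f :: "real^'n::finite \<Rightarrow> real"
  assumes f: "lint f" and \<alpha>: "\<alpha> > 0" and fine: "(\<lambda>M. rav (int M) f x) \<longlonglongrightarrow> c"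
    and coarse: "(\<lambda>M. 2 powr (real M * \<alpha>) * rav (- int M) f x) \<longlonglongrightarrow> 0"
    and s: "((\<lambda>j. 2 powr (- real_of_int j * \<alpha>) * rav j f x) has_sum s) UNIV"
  shows "fracint_dyadic \<alpha> f x = (2 powr \<alpha> - 1) * s"
proof -
  have q: "2 powr (-\<alpha>) < (1::real)" using \<alpha> by (simp add: powr_less_one)
  have "2 powr (- real M * \<alpha>) = (2 powr (-\<alpha>)) ^ M" for M
    by (simp add: powr_realpow[symmetric] powr_powr mult.commute)
  then have "(\<lambda>M. 2 powr (- real M * \<alpha>)) \<longlonglongrightarrow> (0::real)"
    using LIMSEQ_realpow_zero[of "2 powr (-\<alpha>)"] q by simp
  moreover have "(\<lambda>M. rav (int M + 1) f x) \<longlonglongrightarrow> c"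
    using LIMSEQ_Suc[OF fine] by (simp add: add.commute)
  ultimately have T1: "(\<lambda>M. 2 powr (- real M * \<alpha>) * rav (int M + 1) f x) \<longlonglongrightarrow> 0 * c" by (intro tendsto_mult)
  have T2: "(\<lambda>M. (2 powr \<alpha> - 1) * (\<Sum>j\<in>{- int M..int M}. 2 powr (- real_of_int j * \<alpha>) * rav j f x)) \<longlonglongrightarrow> (2 powr \<alpha> - 1) * s"
    by (intro tendsto_mult tendsto_const has_sum_symmetric[OF s])
  have T3: "(\<lambda>M. 2 powr \<alpha> * (2 powr (real M * \<alpha>) * rav (- int M) f x)) \<longlonglongrightarrow> 2 powr \<alpha> * 0"
    by (intro tendsto_mult[OF tendsto_const] coarse)
  note tendsto_diff[OF tendsto_add[OF T2 T1] T3]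
  then show ?thesis
    unfolding fracint_dyadic_def fracint_partial[OF f] abel_sum[where E = "\<lambda>j. rav j f x"] by (intro limI) simp
qed

text \<open>The outer Haar expansion carries no weights, so its partial sums telescope to a
  difference of two averages of F. The fine one reproduces F and the coarse one vanishes, so the
  expansion returns F itself.\<close>

lemma commutator_eqI:
  fixes a f F :: "real^'n::finite \<Rightarrow> real"
  assumes F_def: "F = (\<lambda>y. a y * fracint_dyadic \<alpha> f y - fracint_dyadic \<alpha> (\<lambda>y. a y * f y) y)"
    and F: "lint F" and fine: "(\<lambda>M. rav (int M) F x) \<longlonglongrightarrow> F x"
    and coarse: "(\<lambda>M. rav (- int M) F x) \<longlonglongrightarrow> 0"
  shows "commutator_dyadic a \<alpha> f x = F x"
proof -
  have tel: "(\<Sum>j\<in>{- int M..int M}. 1 * (rav (j+1) F x - rav j F x)) = rav (int M + 1) F x - rav (- int M) F x" for M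
    using abel_sum[where M = M and \<alpha> = 0 and E = "\<lambda>j. rav j F x"] by simp
  have "(\<lambda>M. rav (int M + 1) F x) \<longlonglongrightarrow> F x"
    using LIMSEQ_Suc[OF fine] by (simp add: add.commute)
  then have "(\<lambda>M. rav (int M + 1) F x - rav (- int M) F x) \<longlonglongrightarrow> F x - 0"
    by (intro tendsto_diff coarse)
  moreover have "haar_partial (\<lambda>j m e. pairing F (haarQ j m e)) M x = rav (int M + 1) F x - rav (- int M) F x" for M
    using haar_partial_eq[OF F, of "\<lambda>_. 1" M x] unfolding tel by simp
  then have "commutator_dyadic a \<alpha> f x = lim (\<lambda>M. rav (int M + 1) F x - rav (- int M) F x)"
    unfolding commutator_dyadic_def F_def[symmetric] by simp
  ultimately show ?thesis by (simp add: limI)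
qed

section \<open>Boundedness on block spaces\<close>

lemma abs_le_osc_weight: "\<bar>f y\<bar> \<le> osc_weight a j y * \<bar>f y\<bar>" for f :: "real^'n::finite \<Rightarrow> real"
  using mult_right_mono[OF osc_weight_ge1[of a j y], of "\<bar>f y\<bar>"] by simp

context bmo begin

text \<open>Averages of a BMO function grow at most linearly in the number of levels, which is
  harmless against the geometric decay available for averages of \<open>a * f\<close> over growing
  cubes.\<close>

lemma rav_growth: "\<bar>rav (- int M) a x\<bar> \<le> \<bar>rav 0 a x\<bar> + real M * (2 ^ CARD('n) * K)"
proof (induction M)
  case (Suc M)
  have "- int (Suc M) + 1 = - int M" by simp
  then have "\<bar>rav (- int M) a x - rav (- int (Suc M)) a x\<bar> \<le> 2 ^ CARD('n) * K"
    using rav_jump[of "- int (Suc M)" x] by simp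
  with Suc show ?case by (simp add: algebra_simps)
qed simp

lemma product_bound: "\<bar>a y * f y\<bar> \<le> (1 + \<bar>rav j a y\<bar>) * (osc_weight a j y * \<bar>f y\<bar>)"
proof -
  have "\<bar>a y\<bar> \<le> \<bar>a y - rav j a y\<bar> + \<bar>rav j a y\<bar>" by linarith
  also have "\<dots> \<le> (1 + \<bar>rav j a y\<bar>) * osc_weight a j y"
    unfolding osc_weight_def by (simp add: algebra_simps)
  finally have "\<bar>a y\<bar> * \<bar>f y\<bar> \<le> (1 + \<bar>rav j a y\<bar>) * osc_weight a j y * \<bar>f y\<bar>" by (intro mult_right_mono) auto
  then show ?thesis by (simp add: abs_mult mult.assoc)
qed

lemma product_dav:
  assumes [measurable]: "f \<in> borel_measurable lebesgue"
  shows "dav j (\<lambda>y. ennreal \<bar>a y * f y\<bar>) x \<le> ennreal (1 + \<bar>rav j a x\<bar>) * dav j (\<lambda>y. ennreal (osc_weight a j y * \<bar>f y\<bar>)) x"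
proof -
  have w0: "osc_weight a j y \<ge> 0" for y using osc_weight_ge1[of a j y] by simp
  have "dav j (\<lambda>y. ennreal \<bar>a y * f y\<bar>) x \<le> dav j (\<lambda>y. ennreal (1 + \<bar>rav j a y\<bar>) * ennreal (osc_weight a j y * \<bar>f y\<bar>)) x"
  proof (rule dav_mono)
    fix y
    have "ennreal \<bar>a y * f y\<bar> \<le> ennreal ((1 + \<bar>rav j a y\<bar>) * (osc_weight a j y * \<bar>f y\<bar>))"
      by (rule ennreal_leI[OF product_bound])
    also have "\<dots> = ennreal (1 + \<bar>rav j a y\<bar>) * ennreal (osc_weight a j y * \<bar>f y\<bar>)"
      using w0 by (intro ennreal_mult) auto
    finally show "ennreal \<bar>a y * f y\<bar> \<le> \<dots>" .
  qed
  also have "\<dots> = ennreal (1 + \<bar>rav j a x\<bar>) * dav j (\<lambda>y. ennreal (osc_weight a j y * \<bar>f y\<bar>)) x"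
    by (rule dav_mult_cinv[OF _ cinv_compose[OF cinv_rav]]) measurable
  finally show ?thesis .
qed

lemma Lop_ge_rav:
  assumes f: "lint f"
  shows "ennreal \<bar>2 powr (- real_of_int j * \<alpha>) * rav j f x\<bar> \<le> Lop a \<alpha> j f x"
proof -
  let ?c = "2 powr (- real_of_int j * \<alpha>) :: real" and ?D = "dav j (\<lambda>y. ennreal (osc_weight a j y * \<bar>f y\<bar>)) x"
  have "ennreal \<bar>?c * rav j f x\<bar> = ennreal ?c * ennreal \<bar>rav j f x\<bar>" by (simp add: abs_mult ennreal_mult)
  also have "\<dots> \<le> ennreal ?c * ?D"
  proof (rule mult_left_mono)
    have "ennreal \<bar>rav j f x\<bar> \<le> dav j (\<lambda>y. ennreal \<bar>f y\<bar>) x" by (rule rav_abs_dav[OF f])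
    also have "\<dots> \<le> ?D"
      by (intro dav_mono ennreal_leI abs_le_osc_weight)
    finally show "ennreal \<bar>rav j f x\<bar> \<le> ?D" .
  qed simp
  also have "\<dots> \<le> Lop a \<alpha> j f x"
    unfolding Lop_def using osc_weight_ge1[of a j x] by (intro mult_right_mono ennreal_leI) auto
  finally show ?thesis .
qed

text \<open>The commutator does not change when a constant is subtracted from \<open>a\<close>. With
  the average over the level j cube of x as the constant, both \<open>a x\<close> and the values
  under the average become oscillations covered by the weight.\<close>

lemma Lop_ge_commutator:
  assumes f: "lint f" and af: "lint (\<lambda>y. a y * f y)"
  shows "ennreal \<bar>2 powr (- real_of_int j * \<alpha>) * (a x * rav j f x - rav j (\<lambda>y. a y * f y) x)\<bar> \<le> Lop a \<alpha> j f x"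
proof -
  let ?c = "2 powr (- real_of_int j * \<alpha>) :: real" and ?D = "dav j (\<lambda>y. ennreal (osc_weight a j y * \<bar>f y\<bar>)) x"
  define k where "k = rav j a x"
  have g: "lint (\<lambda>y. a y * f y - k * f y)" by (intro lint_minus af lint_cmult f)
  have eq: "a x * rav j f x - rav j (\<lambda>y. a y * f y) x = (a x - k) * rav j f x - rav j (\<lambda>y. a y * f y - k * f y) x"
    by (simp add: rav_diff[OF af lint_cmult[OF f]] rav_cmult algebra_simps)
  have 1: "ennreal \<bar>rav j f x\<bar> \<le> ?D"
  proof -
    have "ennreal \<bar>rav j f x\<bar> \<le> dav j (\<lambda>y. ennreal \<bar>f y\<bar>) x" by (rule rav_abs_dav[OF f])
    also have "\<dots> \<le> ?D"
      by (intro dav_mono ennreal_leI abs_le_osc_weight)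
    finally show ?thesis .
  qed
  have 2: "ennreal \<bar>rav j (\<lambda>y. a y * f y - k * f y) x\<bar> \<le> ?D"
  proof -
    have "ennreal \<bar>rav j (\<lambda>y. a y * f y - k * f y) x\<bar> \<le> dav j (\<lambda>y. ennreal \<bar>a y * f y - k * f y\<bar>) x" by (rule rav_abs_dav[OF g])
    also have "\<dots> \<le> ?D"
    proof (intro dav_mono ennreal_leI)
      fix y assume "y \<in> cube j x"
      then have "k = rav j a y" unfolding k_def by (simp add: cinvD[OF cinv_rav])
      then have "\<bar>a y * f y - k * f y\<bar> = \<bar>a y - rav j a y\<bar> * \<bar>f y\<bar>" by (simp add: abs_mult flip: left_diff_distrib)
      also have "\<dots> \<le> osc_weight a j y * \<bar>f y\<bar>" unfolding osc_weight_def by (intro mult_right_mono) auto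
      finally show "\<bar>a y * f y - k * f y\<bar> \<le> osc_weight a j y * \<bar>f y\<bar>" .
    qed
    finally show ?thesis .
  qed
  have "\<bar>a x * rav j f x - rav j (\<lambda>y. a y * f y) x\<bar> \<le> \<bar>a x - k\<bar> * \<bar>rav j f x\<bar> + \<bar>rav j (\<lambda>y. a y * f y - k * f y) x\<bar>"
    unfolding eq abs_mult[symmetric] by (rule abs_triangle_ineq4)
  then have "ennreal \<bar>a x * rav j f x - rav j (\<lambda>y. a y * f y) x\<bar> \<le> ennreal (\<bar>a x - k\<bar> * \<bar>rav j f x\<bar> + \<bar>rav j (\<lambda>y. a y * f y - k * f y) x\<bar>)"
    by (rule ennreal_leI)
  also have "\<dots> = ennreal \<bar>a x - k\<bar> * ennreal \<bar>rav j f x\<bar> + ennreal \<bar>rav j (\<lambda>y. a y * f y - k * f y) x\<bar>"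
    by (simp add: ennreal_mult ennreal_plus)
  also have "\<dots> \<le> ennreal \<bar>a x - k\<bar> * ?D + ?D" by (intro add_mono mult_left_mono 1 2) simp
  also have "\<dots> = ennreal (osc_weight a j x) * ?D"
    unfolding osc_weight_def k_def by (simp add: ennreal_plus distrib_right add.commute)
  finally have "ennreal ?c * ennreal \<bar>a x * rav j f x - rav j (\<lambda>y. a y * f y) x\<bar> \<le> ennreal ?c * (ennreal (osc_weight a j x) * ?D)"
    by (intro mult_left_mono) auto
  also have "\<dots> = Lop a \<alpha> j f x"
    unfolding Lop_def using osc_weight_ge1[of a j x] by (simp add: ennreal_mult mult.assoc)
  finally show ?thesis by (simp add: abs_mult ennreal_mult)
qed

theorem dyadic_operators_BS:
  assumes ad: "adams TYPE('n) \<alpha> u v z w \<kappa> s t 1"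
  obtains C where "C > 0"
    "\<And>(f::real^'n \<Rightarrow> real) S. BS u v S f \<Longrightarrow> BS z w (C * S) (fracint_dyadic \<alpha> f)"
    "\<And>(f::real^'n \<Rightarrow> real) S. BS u v S f \<Longrightarrow> BS z w (C * S) (commutator_dyadic a \<alpha> f)"
proof -
  interpret ad1: adams "TYPE('n)" \<alpha> u v z w \<kappa> s t 1 by (rule ad)
  have zw: "1 \<le> z" "z \<le> w" and uv: "1 \<le> u" "u \<le> v" and w0: "w > 0" using ad1.z ad1.u by auto
  show thesis
  proof (rule Lop_BS[OF ad])
    fix C C' :: real
    assume C: "C > 0" "C' > 0"
      and LG: "\<And>(f :: real^'n \<Rightarrow> real) S. BS u v S f \<Longrightarrow> \<exists>G. BS z w (C * S) G \<and> (\<forall>x. G x \<ge> 0) \<and>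
             (AE x in lebesgue. (\<integral>\<^sup>+j. Lop a \<alpha> j f x \<partial>count_space UNIV) \<le> ennreal (G x))"
      and LW: "\<And>(f :: real^'n \<Rightarrow> real) S j x. BS u v S f \<Longrightarrow> dav j (\<lambda>y. ennreal (osc_weight a j y * \<bar>f y\<bar>)) x \<le> ennreal (C' * S * vol TYPE('n) j powr (-1/u))"
    define c where "c = 2 powr \<alpha> - 1"
    have c: "c > 0" unfolding c_def using ad1.\<alpha> by (simp add: gr_one_powr)
    have main: "BS z w (c * (C * S)) (fracint_dyadic \<alpha> f) \<and> BS z w (c * (C * S)) (commutator_dyadic a \<alpha> f)"
      if f: "BS u v S f" for f S
    proof -
      have lf: "lint f" by (rule BS_lint[OF f uv])
      have [measurable]: "f \<in> borel_measurable lebesgue" by (rule lint_measurable[OF lf])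
      define af where "af y = a y * f y" for y
      have [measurable]: "af \<in> borel_measurable lebesgue" unfolding af_def by measurable
      have afd: "dav j (\<lambda>y. ennreal \<bar>af y\<bar>) x \<le> ennreal (1 + \<bar>rav j a x\<bar>) * ennreal (C' * S * vol TYPE('n) j powr (-1/u))" for j x
        unfolding af_def
      proof (rule order_trans[OF product_dav])
        show "ennreal (1 + \<bar>rav j a x\<bar>) * dav j (\<lambda>y. ennreal (osc_weight a j y * \<bar>f y\<bar>)) x
            \<le> ennreal (1 + \<bar>rav j a x\<bar>) * ennreal (C' * S * vol TYPE('n) j powr (-1/u))"
          by (rule mult_left_mono[OF LW[OF f]]) simp
      qed (fact \<open>f \<in> borel_measurable lebesgue\<close>)
      have laf: "lint af"
        unfolding lint_def using le_less_trans[OF afd] by (auto simp: ennreal_mult_less_top)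
      have S0: "S \<ge> 0" by (rule BS_nonneg[OF f])
      \<comment> \<open>The exponent equals -n/z by \<open>e3\<close>, so q < 1: averages over
        growing cubes decay faster than the factor 2^(M\<alpha>) grows.\<close>
      define q where "q = 2 powr (\<alpha> - real CARD('n) / u)"
      have q: "0 < q" "q < 1"
      proof -
        have "0 < real CARD('n) * (1/z)" using ad1.z by simp
        then have "\<alpha> < real CARD('n) / u" unfolding ad1.e3 by (simp add: right_diff_distrib)
        then show "0 < q" "q < 1" unfolding q_def by (simp_all add: powr_less_one)
      qed
      have qM: "2 powr (real M * \<alpha>) * vol TYPE('n) (- int M) powr (-1/u) = q ^ M" for M
      proof -
        have "q ^ M = q powr real M" by (rule powr_realpow[OF q(1), symmetric])
        also have "\<dots> = 2 powr ((\<alpha> - real CARD('n) / u) * real M)" by (simp only: q_def powr_powr)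
        also have "(\<alpha> - real CARD('n) / u) * real M = real M * \<alpha> + (- real_of_int (- int M) * real CARD('n)) * (-1/u)"
          by (simp add: algebra_simps)
        finally show ?thesis by (simp only: powr_add powr_powr)
      qed
      have f_coarse: "(\<lambda>M. 2 powr (real M * \<alpha>) * rav (- int M) f x) \<longlonglongrightarrow> 0" for x
      proof (rule Lim_null_comparison[where g = "\<lambda>M. (C' * S) * q ^ M"])
        show "(\<lambda>M. (C' * S) * q ^ M) \<longlonglongrightarrow> 0" by (intro tendsto_mult_right_zero LIMSEQ_realpow_zero) (use q in auto)
        have "norm (2 powr (real M * \<alpha>) * rav (- int M) f x) \<le> (C' * S) * q ^ M" for M
        proof -
          have "ennreal \<bar>rav (- int M) f x\<bar> \<le> dav (- int M) (\<lambda>y. ennreal \<bar>f y\<bar>) x" by (rule rav_abs_dav[OF lf])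
          also have "\<dots> \<le> dav (- int M) (\<lambda>y. ennreal (osc_weight a (- int M) y * \<bar>f y\<bar>)) x"
        by (intro dav_mono ennreal_leI abs_le_osc_weight)
          also have "\<dots> \<le> ennreal (C' * S * vol TYPE('n) (- int M) powr (-1/u))" by (rule LW[OF f])
          finally have "\<bar>rav (- int M) f x\<bar> \<le> C' * S * vol TYPE('n) (- int M) powr (-1/u)"
            using C S0 by (subst (asm) ennreal_le_iff) auto
          then have "2 powr (real M * \<alpha>) * \<bar>rav (- int M) f x\<bar> \<le> 2 powr (real M * \<alpha>) * (C' * S * vol TYPE('n) (- int M) powr (-1/u))"
            by (intro mult_left_mono) auto
          also have "\<dots> = (C' * S) * q ^ M" unfolding qM[symmetric] by (simp only: mult_ac)
          finally show ?thesis by (simp add: abs_mult)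
        qed
        then show "\<forall>\<^sub>F M in sequentially. norm (2 powr (real M * \<alpha>) * rav (- int M) f x) \<le> (C' * S) * q ^ M" by simp
      qed
      have af_coarse: "(\<lambda>M. 2 powr (real M * \<alpha>) * rav (- int M) af x) \<longlonglongrightarrow> 0" for x
      proof -
        define b where "b = 1 + \<bar>rav 0 a x\<bar>"
        define d where "d = 2 ^ CARD('n) * K"
        have d: "b \<ge> 0" "d \<ge> 0" using K by (auto simp: b_def d_def)
        show ?thesis
        proof (rule Lim_null_comparison[where g = "\<lambda>M. (C' * S) * (b * q ^ M + d * (real M * q ^ M))"])
          have "(\<lambda>M. (C' * S) * (b * q ^ M + d * (real M * q ^ M))) \<longlonglongrightarrow> (C' * S) * (b * 0 + d * 0)"
            by (intro tendsto_intros LIMSEQ_realpow_zero powser_times_n_limit_0) (use q in auto)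
          then show "(\<lambda>M. (C' * S) * (b * q ^ M + d * (real M * q ^ M))) \<longlonglongrightarrow> 0" by simp
          have "norm (2 powr (real M * \<alpha>) * rav (- int M) af x) \<le> (C' * S) * (b * q ^ M + d * (real M * q ^ M))" for M
          proof -
            let ?V = "vol TYPE('n) (- int M) powr (-1/u)"
            have "ennreal \<bar>rav (- int M) af x\<bar> \<le> dav (- int M) (\<lambda>y. ennreal \<bar>af y\<bar>) x" by (rule rav_abs_dav[OF laf])
            also have "\<dots> \<le> ennreal (1 + \<bar>rav (- int M) a x\<bar>) * ennreal (C' * S * ?V)" by (rule afd)
            also have "\<dots> = ennreal ((1 + \<bar>rav (- int M) a x\<bar>) * (C' * S * ?V))"
              using C S0 by (intro ennreal_mult[symmetric]) auto
            finally have "\<bar>rav (- int M) af x\<bar> \<le> (1 + \<bar>rav (- int M) a x\<bar>) * (C' * S * ?V)"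
              using C S0 by (subst (asm) ennreal_le_iff) auto
            also have "\<dots> \<le> (b + real M * d) * (C' * S * ?V)"
              using rav_growth[of M x] C S0 by (intro mult_right_mono) (auto simp: b_def d_def)
            finally have "2 powr (real M * \<alpha>) * \<bar>rav (- int M) af x\<bar> \<le> 2 powr (real M * \<alpha>) * ((b + real M * d) * (C' * S * ?V))"
              by (intro mult_left_mono) auto
            also have "\<dots> = (C' * S) * ((b + real M * d) * (2 powr (real M * \<alpha>) * ?V))" by (simp only: mult_ac)
            also have "\<dots> = (C' * S) * (b * q ^ M + d * (real M * q ^ M))" unfolding qM by (simp add: algebra_simps)
            finally show ?thesis by (simp add: abs_mult)
          qed
          then show "\<forall>\<^sub>F M in sequentially. norm (2 powr (real M * \<alpha>) * rav (- int M) af x) \<le> (C' * S) * (b * q ^ M + d * (real M * q ^ M))" by simp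
        qed
      qed
      obtain G where G: "BS z w (C * S) G" "\<And>x. G x \<ge> 0"
        and LopG: "AE x in lebesgue. (\<integral>\<^sup>+j. Lop a \<alpha> j f x \<partial>count_space UNIV) \<le> ennreal (G x)"
        using LG[OF f] by blast
      \<comment> \<open>The commutator before its outer Haar expansion;
        \<open>commutator_eqI\<close> identifies the two almost everywhere once F is known to lie in
        the target space.\<close>
      define F where "F = (\<lambda>y. a y * fracint_dyadic \<alpha> f y - fracint_dyadic \<alpha> (\<lambda>y. a y * f y) y)"
      have pointwise: "AE x in lebesgue. \<bar>fracint_dyadic \<alpha> f x\<bar> \<le> c * \<bar>G x\<bar> \<and> \<bar>F x\<bar> \<le> c * \<bar>G x\<bar>"
        using LopG dyadic_lebesgue_diff[OF lf] dyadic_lebesgue_diff[OF laf]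
      proof eventually_elim
        case (elim x)
        obtain s1 where s1: "((\<lambda>j. 2 powr (- real_of_int j * \<alpha>) * rav j f x) has_sum s1) UNIV" "\<bar>s1\<bar> \<le> G x"
          by (rule dominated_int_sum[OF Lop_ge_rav[OF lf] elim(1) G(2)])
        obtain s2 where s2: "((\<lambda>j. 2 powr (- real_of_int j * \<alpha>) * (a x * rav j f x - rav j af x)) has_sum s2) UNIV" "\<bar>s2\<bar> \<le> G x"
          unfolding af_def
          by (rule dominated_int_sum[OF Lop_ge_commutator[OF lf laf[unfolded af_def[abs_def]]] elim(1) G(2)])
        \<comment> \<open>The majorant dominates the commutator series, not the series of
          \<open>a * f\<close> itself. The latter is recovered as \<open>a x\<close> times the
          series of f minus the commutator series, and with it the convergence that
          \<open>fracint_eqI\<close> requires.\<close>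
        have "((\<lambda>j. a x * (2 powr (- real_of_int j * \<alpha>) * rav j f x) + (-1) * (2 powr (- real_of_int j * \<alpha>) * (a x * rav j f x - rav j af x))) has_sum (a x * s1 + (-1) * s2)) UNIV"
          by (intro has_sum_add has_sum_cmult_right s1 s2)
        moreover have "a x * (2 powr (- real_of_int j * \<alpha>) * rav j f x) + (-1) * (2 powr (- real_of_int j * \<alpha>) * (a x * rav j f x - rav j af x)) = 2 powr (- real_of_int j * \<alpha>) * rav j af x" for j
          by (simp add: algebra_simps)
        ultimately have s3: "((\<lambda>j. 2 powr (- real_of_int j * \<alpha>) * rav j af x) has_sum (a x * s1 - s2)) UNIV" by simp
        have f1: "fracint_dyadic \<alpha> f x = c * s1" unfolding c_def by (rule fracint_eqI[OF lf ad1.\<alpha> elim(2) f_coarse s1(1)])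
        have f2: "fracint_dyadic \<alpha> af x = c * (a x * s1 - s2)" unfolding c_def by (rule fracint_eqI[OF laf ad1.\<alpha> elim(3) af_coarse s3])
        have "F x = a x * fracint_dyadic \<alpha> f x - fracint_dyadic \<alpha> af x" by (simp add: F_def af_def[abs_def])
        also have "\<dots> = c * s2" unfolding f1 f2 by (simp add: algebra_simps)
        finally have "F x = c * s2" .
        then show ?case using f1 s1(2) s2(2) G(2)[of x] c by (simp add: abs_mult)
      qed
      have [measurable]: "fracint_dyadic \<alpha> f \<in> borel_measurable lebesgue" by (rule fracint_measurable[OF lf])
      have "fracint_dyadic \<alpha> (\<lambda>y. a y * f y) \<in> borel_measurable lebesgue"
        using fracint_measurable[OF laf] by (simp add: af_def[abs_def])
      then have [measurable]: "F \<in> borel_measurable lebesgue" unfolding F_def by measurable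
      have fBS: "BS z w (c * (C * S)) (fracint_dyadic \<alpha> f)"
        by (rule BS_dominated[OF G(1) _ w0 c]) (use pointwise in \<open>auto elim: eventually_mono\<close>)
      have FBS: "BS z w (c * (C * S)) F"
        by (rule BS_dominated[OF G(1) _ w0 c]) (use pointwise in \<open>auto elim: eventually_mono\<close>)
      have lF: "lint F" by (rule BS_lint[OF FBS zw])
      define q' where "q' = 2 powr (- real CARD('n) / z)"
      have q': "0 < q'" "q' < 1" unfolding q'_def using ad1.z by (simp_all add: powr_less_one)
      have F_coarse: "(\<lambda>M. rav (- int M) F x) \<longlonglongrightarrow> 0" for x
      proof (rule Lim_null_comparison[where g = "\<lambda>M. (2 * (c * (C * S))) * q' ^ M"])
        show "(\<lambda>M. (2 * (c * (C * S))) * q' ^ M) \<longlonglongrightarrow> 0" by (intro tendsto_mult_right_zero LIMSEQ_realpow_zero) (use q' in auto)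
        have "norm (rav (- int M) F x) \<le> (2 * (c * (C * S))) * q' ^ M" for M
        proof -
          have "ennreal \<bar>rav (- int M) F x\<bar> \<le> dav (- int M) (\<lambda>y. ennreal \<bar>F y\<bar>) x" by (rule rav_abs_dav[OF lF])
          also have "\<dots> \<le> ennreal (2 * (c * (C * S)) * vol TYPE('n) (- int M) powr (-1/z))" by (rule BS_dav[OF FBS zw])
          finally have "\<bar>rav (- int M) F x\<bar> \<le> 2 * (c * (C * S)) * vol TYPE('n) (- int M) powr (-1/z)"
            using C S0 c by (subst (asm) ennreal_le_iff) auto
          also have "vol TYPE('n) (- int M) powr (-1/z) = q' ^ M"
          proof -
            have "q' ^ M = q' powr real M" by (rule powr_realpow[OF q'(1), symmetric])
            also have "\<dots> = 2 powr ((- real CARD('n) / z) * real M)" by (simp only: q'_def powr_powr)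
            also have "(- real CARD('n) / z) * real M = - real_of_int (- int M) * real CARD('n) * (-1/z)" by simp
            finally show ?thesis by (simp only: powr_powr)
          qed
          finally show ?thesis by simp
        qed
        then show "\<forall>\<^sub>F M in sequentially. norm (rav (- int M) F x) \<le> (2 * (c * (C * S))) * q' ^ M" by simp
      qed
      have "AE x in lebesgue. F x = commutator_dyadic a \<alpha> f x"
        using dyadic_lebesgue_diff[OF lF] by eventually_elim (rule commutator_eqI[OF F_def lF _ F_coarse, symmetric])
      then have "BS z w (c * (C * S)) (commutator_dyadic a \<alpha> f)" by (rule BS_cong_AE[OF FBS])
      with fBS show ?thesis by blast
    qed
    show thesis
    proof (rule that[of "c * C"])
      show "c * C > 0" using c C by simp
    qed (use main in \<open>auto simp: mult.assoc\<close>)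
  qed
qed

end

text \<open>Conjugation turns the two ratios p/p0 and r/r0 into the same \<kappa> in both exponent
  relations, and the Sobolev relation for r0 and p0 into the one for their conjugates.\<close>

lemma adams_exponents:
  fixes \<alpha> r r0 p p0 :: real
  assumes "0 < \<alpha>" "\<alpha> < real CARD('n::finite)" and r: "1 < r" "r \<le> r0" and p: "1 < p" "p \<le> p0"
    and r0: "1 / r0 = 1 / p0 - \<alpha> / real CARD('n)" and rp: "r / r0 = p / p0"
  obtains s t where "adams TYPE('n) \<alpha> (conj_exp r0) (conj_exp r) (conj_exp p0) (conj_exp p) (1 - p / p0) s t 1"
proof -
  have inv: "1 / conj_exp x = 1 - 1/x" and gt1: "1 < conj_exp x" if "1 < x" for x
    using that by (auto simp: conj_exp_def field_simps)
  have mono: "conj_exp y \<le> conj_exp x" if "1 < x" "x \<le> y" for x y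
    using that by (auto simp: conj_exp_def field_simps)
  have r0': "1 < r0" and p0': "1 < p0" using r p by auto
  define \<theta> where "\<theta> = p / p0"
  have \<theta>: "0 < \<theta>" "\<theta> \<le> 1" "r = \<theta> * r0" "p = \<theta> * p0" using p p0' rp r0' by (auto simp: \<theta>_def field_simps)
  \<comment> \<open>The midpoint between 1 and two upper bounds: s < r0' is responsible for the
    decay at coarse levels, and s < p is equivalent to p' < t, which lets the moments of the weights
    be used.\<close>
  define s where "s = (1 + min (conj_exp r0) p) / 2"
  define t where "t = s / (s - 1)"
  have m1: "1 < min (conj_exp r0) p" using gt1[OF r0'] p by simp
  then have s: "1 < s" "s < conj_exp r0" "s < p" unfolding s_def by (auto simp: min_def field_simps split: if_splits)
  have "adams TYPE('n) \<alpha> (conj_exp r0) (conj_exp r) (conj_exp p0) (conj_exp p) (1 - p / p0) s t 1"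
  proof
    show "1 / conj_exp r0 - 1 / conj_exp r = (1 - p/p0) * (1 - 1 / conj_exp r)"
      unfolding inv[OF r0'] inv[OF r(1)] rp[symmetric] using r r0' by (simp add: field_simps)
    show "1 / conj_exp p0 - 1 / conj_exp p = (1 - p/p0) * (1 - 1 / conj_exp p)"
      unfolding inv[OF p0'] inv[OF p(1)] using p p0' by (simp add: field_simps)
    show "1 / conj_exp p0 = 1 / conj_exp r0 - \<alpha> / real CARD('n)"
      unfolding inv[OF p0'] inv[OF r0'] using r0 by simp
    show "1/s + 1/t = 1" using s by (simp add: t_def field_simps)
    show "conj_exp p < t"
      unfolding t_def conj_exp_def using s p by (simp add: field_simps)
    show "0 \<le> 1 - p/p0" "1 - p/p0 < 1" using p by (auto simp: field_simps)
  qed (use assms s gt1 mono r0' p0' in auto)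
  then show thesis by (rule that)
qed

theorem theorem6:
  fixes \<alpha> r r0 p p0 :: real and a :: "real^'n::finite \<Rightarrow> real"
  assumes "0 < \<alpha>" "\<alpha> < real CARD('n)"
    and "1 < r" "r \<le> r0" "1 < p" "p \<le> p0"
    and "1 / r0 = 1 / p0 - \<alpha> / real CARD('n)"
    and "r / r0 = p / p0"
    and "dyadic_BMO a"
  shows "(\<exists>C>0. \<forall>f::real^'n \<Rightarrow> real. in_block_space (conj_exp r0) (conj_exp r) f \<and> Lp_mem (conj_exp r0) f \<longrightarrow>
            in_block_space (conj_exp p0) (conj_exp p) (fracint_dyadic \<alpha> f) \<and>
            block_norm (conj_exp p0) (conj_exp p) (fracint_dyadic \<alpha> f)
              \<le> C * block_norm (conj_exp r0) (conj_exp r) f)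
       \<and> (\<exists>C>0. \<forall>f::real^'n \<Rightarrow> real. in_block_space (conj_exp r0) (conj_exp r) f \<and> Lp_mem (conj_exp r0) f \<longrightarrow>
            in_block_space (conj_exp p0) (conj_exp p) (commutator_dyadic a \<alpha> f) \<and>
            block_norm (conj_exp p0) (conj_exp p) (commutator_dyadic a \<alpha> f)
              \<le> C * block_norm (conj_exp r0) (conj_exp r) f)"
proof -
  obtain K where bmo: "bmo a K" using dyadic_BMO_bmo[OF assms(9)] ..
  obtain s t where ad: "adams TYPE('n) \<alpha> (conj_exp r0) (conj_exp r) (conj_exp p0) (conj_exp p) (1 - p / p0) s t 1"
    by (rule adams_exponents[OF assms(1-8)])
  show ?thesis
  proof (rule bmo.dyadic_operators_BS[OF bmo ad])
    fix C :: real
    assume C: "C > 0"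
      and I: "\<And>(f::real^'n \<Rightarrow> real) S. BS (conj_exp r0) (conj_exp r) S f \<Longrightarrow> BS (conj_exp p0) (conj_exp p) (C * S) (fracint_dyadic \<alpha> f)"
      and J: "\<And>(f::real^'n \<Rightarrow> real) S. BS (conj_exp r0) (conj_exp r) S f \<Longrightarrow> BS (conj_exp p0) (conj_exp p) (C * S) (commutator_dyadic a \<alpha> f)"
    show ?thesis
      using BS_bounded_operator[OF C I] BS_bounded_operator[OF C J] C by blast
  qed
qed

end
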